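(* Let $r \geq 2$ and let $X \subseteq \mathbb{P}^N$ be an irreducible nondegenerate variety such that $\sigma_r(X)$ is a hypersurface. Let $z \in X$. If $\operatorname{mult}_{\sigma_r(X)}(z) \leq \deg(\sigma_r(X)) - 2$, then a generic line $L$ through $z$ is a line with a secant double drop for $\sigma_{r+1}(X)$.
   Context: We work over $\mathbb{C}$; varieties are projective algebraic varieties, and nondegenerate means not contained in a hyperplane. For a variety $X \subseteq \mathbb{P}^N$ and $p \in \mathbb{P}^N$, the $X$-rank $\mathrm{R}_X(p)$ is the minimum $r$ such that $p$ lies in the projective linear span of some $z_1,\dots,z_r \in X$. The $r$-th secant variety $\sigma_r(X)$ is the Zariski closure of $\{p \in \mathbb{P}^N : \mathrm{R}_X(p) \leq r\}$. A hypersurface is a variety of dimension $N-1$ in $\mathbb{P}^N$; its degree is the degree of a generator of its (principal, radical) homogeneous ideal. For a hypersurface $S$ with equation $f$ and $p \in S$, the multiplicity $\operatorname{mult}_S(p)$ is the degree of the tangent cone to $S$ at $p$; equivalently, the largest $k$ with $f \in \mathfrak{m}_p^k$, where $\mathfrak{m}_p$ is the ideal of $p$. For $r \geq 2$, a line $L \subseteq \mathbb{P}^N$ is a line with a secant double drop for $\sigma_{r+1}(X)$ if: (1) there exists $z \in L \cap X$; (2) there exist distinct elements $q_0,q_1 \in L \cap \sigma_r(X)$, both distinct from $z$; (3) $L \not\subseteq \sigma_r(X)$. "A generic line through $z$" means every line in some nonempty Zariski-open subset of the projective space of lines through $z$. *)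

theory Defs
  imports "HOL-Analysis.Analysis" "HOL-Library.Poly_Mapping"
begin

section \<open>Projective space\<close>

text \<open>
  With CARD('n) = N + 1, the projective space P^N is the set of lines through the origin of the
  complex vector space \<open>complex ^ 'n\<close>. Points are represented by these one-dimensional subspaces
  themselves (as sets of vectors, including the zero vector).
\<close>

type_synonym 'n ppoint = "(complex ^ 'n) set"

definition proj_space :: "'n::finite ppoint set" where
  "proj_space = {vec.span {v} |v. v \<noteq> 0}"

definition proj_linear :: "(complex ^ 'n::finite) set \<Rightarrow> 'n ppoint set" where
  "proj_linear W = {p \<in> proj_space. p \<subseteq> W}"

definition proj_line :: "'n::finite ppoint set \<Rightarrow> bool" where
  "proj_line L \<longleftrightarrow> (\<exists>W. vec.subspace W \<and> vec.dim W = 2 \<and> L = proj_linear W)"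

definition hyperplane :: "'n::finite ppoint set \<Rightarrow> bool" where
  "hyperplane H \<longleftrightarrow> (\<exists>W. vec.subspace W \<and> vec.dim W + 1 = CARD('n) \<and> H = proj_linear W)"


section \<open>Polynomials in N + 1 variables\<close>

text \<open>A polynomial maps each exponent vector (monomial) to its coefficient.\<close>

type_synonym 'n cpoly = "('n \<Rightarrow>\<^sub>0 nat) \<Rightarrow>\<^sub>0 complex"

definition poly_eval :: "'n::finite cpoly \<Rightarrow> complex ^ 'n \<Rightarrow> complex" where
  "poly_eval f v =
     (\<Sum>m\<in>Poly_Mapping.keys f.
        Poly_Mapping.lookup f m * (\<Prod>i\<in>UNIV. (v $ i) ^ Poly_Mapping.lookup m i))"

definition monom_degree :: "('n::finite \<Rightarrow>\<^sub>0 nat) \<Rightarrow> nat" where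
  "monom_degree m = (\<Sum>i\<in>UNIV. Poly_Mapping.lookup m i)"

definition homogeneous_poly :: "'n::finite cpoly \<Rightarrow> bool" where
  "homogeneous_poly f \<longleftrightarrow> (\<exists>d. \<forall>m\<in>Poly_Mapping.keys f. monom_degree m = d)"

definition poly_degree :: "'n::finite cpoly \<Rightarrow> nat" where
  "poly_degree f = Max (insert 0 (monom_degree ` Poly_Mapping.keys f))"

text \<open>The ideal generated by a set is its span in the ring regarded as a module over itself.\<close>

definition ideal_span :: "'a::comm_ring_1 set \<Rightarrow> 'a set" where
  "ideal_span B = module.span (*) B"

definition ideal_power :: "'a::comm_ring_1 set \<Rightarrow> nat \<Rightarrow> 'a set" where
  "ideal_power I k = ideal_span {(\<Prod>i<k. g i) |g. \<forall>i<k. g i \<in> I}"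


section \<open>Projective varieties\<close>

definition proj_zeros :: "'n::finite cpoly set \<Rightarrow> 'n ppoint set" where
  "proj_zeros F = {p \<in> proj_space. \<forall>f\<in>F. \<forall>v\<in>p. poly_eval f v = 0}"

definition zariski_closed :: "'n::finite ppoint set \<Rightarrow> bool" where
  "zariski_closed Z \<longleftrightarrow> (\<exists>F. (\<forall>f\<in>F. homogeneous_poly f) \<and> Z = proj_zeros F)"

definition irreducible_variety :: "'n::finite ppoint set \<Rightarrow> bool" where
  "irreducible_variety Z \<longleftrightarrow> zariski_closed Z \<and> Z \<noteq> {} \<and>
     (\<forall>A B. zariski_closed A \<longrightarrow> zariski_closed B \<longrightarrow> Z = A \<union> B \<longrightarrow> Z = A \<or> Z = B)"

definition nondegenerate :: "'n::finite ppoint set \<Rightarrow> bool" where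
  "nondegenerate X \<longleftrightarrow> \<not> (\<exists>H. hyperplane H \<and> X \<subseteq> H)"

text \<open>
  Dimension in the Zariski topology: the supremum of the lengths n of chains
  \<open>Z 0 \<subset> \<dots> \<subset> Z n\<close> of irreducible closed subsets. Only meaningful for nonempty sets, since
  the empty set receives the value 0 here.
\<close>

definition proj_dim :: "'n::finite ppoint set \<Rightarrow> enat" where
  "proj_dim S = Sup {enat n |n. \<exists>Z :: nat \<Rightarrow> 'n ppoint set.
     (\<forall>i\<le>n. irreducible_variety (Z i) \<and> Z i \<subseteq> S) \<and> (\<forall>i<n. Z i \<subset> Z (Suc i))}"

text \<open>The dimension condition reads dim S = N - 1, where CARD('n) = N + 1.\<close>

definition hypersurface :: "'n::finite ppoint set \<Rightarrow> bool" where
  "hypersurface S \<longleftrightarrow> zariski_closed S \<and> S \<noteq> {} \<and> proj_dim S + 2 = enat CARD('n)"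

text \<open>
  The polynomials vanishing on the affine cone over S. As the ground field is infinite, this is
  the homogeneous ideal of S.
\<close>

definition vanishing_ideal :: "'n::finite ppoint set \<Rightarrow> 'n cpoly set" where
  "vanishing_ideal S = {f. \<forall>p\<in>S. \<forall>v\<in>p. poly_eval f v = 0}"

text \<open>
  A generator of the ideal of S when that ideal is principal; generators are unique up to a
  nonzero constant, so the degree and the multiplicities below do not depend on the choice.
\<close>

definition hypersurface_equation :: "'n::finite ppoint set \<Rightarrow> 'n cpoly" where
  "hypersurface_equation S = (SOME f. vanishing_ideal S = ideal_span {f})"

definition hypersurface_degree :: "'n::finite ppoint set \<Rightarrow> nat" where
  "hypersurface_degree S = poly_degree (hypersurface_equation S)"

definition hypersurface_mult :: "'n::finite ppoint set \<Rightarrow> 'n ppoint \<Rightarrow> nat" where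
  "hypersurface_mult S p =
     (GREATEST k. hypersurface_equation S \<in> ideal_power (vanishing_ideal {p}) k)"


section \<open>Ranks and secant varieties\<close>

text \<open>The rank is infinite for points outside the linear span of X.\<close>

definition X_rank :: "'n::finite ppoint set \<Rightarrow> 'n ppoint \<Rightarrow> enat" where
  "X_rank X p = Inf {enat r |r. \<exists>z :: nat \<Rightarrow> 'n ppoint.
     (\<forall>i<r. z i \<in> X) \<and> p \<in> proj_linear (vec.span (\<Union>i<r. z i))}"

definition secant_variety :: "nat \<Rightarrow> 'n::finite ppoint set \<Rightarrow> 'n ppoint set" where
  "secant_variety r X = zariski_closed hull {p \<in> proj_space. X_rank X p \<le> enat r}"

text \<open>\<open>secant_double_drop r X L\<close>: L is a line with a secant double drop for the (r+1)-st secant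
  variety of X.\<close>

definition secant_double_drop :: "nat \<Rightarrow> 'n::finite ppoint set \<Rightarrow> 'n ppoint set \<Rightarrow> bool" where
  "secant_double_drop r X L \<longleftrightarrow> proj_line L \<and>
     (\<exists>z\<in>L \<inter> X. \<exists>q0\<in>L \<inter> secant_variety r X. \<exists>q1\<in>L \<inter> secant_variety r X.
        q0 \<noteq> q1 \<and> q0 \<noteq> z \<and> q1 \<noteq> z) \<and>
     \<not> L \<subseteq> secant_variety r X"


section \<open>Generic lines through a point\<close>

definition lines_through :: "'n::finite ppoint \<Rightarrow> 'n ppoint set set" where
  "lines_through z = {L. proj_line L \<and> z \<in> L}"

text \<open>
  With V = \<open>complex ^ 'n\<close>, the projective space of lines through z is P(V / z). Its closed sets
  are the zero sets of homogeneous polynomials on V / z, i.e. of homogeneous polynomials on V that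
  are invariant under translation by vectors of z.
\<close>

definition zariski_closed_lines :: "'n::finite ppoint \<Rightarrow> 'n ppoint set set \<Rightarrow> bool" where
  "zariski_closed_lines z C \<longleftrightarrow>
     (\<exists>F. (\<forall>f\<in>F. homogeneous_poly f \<and> (\<forall>v. \<forall>w\<in>z. poly_eval f (v + w) = poly_eval f v)) \<and>
          C = {L \<in> lines_through z. \<forall>f\<in>F. \<forall>p\<in>L. \<forall>v\<in>p. poly_eval f v = 0})"

definition zariski_open_lines :: "'n::finite ppoint \<Rightarrow> 'n ppoint set set \<Rightarrow> bool" where
  "zariski_open_lines z U \<longleftrightarrow>
     U \<subseteq> lines_through z \<and> zariski_closed_lines z (lines_through z - U)"

definition generic_line_through ::
    "'n::finite ppoint \<Rightarrow> ('n ppoint set \<Rightarrow> bool) \<Rightarrow> bool" where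
  "generic_line_through z P \<longleftrightarrow> (\<exists>U. zariski_open_lines z U \<and> U \<noteq> {} \<and> (\<forall>L\<in>U. P L))"

end

theory Submission
  imports Defs
    "HOL-Library.Function_Algebras"
    "HOL-Computational_Algebra.Polynomial_Factorial"
    "HOL-Computational_Algebra.Fundamental_Theorem_Algebra"
    "HOL-Computational_Algebra.Field_as_Ring"
begin

text \<open>
  Let \<open>S\<close> be the secant variety, \<open>f\<close> an equation of \<open>S\<close> of degree \<open>d\<close>, and \<open>z\<close> the point spanned
  by a vector \<open>e\<close>. Along a line through \<open>z\<close> the equation becomes a polynomial \<open>f (v + t e)\<close> in \<open>t\<close>,
  whose roots are the points of \<open>S\<close> on the line other than \<open>z\<close>. Its degree \<open>k\<close> for general \<open>v\<close> is at
  least \<open>d\<close> minus the multiplicity of \<open>z\<close> (\<open>homog_in_ideal_power\<close>), so \<open>k \<ge> 2\<close>, and two different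
  roots exist unless the polynomial is a multiple of a \<open>k\<close>-th power. For \<open>c t\<^sup>k + b t\<^sup>k\<^sup>-\<^sup>1 + \<dots>\<close> this
  exception means that \<open>k\<^sup>2 c f = (k c t + b) f'\<close>, with the derivative taken with respect to \<open>t\<close>
  (\<open>two_roots\<close>). These are polynomial conditions on the direction of the line. They do not hold for
  all lines: otherwise one of the factors \<open>k c t + b\<close> and \<open>f'\<close> would be zero on \<open>S\<close>, hence a multiple
  of \<open>f\<close>, although its degree in \<open>t\<close> is smaller than \<open>k\<close> (\<open>root_defect_nonzero\<close>).

  This uses that \<open>S\<close> is irreducible and that its ideal is generated by one polynomial, which is where
  most of the work goes. The cone over the points of rank at most \<open>r\<close> is an \<open>r\<close>-fold sum of the
  irreducible cone over \<open>X\<close>, and sums of irreducible sets are irreducible (\<open>prime_on_sumset\<close>).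

  For the ideal, let \<open>CARD('n) = N + 1\<close> and project from a point \<open>e\<close> outside \<open>S\<close>. Some \<open>F\<close> in the ideal
  is monic in the height, the coordinate along \<open>e\<close>. A chain of \<open>N\<close> irreducible subsets of \<open>S\<close>
  provides \<open>N\<close> algebraically independent functions on the cone (\<open>alg_indep_on_irreducible_chain\<close>).
  If some nonzero polynomial that is constant along \<open>e\<close> were zero on \<open>S\<close>, then modulo the ideal the
  polynomials of degree at most \<open>n\<close> would span a space of dimension \<open>O(n\<^sup>N\<^sup>-\<^sup>1)\<close>, too small for \<open>N\<close>
  independent functions (\<open>base_fun_zero\<close>). Hence in an element of the ideal of least degree in the
  height the leading coefficient \<open>a\<close> is not zero on \<open>S\<close>, and a power of \<open>a\<close> times \<open>F\<close> is a multiple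
  of that element. By Gauss's lemma, applied on the lines of the base, where the coefficients are
  polynomials in one variable, \<open>a\<close> divides the other coefficients. The quotient is monic
  in the height, and division with remainder shows that it generates the ideal (\<open>monic_generator\<close>).
\<close>

section \<open>Polynomial functions and their restrictions to lines\<close>

inductive_set polyfun :: "(complex ^ 'n::finite \<Rightarrow> complex) set" where
  const [simp, intro]: "(\<lambda>_. c) \<in> polyfun"
| coord [simp, intro]: "(\<lambda>v. v $ i) \<in> polyfun"
| add [intro]: "f \<in> polyfun \<Longrightarrow> g \<in> polyfun \<Longrightarrow> (\<lambda>v. f v + g v) \<in> polyfun"
| mult [intro]: "f \<in> polyfun \<Longrightarrow> g \<in> polyfun \<Longrightarrow> (\<lambda>v. f v * g v) \<in> polyfun"

lemma polyfun_cmult [intro]: "f \<in> polyfun \<Longrightarrow> (\<lambda>v. c * f v) \<in> polyfun"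
  by (intro polyfun.mult polyfun.const)

lemma polyfun_minus [intro]: "f \<in> polyfun \<Longrightarrow> (\<lambda>v. - f v) \<in> polyfun"
  using polyfun_cmult[of f "-1"] by simp

lemma polyfun_diff [intro]:
  "f \<in> polyfun \<Longrightarrow> g \<in> polyfun \<Longrightarrow> (\<lambda>v. f v - g v) \<in> polyfun"
  using polyfun.add[of f "\<lambda>v. - g v"] polyfun_minus[of g] by simp

lemma polyfun_divide_const [intro]: "f \<in> polyfun \<Longrightarrow> (\<lambda>v. f v / c) \<in> polyfun"
  using polyfun_cmult[of f "inverse c"] by (simp add: divide_inverse mult.commute)

lemma polyfun_sum [intro]:
  "(\<And>i. i \<in> I \<Longrightarrow> f i \<in> polyfun) \<Longrightarrow> (\<lambda>v. \<Sum>i\<in>I. f i v) \<in> polyfun"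
  by (induction I rule: infinite_finite_induct) auto

lemma polyfun_power [intro]: "f \<in> polyfun \<Longrightarrow> (\<lambda>v. f v ^ k) \<in> polyfun"
  by (induction k) auto

lemma polyfun_prod [intro]:
  "(\<And>i. i \<in> I \<Longrightarrow> f i \<in> polyfun) \<Longrightarrow> (\<lambda>v. \<Prod>i\<in>I. f i v) \<in> polyfun"
  by (induction I rule: infinite_finite_induct) auto

lemma polyfun_compose:
  assumes "f \<in> polyfun" and "\<And>i. (\<lambda>v. \<alpha> v $ i) \<in> polyfun"
  shows "(\<lambda>v. f (\<alpha> v)) \<in> polyfun"
  using assms(1) by induction (auto intro: assms(2))

text \<open>
  Restrictions to lines reduce most questions below to polynomials in one variable. As a polynomial
  over an infinite field is determined by its values, there is at most one candidate, and for
  polynomial functions there is one.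
\<close>

definition line_poly ::
    "(complex ^ 'n::finite \<Rightarrow> complex) \<Rightarrow> complex ^ 'n \<Rightarrow> complex ^ 'n \<Rightarrow> complex poly" where
  "line_poly f u w = (THE p. \<forall>t. poly p t = f (u + t *s w))"

lemma poly_ext: "(\<And>t. poly p t = poly q t) \<Longrightarrow> p = q" for p q :: "complex poly"
  using poly_eq_poly_eq_iff by blast

lemma line_poly_eqI:
  assumes "\<And>t. poly p t = f (u + t *s w)"
  shows "line_poly f u w = p"
  unfolding line_poly_def
  by (rule the_equality) (use assms in \<open>auto intro: poly_ext\<close>)

lemma line_poly_const [simp]: "line_poly (\<lambda>_. c) u w = [:c:]"
  and line_poly_coord [simp]: "line_poly (\<lambda>v. v $ i) u w = [:u $ i, w $ i:]"
  by (rule line_poly_eqI; simp)+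

lemma polyfun_line_poly_exists:
  assumes "f \<in> polyfun"
  shows "\<exists>p. \<forall>t. poly p t = f (u + t *s w)"
  using assms
proof induction
  case (const c)
  show ?case by (rule exI[of _ "[:c:]"]) simp
next
  case (coord i)
  show ?case by (rule exI[of _ "[:u $ i, w $ i:]"]) simp
next
  case (add f g)
  then obtain p q where "\<forall>t. poly p t = f (u + t *s w)" "\<forall>t. poly q t = g (u + t *s w)"
    by blast
  then show ?case by (intro exI[of _ "p + q"]) simp
next
  case (mult f g)
  then obtain p q where "\<forall>t. poly p t = f (u + t *s w)" "\<forall>t. poly q t = g (u + t *s w)"
    by blast
  then show ?case by (intro exI[of _ "p * q"]) simp
qed

lemma poly_line_poly:
  assumes "f \<in> polyfun"
  shows "poly (line_poly f u w) t = f (u + t *s w)"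
proof -
  obtain p where p: "\<And>t. poly p t = f (u + t *s w)"
    using polyfun_line_poly_exists[OF assms] by metis
  then have "line_poly f u w = p" by (rule line_poly_eqI)
  then show ?thesis using p by simp
qed

lemma line_poly_add:
  "f \<in> polyfun \<Longrightarrow> g \<in> polyfun \<Longrightarrow>
     line_poly (\<lambda>v. f v + g v) u w = line_poly f u w + line_poly g u w"
  by (rule line_poly_eqI) (simp add: poly_line_poly)

lemma line_poly_diff:
  "f \<in> polyfun \<Longrightarrow> g \<in> polyfun \<Longrightarrow>
     line_poly (\<lambda>v. f v - g v) u w = line_poly f u w - line_poly g u w"
  by (rule line_poly_eqI) (simp add: poly_line_poly)

lemma line_poly_mult:
  "f \<in> polyfun \<Longrightarrow> g \<in> polyfun \<Longrightarrow>
     line_poly (\<lambda>v. f v * g v) u w = line_poly f u w * line_poly g u w"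
  by (rule line_poly_eqI) (simp add: poly_line_poly)

lemma line_poly_power:
  "f \<in> polyfun \<Longrightarrow> line_poly (\<lambda>v. f v ^ k) u w = line_poly f u w ^ k"
  by (rule line_poly_eqI) (simp add: poly_line_poly)

lemma line_poly_sum:
  "(\<And>i. i \<in> I \<Longrightarrow> f i \<in> polyfun) \<Longrightarrow>
     line_poly (\<lambda>v. \<Sum>i\<in>I. f i v) u w = (\<Sum>i\<in>I. line_poly (f i) u w)"
  by (rule line_poly_eqI) (simp add: poly_line_poly poly_sum)

lemma line_poly_degree_bound:
  assumes "f \<in> polyfun"
  shows "\<exists>D. \<forall>u w. degree (line_poly f u w) \<le> D"
  using assms
proof induction
  case (coord i)
  show ?case by (rule exI[of _ 1]) simp
next
  case (add f g)
  then obtain a b where "\<forall>u w. degree (line_poly f u w) \<le> a" "\<forall>u w. degree (line_poly g u w) \<le> b"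
    by blast
  then show ?case using add.hyps
    by (intro exI[of _ "max a b"]) (auto simp: line_poly_add intro!: degree_add_le intro: max.coboundedI1 max.coboundedI2)
next
  case (mult f g)
  then obtain a b where "\<forall>u w. degree (line_poly f u w) \<le> a" "\<forall>u w. degree (line_poly g u w) \<le> b"
    by blast
  then show ?case using mult.hyps
    by (intro exI[of _ "a + b"]) (auto simp: line_poly_mult intro!: order_trans[OF degree_mult_le] add_mono)
qed auto

lemma polyfun_coeff_line_poly:
  assumes "f \<in> polyfun" and \<alpha>: "\<And>i. (\<lambda>v. \<alpha> v $ i) \<in> polyfun"
    and \<beta>: "\<And>i. (\<lambda>v. \<beta> v $ i) \<in> polyfun"
  shows "(\<lambda>v. coeff (line_poly f (\<alpha> v) (\<beta> v)) j) \<in> polyfun"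
  using assms(1)
proof (induction arbitrary: j)
  case (const c)
  show ?case by (cases j) auto
next
  case (coord i)
  consider "j = 0" | "j = 1" | k where "j = Suc (Suc k)"
    by (cases j rule: nat.exhaust) (metis One_nat_def nat.exhaust)+
  then show ?case by cases (simp_all add: \<alpha> \<beta>)
next
  case (add f g)
  then show ?case by (auto simp: line_poly_add)
next
  case (mult f g)
  then show ?case by (auto simp: line_poly_mult coeff_mult intro!: polyfun_sum polyfun.mult)
qed

lemma line_poly_scale_direction:
  assumes "f \<in> polyfun"
  shows "line_poly f u (c *s w) = pcompose (line_poly f u w) [:0, c:]"
  by (rule line_poly_eqI) (simp add: poly_line_poly assms poly_pcompose vec_eq_iff algebra_simps)

lemma coeff_pcompose_scale: "coeff (pcompose p [:0, c:]) j = c ^ j * coeff p j"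
  for p :: "'a::comm_ring_1 poly"
  by (induction p arbitrary: j) (auto simp: pcompose_pCons coeff_pCons algebra_simps split: nat.splits)

definition homog :: "nat \<Rightarrow> (complex ^ 'n \<Rightarrow> complex) \<Rightarrow> bool" where
  "homog d f \<longleftrightarrow> (\<forall>c v. f (c *s v) = c ^ d * f v)"

lemma homog_cmult: "homog d f \<Longrightarrow> homog d (\<lambda>v. c * f v)"
  by (simp add: homog_def)

lemma homog_diff: "homog d f \<Longrightarrow> homog d g \<Longrightarrow> homog d (\<lambda>v. f v - g v)"
  by (simp add: homog_def algebra_simps)

lemma homog_mult: "homog d f \<Longrightarrow> homog e g \<Longrightarrow> homog (d + e) (\<lambda>v. f v * g v)"
  by (simp add: homog_def power_add)

text \<open>Expanding along the lines through the origin gives the homogeneous components.\<close>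

definition component :: "(complex ^ 'n::finite \<Rightarrow> complex) \<Rightarrow> nat \<Rightarrow> complex ^ 'n \<Rightarrow> complex" where
  "component f j v = coeff (line_poly f 0 v) j"

lemma polyfun_component [intro]: "f \<in> polyfun \<Longrightarrow> component f j \<in> polyfun"
  unfolding component_def[abs_def] by (rule polyfun_coeff_line_poly) auto

lemma homog_component: "f \<in> polyfun \<Longrightarrow> homog j (component f j)"
  by (simp add: homog_def component_def line_poly_scale_direction coeff_pcompose_scale)

lemma sum_components:
  assumes "f \<in> polyfun"
  shows "f v = (\<Sum>j\<le>degree (line_poly f 0 v). component f j v)"
  using poly_line_poly[OF assms, of 0 v 1] by (simp add: component_def poly_altdef)

lemma components_zero_iff:
  assumes "f \<in> polyfun"
  shows "(\<forall>j. component f j v = 0) \<longleftrightarrow> (\<forall>t. f (t *s v) = 0)"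
proof -
  have "(\<forall>j. component f j v = 0) \<longleftrightarrow> line_poly f 0 v = 0"
    by (simp add: component_def poly_eq_iff)
  also have "\<dots> \<longleftrightarrow> (\<forall>t. poly (line_poly f 0 v) t = 0)"
    using poly_all_0_iff_0 by blast
  finally show ?thesis by (simp add: poly_line_poly assms)
qed

text \<open>
  By comparing \<open>f (c u + t w) = c\<^sup>d f (u + (t / c) w)\<close> coefficientwise, the coefficient of \<open>t\<^sup>j\<close> is
  homogeneous of degree \<open>d - j\<close> in \<open>u\<close>; so it is zero for \<open>j > d\<close> and constant for \<open>j = d\<close>.
\<close>

lemma homog_line_poly_coeff:
  assumes f: "f \<in> polyfun" "homog d f"
  shows "c ^ j * coeff (line_poly f (c *s u) w) j = c ^ d * coeff (line_poly f u w) j"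
proof -
  have "pcompose (line_poly f (c *s u) w) [:0, c:] = smult (c ^ d) (line_poly f u w)"
  proof (rule poly_ext)
    fix t
    have "c *s u + (t * c) *s w = c *s (u + t *s w)" by (simp add: vec_eq_iff algebra_simps)
    then have "f (c *s u + (t * c) *s w) = c ^ d * f (u + t *s w)"
      using f(2) by (simp only: homog_def)
    then show "poly (pcompose (line_poly f (c *s u) w) [:0, c:]) t
        = poly (smult (c ^ d) (line_poly f u w)) t"
      by (simp add: poly_line_poly f(1) poly_pcompose)
  qed
  from arg_cong[OF this, of "\<lambda>p. coeff p j"] show ?thesis
    by (simp add: coeff_pcompose_scale)
qed

lemma homog_line_poly:
  assumes f: "f \<in> polyfun" "homog d f"
  shows "degree (line_poly f u w) \<le> d" and "coeff (line_poly f u w) d = f w"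
    and "j \<le> d \<Longrightarrow> homog (d - j) (\<lambda>u. coeff (line_poly f u w) j)"
proof -
  define b where "b j u = coeff (line_poly f u w) j" for j u
  have b: "b j \<in> polyfun" for j
    unfolding b_def[abs_def] by (rule polyfun_coeff_line_poly[OF f(1)]) auto
  have pow: "monom 1 j * line_poly (b j) 0 u = monom (b j u) d" for j u
    by (rule poly_ext)
      (use homog_line_poly_coeff[OF f, of _ j u w] in \<open>simp add: poly_line_poly b poly_monom b_def ac_simps\<close>)
  have high: "b j u = 0" if "d < j" for j u
  proof -
    have "coeff (monom 1 j * line_poly (b j) 0 u) d = 0"
      using that by (simp add: coeff_monom_mult)
    then show ?thesis by (simp add: pow)
  qed
  show "degree (line_poly f u w) \<le> d"
    using high by (intro degree_le) (simp add: b_def)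
  have low: "homog (d - j) (b j)" if "j \<le> d" for j
  proof -
    have "line_poly (b j) 0 u = monom (b j u) (d - j)" for u
    proof -
      have "monom 1 j * line_poly (b j) 0 u = monom 1 j * monom (b j u) (d - j)"
        using pow[of j u] that by (simp add: mult_monom)
      then show ?thesis by (metis mult_left_cancel monom_eq_0_iff zero_neq_one)
    qed
    then have "poly (line_poly (b j) 0 u) c = c ^ (d - j) * b j u" for c u
      by (simp add: poly_monom ac_simps)
    then show ?thesis by (simp add: homog_def poly_line_poly b)
  qed
  then show "j \<le> d \<Longrightarrow> homog (d - j) (\<lambda>u. coeff (line_poly f u w) j)"
    by (simp add: b_def[abs_def])
  have "b d u = b d 0"
    using low[of d] unfolding homog_def by (metis le_refl diff_self_eq_0 power_0 mult_1 vec.scale_zero_left)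
  moreover have "line_poly f 0 w = monom (f w) d"
    using f by (intro line_poly_eqI) (simp add: poly_monom homog_def)
  ultimately show "coeff (line_poly f u w) d = f w"
    by (simp add: b_def)
qed

text \<open>The ideal of the functions that are zero on \<open>C\<close> is prime, or the whole ring if \<open>C\<close> is empty.\<close>

definition prime_on :: "(complex ^ 'n::finite) set \<Rightarrow> bool" where
  "prime_on C \<longleftrightarrow> (\<forall>f\<in>polyfun. \<forall>g\<in>polyfun.
     (\<forall>v\<in>C. f v * g v = 0) \<longrightarrow> (\<forall>v\<in>C. f v = 0) \<or> (\<forall>v\<in>C. g v = 0))"

lemma prime_onD:
  "prime_on C \<Longrightarrow> f \<in> polyfun \<Longrightarrow> g \<in> polyfun \<Longrightarrow> (\<And>v. v \<in> C \<Longrightarrow> f v * g v = 0) \<Longrightarrow>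
     (\<forall>v\<in>C. f v = 0) \<or> (\<forall>v\<in>C. g v = 0)"
  unfolding prime_on_def by blast

text \<open>
  Join a point of \<open>W\<close> where one factor is nonzero to a point of \<open>W\<close> where the other one is: on this
  line, both factors are nonzero polynomials in one variable.
\<close>

lemma prime_on_subspace:
  fixes W :: "(complex ^ 'n::finite) set"
  assumes "vec.subspace W"
  shows "prime_on W"
  unfolding prime_on_def
proof (intro ballI impI, rule ccontr)
  fix f g :: "complex ^ 'n \<Rightarrow> complex"
  assume fg: "f \<in> polyfun" "g \<in> polyfun" "\<forall>v\<in>W. f v * g v = 0"
    and "\<not> ((\<forall>v\<in>W. f v = 0) \<or> (\<forall>v\<in>W. g v = 0))"
  then obtain u w where u: "u \<in> W" "f u \<noteq> 0" and w: "w \<in> W" "g w \<noteq> 0" by blast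
  have "u + t *s (w - u) \<in> W" for t
    using assms u w by (simp add: vec.subspace_add vec.subspace_diff vec.subspace_scale)
  then have "line_poly f u (w - u) * line_poly g u (w - u) = 0"
    using fg by (intro poly_ext) (simp add: poly_line_poly)
  then consider "line_poly f u (w - u) = 0" | "line_poly g u (w - u) = 0" by auto
  then show False
  proof cases
    case 1
    then show ?thesis using poly_line_poly[OF fg(1), of u "w - u" 0] u by simp
  next
    case 2
    then show ?thesis using poly_line_poly[OF fg(2), of u "w - u" 1] w by simp
  qed
qed

lemma polyfun_mult_eq_0:
  assumes "f \<in> polyfun" "g \<in> polyfun" "\<And>v. f v * g v = 0"
  shows "(\<forall>v. f v = 0) \<or> (\<forall>v. g v = 0)"
  using prime_onD[OF prime_on_subspace[OF vec.subspace_UNIV] assms(1,2)] assms(3) by blast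

lemma polyfun_mult_left_cancel:
  assumes "f \<in> polyfun" "g \<in> polyfun" "h \<in> polyfun" "f v0 \<noteq> 0" "\<And>v. f v * g v = f v * h v"
  shows "g v = h v"
proof -
  have "f v * (g v - h v) = 0" for v using assms(5)[of v] by (simp add: algebra_simps)
  then show ?thesis
    using polyfun_mult_eq_0[OF assms(1) polyfun_diff[OF assms(2,3)]] assms(4) by auto
qed

section \<open>Polynomials as polynomial functions\<close>

definition monomial_fun :: "('n::finite \<Rightarrow>\<^sub>0 nat) \<Rightarrow> complex ^ 'n \<Rightarrow> complex" where
  "monomial_fun m v = (\<Prod>i\<in>UNIV. (v $ i) ^ Poly_Mapping.lookup m i)"

lemma monomial_fun_add: "monomial_fun (m + m') v = monomial_fun m v * monomial_fun m' v"
  by (simp add: monomial_fun_def lookup_add power_add prod.distrib)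

lemma monomial_fun_scale: "monomial_fun m (c *s v) = c ^ monom_degree m * monomial_fun m v"
  by (simp add: monomial_fun_def monom_degree_def power_mult_distrib prod.distrib power_sum)

lemma poly_eval_superset:
  assumes "finite A" "Poly_Mapping.keys f \<subseteq> A"
  shows "poly_eval f v = (\<Sum>m\<in>A. Poly_Mapping.lookup f m * monomial_fun m v)"
  unfolding poly_eval_def monomial_fun_def
  by (rule sum.mono_neutral_left) (use assms in \<open>auto simp: in_keys_iff\<close>)

lemma poly_eval_altdef:
  "poly_eval f v = (\<Sum>m\<in>Poly_Mapping.keys f. Poly_Mapping.lookup f m * monomial_fun m v)"
  by (rule poly_eval_superset) auto

lemma poly_eval_single [simp]: "poly_eval (Poly_Mapping.single m c) v = c * monomial_fun m v"
  by (cases "c = 0") (simp_all add: poly_eval_altdef)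

lemma poly_eval_0 [simp]: "poly_eval 0 v = 0"
  by (simp add: poly_eval_def)

lemma poly_eval_1 [simp]: "poly_eval 1 v = 1"
  unfolding single_one[symmetric] poly_eval_single by (simp add: monomial_fun_def)

lemma poly_eval_add [simp]: "poly_eval (f + g) v = poly_eval f v + poly_eval g v"
proof -
  let ?A = "Poly_Mapping.keys f \<union> Poly_Mapping.keys g"
  have "Poly_Mapping.keys (f + g) \<subseteq> ?A" by (rule Poly_Mapping.keys_add)
  then show ?thesis
    by (simp add: poly_eval_superset[of ?A] lookup_add algebra_simps sum.distrib)
qed

lemma poly_eval_sum [simp]: "poly_eval (\<Sum>i\<in>I. f i) v = (\<Sum>i\<in>I. poly_eval (f i) v)"
  by (induction I rule: infinite_finite_induct) auto

lemma poly_mapping_as_sum: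
  "f = (\<Sum>m\<in>Poly_Mapping.keys f. Poly_Mapping.single m (Poly_Mapping.lookup f m))"
  by (rule poly_mapping_eqI)
    (auto simp: lookup_sum lookup_single when_def in_keys_iff)

lemma poly_eval_mult [simp]: "poly_eval (f * g) v = poly_eval f v * poly_eval g v"
proof -
  have "f * g = (\<Sum>m\<in>Poly_Mapping.keys f. \<Sum>m'\<in>Poly_Mapping.keys g.
      Poly_Mapping.single (m + m') (Poly_Mapping.lookup f m * Poly_Mapping.lookup g m'))"
    by (subst (1) poly_mapping_as_sum[of f], subst (1) poly_mapping_as_sum[of g])
      (simp add: sum_product mult_single)
  then show ?thesis
    by (simp add: poly_eval_altdef[of f] poly_eval_altdef[of g] sum_product monomial_fun_add ac_simps)
qed

lemma poly_eval_prod [simp]: "poly_eval (\<Prod>i\<in>I. f i) v = (\<Prod>i\<in>I. poly_eval (f i) v)"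
  by (induction I rule: infinite_finite_induct) auto

lemma poly_eval_power [simp]: "poly_eval (f ^ k) v = poly_eval f v ^ k"
  by (induction k) auto

lemma poly_eval_uminus [simp]: "poly_eval (- f) v = - poly_eval f v"
  using poly_eval_add[of f "- f" v] by (simp add: eq_neg_iff_add_eq_0 add.commute)

lemma poly_eval_diff [simp]: "poly_eval (f - g) v = poly_eval f v - poly_eval g v"
  using poly_eval_add[of f "- g" v] by simp

lemma monomial_fun_unit: "monomial_fun (Poly_Mapping.single i 1) v = v $ i"
proof -
  have "monomial_fun (Poly_Mapping.single i 1) v = (\<Prod>j\<in>UNIV. if j = i then v $ i else 1)"
    unfolding monomial_fun_def by (rule prod.cong) (auto simp: lookup_single when_def)
  then show ?thesis by simp
qed

lemma monomial_fun_zero [simp]: "monomial_fun 0 v = 1"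
  by (simp add: monomial_fun_def)

lemma polyfun_eq_range: "polyfun = range poly_eval"
proof (intro equalityI subsetI)
  fix f :: "complex ^ 'n \<Rightarrow> complex"
  assume "f \<in> polyfun"
  then show "f \<in> range poly_eval"
  proof induction
    case (const c)
    have "poly_eval (Poly_Mapping.single 0 c) = (\<lambda>_. c)" by (rule ext) simp
    from this[symmetric] show ?case by (rule range_eqI)
  next
    case (coord i)
    have "poly_eval (Poly_Mapping.single (Poly_Mapping.single i 1) 1) = (\<lambda>v. v $ i)"
      by (rule ext) (simp add: monomial_fun_unit[simplified])
    from this[symmetric] show ?case by (rule range_eqI)
  next
    case (add f g)
    then obtain F G where "f = poly_eval F" "g = poly_eval G" by blast
    then have "(\<lambda>v. f v + g v) = poly_eval (F + G)" by auto
    then show ?case by blast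
  next
    case (mult f g)
    then obtain F G where "f = poly_eval F" "g = poly_eval G" by blast
    then have "(\<lambda>v. f v * g v) = poly_eval (F * G)" by auto
    then show ?case by blast
  qed
next
  fix f :: "complex ^ 'n \<Rightarrow> complex"
  assume "f \<in> range poly_eval"
  then show "f \<in> polyfun"
    by (auto simp: poly_eval_def[abs_def] intro!: polyfun_sum polyfun_cmult polyfun_prod polyfun_power)
qed

lemma polyfun_poly_eval [simp, intro]: "poly_eval f \<in> polyfun"
  by (simp add: polyfun_eq_range)

text \<open>
  By induction on the set of variables: grouping the monomials by the exponent of one variable gives
  a polynomial in this variable that is identically zero, so each group is zero by itself.
\<close>

lemma monomials_independent_aux:
  fixes e :: "'m \<Rightarrow> 'n::finite \<Rightarrow> nat" and c :: "'m \<Rightarrow> complex"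
  assumes "finite I" "finite M" "m \<in> M"
    and "\<And>m m'. m \<in> M \<Longrightarrow> m' \<in> M \<Longrightarrow> (\<And>i. i \<in> I \<Longrightarrow> e m i = e m' i) \<Longrightarrow> m = m'"
    and "\<And>v :: complex ^ 'n. (\<Sum>m\<in>M. c m * (\<Prod>i\<in>I. (v $ i) ^ e m i)) = 0"
  shows "c m = 0"
  using assms
proof (induction I arbitrary: M m rule: finite_induct)
  case empty
  then have "M = {m}" by auto
  then show ?case using empty.prems by simp
next
  case (insert i I)
  define N where "N = {m'\<in>M. e m' i = e m i}"
  have "c m = 0"
  proof (rule insert.IH[of N m])
    show "finite N" "m \<in> N" using insert.prems by (auto simp: N_def)
    show "m1 = m2" if "m1 \<in> N" "m2 \<in> N" "\<And>j. j \<in> I \<Longrightarrow> e m1 j = e m2 j" for m1 m2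
    proof (rule insert.prems(3))
      show "m1 \<in> M" "m2 \<in> M" using that by (auto simp: N_def)
      show "e m1 j = e m2 j" if "j \<in> insert i I" for j
        using that \<open>m1 \<in> N\<close> \<open>m2 \<in> N\<close> \<open>\<And>j. j \<in> I \<Longrightarrow> e m1 j = e m2 j\<close> by (auto simp: N_def)
    qed
    fix v :: "complex ^ 'n"
    define q where "q m' = c m' * (\<Prod>j\<in>I. (v $ j) ^ e m' j)" for m'
    have "(\<Sum>m'\<in>M. monom (q m') (e m' i)) = 0"
    proof (rule poly_ext)
      fix t
      define w where "w = (\<chi> j. if j = i then t else v $ j)"
      have "(\<Prod>j\<in>insert i I. (w $ j) ^ e m' j) = t ^ e m' i * (\<Prod>j\<in>I. (v $ j) ^ e m' j)" for m'
      proof -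
        have "(\<Prod>j\<in>I. (w $ j) ^ e m' j) = (\<Prod>j\<in>I. (v $ j) ^ e m' j)"
          by (rule prod.cong) (use insert.hyps in \<open>auto simp: w_def\<close>)
        then show ?thesis using insert.hyps by (simp add: w_def)
      qed
      then show "poly (\<Sum>m'\<in>M. monom (q m') (e m' i)) t = poly 0 t"
        using insert.prems(4)[of w] by (simp add: poly_sum poly_monom q_def ac_simps)
    qed
    then have "coeff (\<Sum>m'\<in>M. monom (q m') (e m' i)) (e m i) = 0" by simp
    then have "(\<Sum>m'\<in>M. if e m' i = e m i then q m' else 0) = 0"
      by (simp add: coeff_sum)
    then show "(\<Sum>m'\<in>N. c m' * (\<Prod>j\<in>I. (v $ j) ^ e m' j)) = 0"
      using insert.prems(1) unfolding q_def by (simp add: N_def sum.inter_filter)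
  qed
  then show ?case .
qed

lemma monomials_independent:
  fixes M :: "('n::finite \<Rightarrow>\<^sub>0 nat) set"
  assumes "finite M" "\<And>v. (\<Sum>m\<in>M. c m * monomial_fun m v) = 0" "m \<in> M"
  shows "c m = 0"
  by (rule monomials_independent_aux[of UNIV M m Poly_Mapping.lookup c])
    (use assms in \<open>auto simp: monomial_fun_def intro: poly_mapping_eqI\<close>)

lemma poly_eval_inject: "poly_eval f = poly_eval g \<longleftrightarrow> f = g"
proof
  assume eq: "poly_eval f = poly_eval g"
  have "Poly_Mapping.lookup (f - g) m = 0" if "m \<in> Poly_Mapping.keys (f - g)" for m
    by (rule monomials_independent[OF _ _ that])
      (use eq in \<open>simp_all flip: poly_eval_altdef\<close>)
  then have "f - g = 0"
    by (metis in_keys_iff lookup_zero poly_mapping_eqI)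
  then show "f = g" by simp
qed simp

text \<open>Doubling \<open>v\<close> multiplies each monomial by its own power of 2, which has to be the \<open>d\<close>-th one.\<close>

lemma homog_keys:
  assumes "homog d (poly_eval f)" "m \<in> Poly_Mapping.keys f"
  shows "monom_degree m = d"
proof -
  have "Poly_Mapping.lookup f m * (2 ^ monom_degree m - 2 ^ d) = 0"
  proof (rule monomials_independent[OF _ _ assms(2)])
    fix v
    have "poly_eval f (2 *s v) = 2 ^ d * poly_eval f v"
      using assms(1) by (simp add: homog_def)
    then show "(\<Sum>m\<in>Poly_Mapping.keys f. Poly_Mapping.lookup f m * (2 ^ monom_degree m - 2 ^ d)
        * monomial_fun m v) = 0"
      by (simp add: poly_eval_altdef monomial_fun_scale algebra_simps sum_subtractf sum_distrib_left)
  qed simp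
  then have "(2::complex) ^ monom_degree m = 2 ^ d"
    using assms(2) by (simp add: in_keys_iff)
  then have "(of_nat (2 ^ monom_degree m) :: complex) = of_nat (2 ^ d)" by simp
  then show ?thesis by (simp only: of_nat_eq_iff) simp
qed

lemma homogeneous_poly_iff: "homogeneous_poly f \<longleftrightarrow> (\<exists>d. homog d (poly_eval f))"
proof
  assume "homogeneous_poly f"
  then obtain d where d: "\<forall>m\<in>Poly_Mapping.keys f. monom_degree m = d"
    unfolding homogeneous_poly_def by blast
  then have "homog d (poly_eval f)"
    by (simp add: homog_def poly_eval_altdef monomial_fun_scale sum_distrib_left ac_simps)
  then show "\<exists>d. homog d (poly_eval f)" ..
next
  assume "\<exists>d. homog d (poly_eval f)"
  then show "homogeneous_poly f"
    unfolding homogeneous_poly_def using homog_keys by blast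
qed

definition poly_of :: "(complex ^ 'n::finite \<Rightarrow> complex) \<Rightarrow> 'n cpoly" where
  "poly_of f = inv poly_eval f"

lemma poly_eval_poly_of [simp]: "f \<in> polyfun \<Longrightarrow> poly_eval (poly_of f) = f"
  unfolding poly_of_def by (simp add: f_inv_into_f polyfun_eq_range)

lemma homogeneous_poly_of: "f \<in> polyfun \<Longrightarrow> homog d f \<Longrightarrow> homogeneous_poly (poly_of f)"
  by (auto simp: homogeneous_poly_iff)

section \<open>Affine cones and irreducibility\<close>

lemma proj_point_eq_span:
  assumes "p \<in> proj_space" "v \<in> p" "v \<noteq> 0"
  shows "p = vec.span {v}"
proof -
  obtain w where w: "p = vec.span {w}" using assms(1) by (auto simp: proj_space_def)
  obtain k where k: "v = k *s w" using assms(2) by (auto simp: w vec.span_singleton)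
  with assms(3) have "k \<noteq> 0" by auto
  then have "w = inverse k *s v" by (simp add: k)
  then have "w \<in> vec.span {v}" by (auto simp: vec.span_singleton)
  moreover have "v \<in> vec.span {w}" using assms(2) w by simp
  ultimately show ?thesis
    unfolding w by (intro equalityI vec.span_minimal) auto
qed

lemma span_in_proj_space: "v \<noteq> 0 \<Longrightarrow> vec.span {v} \<in> proj_space"
  by (auto simp: proj_space_def)

lemma proj_point_nonzero: "p \<in> proj_space \<Longrightarrow> \<exists>v\<in>p. v \<noteq> 0"
  unfolding proj_space_def using vec.span_base by fastforce

lemma proj_point_subspace: "p \<in> proj_space \<Longrightarrow> vec.subspace p"
  by (auto simp: proj_space_def)

lemma cone_scale:
  assumes "Z \<subseteq> proj_space" "v \<in> \<Union>Z"
  shows "c *s v \<in> \<Union>Z"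
  using assms proj_point_subspace by (metis Union_iff subsetD vec.subspace_scale)

lemma zero_in_cone: "Z \<subseteq> proj_space \<Longrightarrow> Z \<noteq> {} \<Longrightarrow> 0 \<in> \<Union>Z"
  using proj_point_subspace vec.subspace_0 by blast

lemma span_in_iff_cone:
  assumes "Z \<subseteq> proj_space" "v \<noteq> 0"
  shows "vec.span {v} \<in> Z \<longleftrightarrow> v \<in> \<Union>Z"
  using assms proj_point_eq_span[of _ v] vec.span_base[of v "{v}"]
  by (metis UnionE UnionI insertI1 subsetD)

lemma zariski_closed_subset: "zariski_closed Z \<Longrightarrow> Z \<subseteq> proj_space"
  by (auto simp: zariski_closed_def proj_zeros_def)

text \<open>Closed sets may be cut out by polynomial functions, without naming polynomials for them.\<close>

lemma zariski_closed_restrict: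
  assumes "zariski_closed Z" and "\<And>f. f \<in> \<Phi> \<Longrightarrow> f \<in> polyfun \<and> (\<exists>d. homog d f)"
  shows "zariski_closed {p \<in> Z. \<forall>f\<in>\<Phi>. \<forall>v\<in>p. f v = 0}"
proof -
  obtain F where F: "\<forall>f\<in>F. homogeneous_poly f" "Z = proj_zeros F"
    using assms(1) unfolding zariski_closed_def by blast
  have "{p \<in> Z. \<forall>f\<in>\<Phi>. \<forall>v\<in>p. f v = 0} = proj_zeros (F \<union> poly_of ` \<Phi>)"
    using assms(2) by (auto simp: F(2) proj_zeros_def ball_Un)
  moreover have "\<forall>f\<in>F \<union> poly_of ` \<Phi>. homogeneous_poly f"
    using F(1) assms(2) homogeneous_poly_of by auto
  ultimately show ?thesis unfolding zariski_closed_def by blast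
qed

lemma zariski_closed_proj_space: "zariski_closed proj_space"
  unfolding zariski_closed_def by (rule exI[of _ "{}"]) (simp add: proj_zeros_def)

lemma homog_zero_on_point:
  assumes "homog d f" "p \<in> proj_space" "v \<in> p" "v \<noteq> 0" "f v = 0" "w \<in> p"
  shows "f w = 0"
  using assms proj_point_eq_span[OF assms(2-4)] by (auto simp: homog_def vec.span_singleton)

lemma not_in_closed_imp_homog:
  assumes "zariski_closed Z" "v \<notin> \<Union>Z" "v \<noteq> 0"
  shows "\<exists>f d. f \<in> polyfun \<and> homog d f \<and> (\<forall>u\<in>\<Union>Z. f u = 0) \<and> f v \<noteq> 0"
proof -
  obtain F where F: "\<forall>f\<in>F. homogeneous_poly f" "Z = proj_zeros F"
    using assms(1) unfolding zariski_closed_def by blast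
  have "vec.span {v} \<notin> Z"
    using span_in_iff_cone[OF zariski_closed_subset] assms by blast
  then obtain f u where f: "f \<in> F" "u \<in> vec.span {v}" "poly_eval f u \<noteq> 0"
    using span_in_proj_space[OF assms(3)] by (auto simp: F(2) proj_zeros_def)
  then obtain d where d: "homog d (poly_eval f)" using F(1) homogeneous_poly_iff by blast
  then have "poly_eval f v \<noteq> 0"
    using homog_zero_on_point[OF d span_in_proj_space[OF assms(3)], of v u] f assms(3)
    by (auto intro: vec.span_base)
  then show ?thesis using d f(1) by (auto simp: F(2) proj_zeros_def)
qed

text \<open>
  If \<open>f g = 0\<close> on the cone, then on every line of the cone one of the two factors is zero, with all
  its homogeneous components, as polynomials in one variable have no zero divisors. This splits the
  variety into two closed subsets.
\<close>

lemma irreducible_imp_prime_on: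
  assumes "irreducible_variety Z"
  shows "prime_on (\<Union>Z)"
  unfolding prime_on_def
proof (intro ballI impI)
  fix f g :: "complex ^ 'a \<Rightarrow> complex"
  assume fg: "f \<in> polyfun" "g \<in> polyfun" "\<forall>v\<in>\<Union>Z. f v * g v = 0"
  have Z: "zariski_closed Z" using assms by (simp add: irreducible_variety_def)
  then have Zs: "Z \<subseteq> proj_space" by (rule zariski_closed_subset)
  define part where "part h = {p \<in> Z. \<forall>k\<in>range (component h). \<forall>v\<in>p. k v = 0}"
    for h :: "complex ^ 'a \<Rightarrow> complex"
  have closed: "zariski_closed (part h)" if "h \<in> polyfun" for h
    unfolding part_def using Z that homog_component by (intro zariski_closed_restrict) auto
  have "p \<in> part f \<union> part g" if "p \<in> Z" for p
  proof -
    obtain v where v: "v \<in> p" "v \<noteq> 0" using Zs \<open>p \<in> Z\<close> proj_point_nonzero by blast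
    have "line_poly f 0 v * line_poly g 0 v = 0"
    proof (rule poly_ext)
      fix t
      have "t *s v \<in> \<Union>Z" using cone_scale[OF Zs] v that by blast
      then show "poly (line_poly f 0 v * line_poly g 0 v) t = poly 0 t"
        using bspec[OF fg(3), of "t *s v"] by (simp add: poly_line_poly fg(1,2) del: mult_eq_0_iff)
    qed
    then have "line_poly f 0 v = 0 \<or> line_poly g 0 v = 0" by simp
    moreover have "p \<in> part h" if h: "h \<in> polyfun" "line_poly h 0 v = 0" for h
    proof -
      have "component h j w = 0" if "w \<in> p" for j w
        by (rule homog_zero_on_point[OF homog_component[OF h(1)] _ v])
          (use Zs \<open>p \<in> Z\<close> that h in \<open>auto simp: component_def\<close>)
      then show ?thesis using \<open>p \<in> Z\<close> by (auto simp: part_def)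
    qed
    ultimately show ?thesis using fg by blast
  qed
  then have "Z = part f \<union> part g" by (auto simp: part_def)
  then have "Z = part f \<or> Z = part g"
    using assms closed fg unfolding irreducible_variety_def by blast
  moreover have "\<forall>v\<in>\<Union>Z. h v = 0" if "Z = part h" "h \<in> polyfun" for h
  proof
    fix v assume "v \<in> \<Union>Z"
    then have "component h j v = 0" for j using that(1) unfolding part_def by blast
    then show "h v = 0" using sum_components[OF that(2), of v] by simp
  qed
  ultimately show "(\<forall>v\<in>\<Union>Z. f v = 0) \<or> (\<forall>v\<in>\<Union>Z. g v = 0)"
    using fg by blast
qed

lemma prime_on_imp_irreducible:
  assumes "zariski_closed Z" "Z \<noteq> {}" "prime_on (\<Union>Z)"
  shows "irreducible_variety Z"
  unfolding irreducible_variety_def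
proof (intro conjI allI impI assms(1,2), rule ccontr)
  fix A B assume AB: "zariski_closed A" "zariski_closed B" "Z = A \<union> B" "\<not> (Z = A \<or> Z = B)"
  have witness: "\<exists>f\<in>polyfun. (\<forall>u\<in>\<Union>A'. f u = 0) \<and> (\<exists>v\<in>\<Union>Z. f v \<noteq> 0)"
    if A': "zariski_closed A'" "A' \<subset> Z" for A'
  proof -
    obtain p where p: "p \<in> Z" "p \<notin> A'" using A'(2) by blast
    then have "p \<in> proj_space" using assms(1) zariski_closed_subset by blast
    then obtain v where v: "v \<in> p" "v \<noteq> 0" using proj_point_nonzero by blast
    then have "v \<notin> \<Union>A'"
      using p(2) span_in_iff_cone[OF zariski_closed_subset[OF A'(1)], of v]
        proj_point_eq_span[OF \<open>p \<in> proj_space\<close> v] by simp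
    from not_in_closed_imp_homog[OF A'(1) this v(2)] show ?thesis using p v by blast
  qed
  obtain f g where "f \<in> polyfun" "\<forall>u\<in>\<Union>A. f u = 0" "\<exists>v\<in>\<Union>Z. f v \<noteq> 0"
    and "g \<in> polyfun" "\<forall>u\<in>\<Union>B. g u = 0" "\<exists>v\<in>\<Union>Z. g v \<noteq> 0"
    using witness[of A] witness[of B] AB by blast
  then show False using prime_onD[OF assms(3), of f g] AB(3) by fastforce
qed

section \<open>Irreducibility of secant varieties\<close>

definition sumset :: "(complex ^ 'n) set \<Rightarrow> (complex ^ 'n) set \<Rightarrow> (complex ^ 'n) set" where
  "sumset A B = {a + b |a b. a \<in> A \<and> b \<in> B}"

lemma polyfun_translate: "f \<in> polyfun \<Longrightarrow> (\<lambda>v. f (v + b)) \<in> polyfun"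
  and polyfun_translate': "f \<in> polyfun \<Longrightarrow> (\<lambda>v. f (b + v)) \<in> polyfun"
  by (erule polyfun_compose, simp, intro polyfun.intros)+

text \<open>
  Fix \<open>a \<in> A\<close>: as \<open>f (a + \<cdot>) g (a + \<cdot>)\<close> is zero on \<open>B\<close>, one of the two factors is. If neither \<open>f\<close>
  nor \<open>g\<close> is zero on \<open>A + B\<close>, say \<open>f (a + b) \<noteq> 0\<close> and \<open>g (a' + b') \<noteq> 0\<close>, then \<open>f (\<cdot> + b)\<close> and
  \<open>g (\<cdot> + b')\<close> contradict the primality of \<open>A\<close>.
\<close>

lemma prime_on_sumset:
  assumes A: "prime_on A" and B: "prime_on B"
  shows "prime_on (sumset A B)"
  unfolding prime_on_def
proof (intro ballI impI, rule ccontr)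
  fix f g :: "complex ^ 'a \<Rightarrow> complex"
  assume fg: "f \<in> polyfun" "g \<in> polyfun" "\<forall>v\<in>sumset A B. f v * g v = 0"
    and "\<not> ((\<forall>v\<in>sumset A B. f v = 0) \<or> (\<forall>v\<in>sumset A B. g v = 0))"
  then obtain a b a' b' where ab: "a \<in> A" "b \<in> B" "f (a + b) \<noteq> 0"
    and ab': "a' \<in> A" "b' \<in> B" "g (a' + b') \<noteq> 0"
    by (auto simp: sumset_def)
  have "f (x + b) * g (x + b') = 0" if "x \<in> A" for x
  proof -
    have "(\<forall>y\<in>B. f (x + y) = 0) \<or> (\<forall>y\<in>B. g (x + y) = 0)"
      by (rule prime_onD[OF B polyfun_translate' polyfun_translate'])
        (use fg that in \<open>auto simp: sumset_def\<close>)
    then show ?thesis using ab ab' by auto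
  qed
  then have "(\<forall>x\<in>A. f (x + b) = 0) \<or> (\<forall>x\<in>A. g (x + b') = 0)"
    using fg by (intro prime_onD[OF A] polyfun_translate) auto
  then show False using ab ab' by blast
qed

text \<open>
  The \<open>r\<close>-fold sum of the cone over \<open>X\<close> is the cone over the points of rank at most \<open>r\<close>: a vector in
  the span of \<open>r\<close> points is a sum of \<open>r\<close> vectors, one in each of them.
\<close>

primrec fold_sum :: "nat \<Rightarrow> (complex ^ 'n) set \<Rightarrow> (complex ^ 'n) set" where
  "fold_sum 0 C = {0}"
| "fold_sum (Suc r) C = sumset (fold_sum r C) C"

lemma prime_on_fold_sum: "prime_on C \<Longrightarrow> prime_on (fold_sum r C)"
  by (induction r) (use prime_on_subspace[OF vec.subspace_single_0] in \<open>auto intro: prime_on_sumset\<close>)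

lemma fold_sum_mono:
  assumes "0 \<in> C" "r \<le> s"
  shows "fold_sum r C \<subseteq> fold_sum s C"
  using assms(2) by (induction s rule: dec_induct) (use assms(1) in \<open>force simp: sumset_def\<close>)+

lemma fold_sum_scale:
  assumes "\<And>v. v \<in> C \<Longrightarrow> c *s v \<in> C" "v \<in> fold_sum r C"
  shows "c *s v \<in> fold_sum r C"
  using assms(2) by (induction r arbitrary: v) (use assms(1) in \<open>force simp: sumset_def vec.scale_right_distrib\<close>)+

lemma span_points_subset_fold_sum:
  assumes "Z \<subseteq> proj_space" "\<And>i. i < r \<Longrightarrow> z i \<in> Z"
  shows "vec.span (\<Union>i<r. z i) \<subseteq> fold_sum r (\<Union>Z)"
  using assms(2)
proof (induction r)
  case (Suc r)
  have "vec.subspace (z r)"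
    using Suc.prems[of r] assms(1) proj_point_subspace by auto
  then have sp: "vec.span (z r) = z r"
    by (rule vec.span_eq_iff[THEN iffD2])
  have un: "(\<Union>i<Suc r. z i) = (\<Union>i<r. z i) \<union> z r"
    by (simp add: lessThan_Suc Un_commute)
  show ?case
  proof
    fix v assume "v \<in> vec.span (\<Union>i<Suc r. z i)"
    then obtain x y where "v = x + y" "x \<in> vec.span (\<Union>i<r. z i)" "y \<in> z r"
      unfolding un vec.span_Un sp by blast
    moreover have "vec.span (\<Union>i<r. z i) \<subseteq> fold_sum r (\<Union>Z)"
      using Suc.IH Suc.prems by simp
    ultimately show "v \<in> fold_sum (Suc r) (\<Union>Z)"
      using Suc.prems[of r] unfolding fold_sum.simps sumset_def by blast
  qed
qed simp

lemma fold_sum_subset_span_points: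
  assumes "v \<in> fold_sum r (\<Union>Z)"
  shows "\<exists>z. (\<forall>i<r. z i \<in> Z) \<and> v \<in> vec.span (\<Union>i<r. z i)"
  using assms
proof (induction r arbitrary: v)
  case (Suc r)
  then obtain a b p where ab: "v = a + b" "a \<in> fold_sum r (\<Union>Z)" "b \<in> p" "p \<in> Z"
    by (auto simp: sumset_def)
  obtain z where z: "\<forall>i<r. z i \<in> Z" "a \<in> vec.span (\<Union>i<r. z i)"
    using Suc.IH[OF ab(2)] by blast
  let ?z = "z(r := p)"
  have "(\<Union>i<r. z i) \<subseteq> (\<Union>i<Suc r. ?z i)" "p \<subseteq> (\<Union>i<Suc r. ?z i)"
    by (auto simp: less_Suc_eq)
  then have "v \<in> vec.span (\<Union>i<Suc r. ?z i)"
    using ab z unfolding ab(1)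
    by (intro vec.span_add) (meson vec.span_mono vec.span_base subsetD)+
  moreover have "\<forall>i<Suc r. ?z i \<in> Z" using z ab by auto
  ultimately show ?case by blast
qed simp

lemma Inf_enat_le_iff: "Inf {enat s |s. P s} \<le> enat r \<longleftrightarrow> (\<exists>s\<le>r. P s)"
proof
  assume le: "Inf {enat s |s. P s} \<le> enat r"
  show "\<exists>s\<le>r. P s"
  proof (rule ccontr)
    assume "\<not> (\<exists>s\<le>r. P s)"
    then have "enat (Suc r) \<le> Inf {enat s |s. P s}"
      by (intro Inf_greatest) (auto simp: not_less_eq_eq)
    then have "enat (Suc r) \<le> enat r" using le by (rule order_trans)
    then show False by simp
  qed
next
  assume "\<exists>s\<le>r. P s"
  then obtain s where "s \<le> r" "P s" by blast
  then show "Inf {enat s |s. P s} \<le> enat r"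
    by (intro Inf_lower2[of "enat s"]) auto
qed

lemma X_rank_le_iff:
  assumes "X \<subseteq> proj_space" "X \<noteq> {}" "p \<in> proj_space"
  shows "X_rank X p \<le> enat r \<longleftrightarrow> p \<subseteq> fold_sum r (\<Union>X)"
proof
  assume "X_rank X p \<le> enat r"
  then obtain s z where s: "s \<le> r" "\<forall>i<s. z i \<in> X"
    "p \<in> proj_linear (vec.span (\<Union>i<s. z i))"
    unfolding X_rank_def Inf_enat_le_iff by blast
  have "p \<subseteq> fold_sum s (\<Union>X)"
    using s(2,3) span_points_subset_fold_sum[OF assms(1), of s z] by (auto simp: proj_linear_def)
  also have "\<dots> \<subseteq> fold_sum r (\<Union>X)"
    using s(1) zero_in_cone[OF assms(1,2)] by (intro fold_sum_mono)
  finally show "p \<subseteq> fold_sum r (\<Union>X)" .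
next
  assume p: "p \<subseteq> fold_sum r (\<Union>X)"
  obtain v where v: "v \<in> p" "v \<noteq> 0" using assms(3) proj_point_nonzero by blast
  then obtain z where z: "\<forall>i<r. z i \<in> X" "v \<in> vec.span (\<Union>i<r. z i)"
    using p fold_sum_subset_span_points by blast
  have "vec.span {v} \<subseteq> vec.span (\<Union>i<r. z i)"
    using z(2) by (intro vec.span_minimal) auto
  then have "p \<in> proj_linear (vec.span (\<Union>i<r. z i))"
    using assms(3) proj_point_eq_span[OF assms(3) v] by (simp add: proj_linear_def)
  then show "X_rank X p \<le> enat r"
    unfolding X_rank_def Inf_enat_le_iff using z(1) by blast
qed

text \<open>
  The closure has the same ideal as the sum \<open>K\<close> of cones that it comes from: as \<open>K\<close> is a cone, the
  homogeneous components of a function that is zero on \<open>K\<close> are zero there, and homogeneous functions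
  define closed sets.
\<close>

lemma prime_on_secant_variety:
  assumes X: "irreducible_variety X" and S: "zariski_closed (secant_variety r X)"
  shows "prime_on (\<Union>(secant_variety r X))"
proof -
  define S where "S = secant_variety r X"
  define K where "K = fold_sum r (\<Union>X)"
  have Xs: "X \<subseteq> proj_space" "X \<noteq> {}"
    using X zariski_closed_subset by (auto simp: irreducible_variety_def)
  have K: "prime_on K" unfolding K_def
    using X by (intro prime_on_fold_sum irreducible_imp_prime_on)
  have Kscale: "c *s v \<in> K" if "v \<in> K" for c v
    using that unfolding K_def by (intro fold_sum_scale cone_scale Xs)
  have zero: "\<forall>v\<in>\<Union>S. f v = 0" if f: "f \<in> polyfun" "\<forall>v\<in>K. f v = 0" for f
  proof
    have comp: "h \<in> polyfun \<and> (\<exists>d. homog d h)" if "h \<in> range (component f)" for h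
      using that f(1) homog_component[OF f(1)] by blast
    have "\<forall>j. component f j v = 0" if "v \<in> K" for v
      using components_zero_iff[OF f(1)] f(2) Kscale that by blast
    then have "{p \<in> proj_space. X_rank X p \<le> enat r}
        \<subseteq> {p \<in> proj_space. \<forall>h\<in>range (component f). \<forall>v\<in>p. h v = 0}"
      using X_rank_le_iff[OF Xs] unfolding K_def by blast
    then have "S \<subseteq> {p \<in> proj_space. \<forall>h\<in>range (component f). \<forall>v\<in>p. h v = 0}"
      unfolding S_def secant_variety_def
      by (rule hull_minimal) (rule zariski_closed_restrict[OF zariski_closed_proj_space comp])
    moreover fix v assume "v \<in> \<Union>S"
    ultimately have "component f j v = 0" for j by blast
    then show "f v = 0" using sum_components[OF f(1), of v] by simp
  qed
  have KS: "v \<in> \<Union>S" if "v \<in> K" "v \<noteq> 0" for v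
  proof -
    have "vec.span {v} \<subseteq> K" using Kscale that(1) by (auto simp: vec.span_singleton)
    then have "vec.span {v} \<in> S"
      unfolding S_def secant_variety_def
      using X_rank_le_iff[OF Xs span_in_proj_space] span_in_proj_space that(2)
      by (intro hull_inc) (auto simp: K_def)
    then show ?thesis using vec.span_base by blast
  qed
  show ?thesis
    unfolding prime_on_def S_def[symmetric]
  proof (intro ballI impI)
    fix f g :: "complex ^ 'a \<Rightarrow> complex"
    assume fg: "f \<in> polyfun" "g \<in> polyfun" "\<forall>v\<in>\<Union>S. f v * g v = 0"
    show "(\<forall>v\<in>\<Union>S. f v = 0) \<or> (\<forall>v\<in>\<Union>S. g v = 0)"
    proof (cases "S = {}")
      case False
      then have "0 \<in> \<Union>S" using zariski_closed_subset S zero_in_cone by (metis S_def)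
      then have "\<forall>v\<in>K. f v * g v = 0" using KS fg(3) by (metis)
      then have "(\<forall>v\<in>K. f v = 0) \<or> (\<forall>v\<in>K. g v = 0)"
        using prime_onD[OF K fg(1,2)] by blast
      then show ?thesis using zero fg by blast
    qed auto
  qed
qed

section \<open>Algebraic independence along chains of irreducible sets\<close>

fun power_product :: "('a \<Rightarrow> complex) list \<Rightarrow> nat list \<Rightarrow> 'a \<Rightarrow> complex" where
  "power_product (h # hs) (a # as) v = h v ^ a * power_product hs as v"
| "power_product _ _ v = 1"

text \<open>Each exponent is bounded by itself, not the total degree: this makes the counting exact.\<close>

definition exponents :: "nat \<Rightarrow> nat \<Rightarrow> nat list set" where
  "exponents k n = {as. set as \<subseteq> {..n} \<and> length as = k}"

lemma finite_exponents [simp]: "finite (exponents k n)"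
  and card_exponents: "card (exponents k n) = Suc n ^ k"
  unfolding exponents_def by (simp_all add: finite_lists_length_eq card_lists_length_eq)

lemma exponents_0: "exponents 0 n = {[]}"
  by (auto simp: exponents_def)

lemma exponents_Suc: "exponents (Suc k) n = (\<lambda>(a, as). a # as) ` ({..n} \<times> exponents k n)"
  by (auto simp: exponents_def length_Suc_conv image_iff)

lemma sum_exponents_Suc:
  "(\<Sum>as\<in>exponents (Suc k) n. F as) = (\<Sum>a\<le>n. \<Sum>as\<in>exponents k n. F (a # as))"
  unfolding exponents_Suc
  by (subst sum.reindex) (auto simp: inj_on_def sum.cartesian_product case_prod_unfold)

lemma polyfun_power_product:
  "set hs \<subseteq> polyfun \<Longrightarrow> (\<lambda>v. power_product hs as v) \<in> polyfun"
proof (induction hs arbitrary: as)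
  case (Cons h hs)
  have "(\<lambda>v. h v ^ a * power_product hs as' v) \<in> polyfun" for a as'
    using Cons by (intro polyfun.mult polyfun_power) auto
  then show ?case by (cases as) auto
next
  case Nil
  show ?case by (simp only: power_product.simps polyfun.const)
qed

definition indep_on :: "'a set \<Rightarrow> 'i set \<Rightarrow> ('i \<Rightarrow> 'a \<Rightarrow> complex) \<Rightarrow> bool" where
  "indep_on C I F \<longleftrightarrow> (\<forall>c. (\<forall>v\<in>C. (\<Sum>i\<in>I. c i * F i v) = 0) \<longrightarrow> (\<forall>i\<in>I. c i = 0))"

lemma indep_onD:
  "indep_on C I F \<Longrightarrow> (\<And>v. v \<in> C \<Longrightarrow> (\<Sum>i\<in>I. c i * F i v) = 0) \<Longrightarrow> i \<in> I \<Longrightarrow> c i = 0"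
  unfolding indep_on_def by simp

definition alg_indep_on :: "'a set \<Rightarrow> ('a \<Rightarrow> complex) list \<Rightarrow> bool" where
  "alg_indep_on C hs \<longleftrightarrow> (\<forall>n. indep_on C (exponents (length hs) n) (power_product hs))"

lemma alg_indep_on_mono: "C \<subseteq> D \<Longrightarrow> alg_indep_on C hs \<Longrightarrow> alg_indep_on D hs"
  unfolding alg_indep_on_def indep_on_def by (meson subsetD)

text \<open>
  Sort a relation on \<open>C\<close> by powers of \<open>h\<close>. The lowest power can be cancelled, as \<open>C\<close> is prime and
  \<open>h\<close> is not zero on \<open>C\<close>; restricting to \<open>D\<close>, where \<open>h\<close> is zero, leaves the lowest coefficient, a
  relation among \<open>hs\<close> on \<open>D\<close>.
\<close>

lemma alg_indep_on_Cons:
  fixes C D :: "(complex ^ 'n::finite) set"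
  assumes C: "prime_on C" and D: "D \<subseteq> C" "alg_indep_on D hs" "set hs \<subseteq> polyfun"
    and h: "h \<in> polyfun" "\<And>v. v \<in> D \<Longrightarrow> h v = 0" "u \<in> C" "h u \<noteq> 0"
  shows "alg_indep_on C (h # hs)"
  unfolding alg_indep_on_def indep_on_def
proof (intro allI impI)
  fix n c
  define E where "E = exponents (length hs) n"
  define s where "s a v = (\<Sum>as\<in>E. c (a # as) * power_product hs as v)" for a v
  have s: "s a \<in> polyfun" for a
    unfolding s_def[abs_def] using D(3) by (intro polyfun_sum polyfun_cmult polyfun_power_product)
  assume "\<forall>v\<in>C. (\<Sum>as\<in>exponents (length (h # hs)) n. c as * power_product (h # hs) as v) = 0"
  then have rel: "(\<Sum>a\<le>n. h v ^ a * s a v) = 0" if "v \<in> C" for v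
    using that by (simp add: sum_exponents_Suc s_def E_def sum_distrib_left ac_simps)
  have "\<forall>as\<in>E. c (a # as) = 0" if "a \<le> n" for a
    using that
  proof (induction a rule: less_induct)
    case (less a)
    define q where "q v = (\<Sum>b\<in>{a..n}. h v ^ (b - a) * s b v)" for v
    have low: "s b v = 0" if "b < a" for b v
      using less.IH[of b] less.prems that by (simp add: s_def)
    have "h v ^ a * q v = 0" if "v \<in> C" for v
    proof -
      have "0 = (\<Sum>b\<in>{a..n}. h v ^ b * s b v)"
        unfolding rel[OF that, symmetric]
        by (rule sum.mono_neutral_right) (auto simp: low not_le)
      also have "\<dots> = h v ^ a * q v"
        unfolding q_def sum_distrib_left
        by (rule sum.cong) (auto simp flip: power_add mult.assoc)
      finally show ?thesis by simp
    qed
    moreover have "q \<in> polyfun"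
      unfolding q_def[abs_def] using h s by (intro polyfun_sum polyfun.mult polyfun_power)
    ultimately have q0: "\<forall>v\<in>C. q v = 0"
      using prime_onD[OF C polyfun_power[OF h(1)], of q a] h(3,4) by auto
    have "s a v = 0" if "v \<in> D" for v
    proof -
      have "q v = (\<Sum>b\<in>{a..n}. if b = a then s a v else 0)"
        unfolding q_def by (rule sum.cong) (use that h(2) in auto)
      also have "\<dots> = s a v" using less.prems by simp
      finally show ?thesis using q0 that D(1) by auto
    qed
    then have "\<forall>v\<in>D. (\<Sum>as\<in>exponents (length hs) n. c (a # as) * power_product hs as v) = 0"
      by (simp add: s_def E_def)
    with D(2) show ?case
      unfolding alg_indep_on_def E_def by (blast intro: indep_onD[where c = "\<lambda>as. c (a # as)"])
  qed
  then show "\<forall>as\<in>exponents (length (h # hs)) n. c as = 0"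
    by (auto simp: exponents_Suc E_def)
qed

text \<open>
  Each step of the chain contributes a function that is zero on the smaller cone only. The origin
  serves as a further, smallest member of the chain of cones, so \<open>n\<close> steps give \<open>n + 1\<close> functions.
\<close>

lemma alg_indep_on_irreducible_chain:
  fixes Z :: "nat \<Rightarrow> 'n::finite ppoint set"
  assumes "\<And>i. i \<le> n \<Longrightarrow> irreducible_variety (Z i)" and "\<And>i. i < n \<Longrightarrow> Z i \<subset> Z (Suc i)"
  shows "\<exists>hs. length hs = Suc n \<and> set hs \<subseteq> polyfun \<and> alg_indep_on (\<Union>(Z n)) hs"
  using assms
proof (induction n)
  case 0
  have Z: "irreducible_variety (Z 0)" using 0 by simp
  then have Zs: "Z 0 \<subseteq> proj_space" "Z 0 \<noteq> {}"
    using zariski_closed_subset by (auto simp: irreducible_variety_def)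
  then obtain p where "p \<in> Z 0" by blast
  then obtain v where v: "v \<in> \<Union>(Z 0)" "v \<noteq> 0" using Zs proj_point_nonzero by blast
  then obtain i where i: "v $ i \<noteq> 0" by (auto simp: vec_eq_iff)
  have "alg_indep_on (\<Union>(Z 0)) [\<lambda>v. v $ i]"
  proof (rule alg_indep_on_Cons[where D = "{0}"])
    show "prime_on (\<Union>(Z 0))" using Z by (rule irreducible_imp_prime_on)
    show "{0} \<subseteq> \<Union>(Z 0)" using zero_in_cone[OF Zs] by simp
    show "alg_indep_on {0 :: complex ^ 'n} []"
      by (simp add: alg_indep_on_def indep_on_def exponents_0)
  qed (use v i in auto)
  then show ?case by (intro exI[of _ "[\<lambda>v. v $ i]"]) auto
next
  case (Suc n)
  then obtain hs where hs: "length hs = Suc n" "set hs \<subseteq> polyfun" "alg_indep_on (\<Union>(Z n)) hs"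
    by force
  have irr: "irreducible_variety (Z n)" "irreducible_variety (Z (Suc n))"
    and sub: "Z n \<subset> Z (Suc n)"
    using Suc.prems by auto
  have Zs: "Z n \<subseteq> proj_space" "Z (Suc n) \<subseteq> proj_space"
    using irr zariski_closed_subset by (auto simp: irreducible_variety_def)
  obtain p where p: "p \<in> Z (Suc n)" "p \<notin> Z n" using sub by blast
  then obtain v where v: "v \<in> p" "v \<noteq> 0" using Zs proj_point_nonzero by blast
  then have "v \<notin> \<Union>(Z n)"
    using p Zs proj_point_eq_span[of p v] span_in_iff_cone[OF Zs(1) v(2)] by auto
  then obtain h d where h: "h \<in> polyfun" "\<forall>u\<in>\<Union>(Z n). h u = 0" "h v \<noteq> 0"
    using not_in_closed_imp_homog[of "Z n" v] irr(1) v(2) by (auto simp: irreducible_variety_def)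
  have "alg_indep_on (\<Union>(Z (Suc n))) (h # hs)"
    by (rule alg_indep_on_Cons[OF irreducible_imp_prime_on[OF irr(2)] _ hs(3,2) h(1), of v])
      (use sub h p v in auto)
  then show ?case using hs h by (intro exI[of _ "h # hs"]) auto
qed

section \<open>Growth of filtered spaces of functions\<close>

interpretation fun_space: vector_space "\<lambda>(c::complex) (f :: 'a \<Rightarrow> complex) v. c * f v"
  by unfold_locales (auto simp: algebra_simps fun_eq_iff)

lemma sum_fun_apply: "(\<Sum>i\<in>I. f i) v = (\<Sum>i\<in>I. f i v :: complex)"
  by (induction I rule: infinite_finite_induct) auto

lemma card_le_of_indep_on:
  assumes "finite I" "indep_on UNIV I F" "finite T" "F ` I \<subseteq> fun_space.span T"
  shows "card I \<le> card T"
proof -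
  have coeffs: "c i = 0" if "\<And>v. (\<Sum>i\<in>I. c i * F i v) = 0" "i \<in> I" for c i
    using indep_onD[OF assms(2), of c i] that by simp
  have inj: "inj_on F I"
  proof (rule inj_onI, rule ccontr)
    fix i j assume ij: "i \<in> I" "j \<in> I" "F i = F j" "i \<noteq> j"
    have "(if i = i then 1 else if i = j then -1 else 0 :: complex) = 0"
    proof (rule coeffs[OF _ ij(1), where c = "\<lambda>k. if k = i then 1 else if k = j then -1 else 0"])
      fix v
      have "(\<Sum>k\<in>I. (if k = i then 1 else if k = j then -1 else 0) * F k v)
          = (\<Sum>k\<in>I. (if k = i then F i v else 0) - (if k = j then F j v else 0))"
        using ij(4) by (intro sum.cong) auto
      also have "\<dots> = 0" using ij assms(1) by (simp add: sum_subtractf)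
      finally show "(\<Sum>k\<in>I. (if k = i then 1 else if k = j then -1 else 0) * F k v) = 0" .
    qed
    then show False by simp
  qed
  have "fun_space.independent (F ` I)"
  proof
    assume "fun_space.dependent (F ` I)"
    then obtain c where c: "\<exists>f\<in>F ` I. c f \<noteq> 0" "(\<Sum>f\<in>F ` I. (\<lambda>v. c f * f v)) = 0"
      using assms(1) by (subst (asm) fun_space.dependent_finite) auto
    have "(\<Sum>i\<in>I. c (F i) * F i v) = 0" for v
    proof -
      have "(\<Sum>f\<in>F ` I. (\<lambda>v. c f * f v)) v = 0" using c(2) by simp
      then show ?thesis using inj by (simp add: sum.reindex sum_fun_apply)
    qed
    then show False using coeffs[of "\<lambda>i. c (F i)"] c(1) by blast
  qed
  then have "card (F ` I) \<le> card T"
    using fun_space.independent_span_bound assms(3,4) by blast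
  then show ?thesis using card_image[OF inj] by simp
qed

text \<open>
  Only the order of growth of the dimension of \<open>M d\<close> matters. So a multiplier may raise the degree by
  any constant, and the multipliers of a filtered space form an algebra.
\<close>

definition filtered :: "(nat \<Rightarrow> ('a \<Rightarrow> complex) set) \<Rightarrow> bool" where
  "filtered M \<longleftrightarrow> (\<forall>d. fun_space.subspace (M d)) \<and> mono M"

definition growth_le :: "(nat \<Rightarrow> ('a \<Rightarrow> complex) set) \<Rightarrow> nat \<Rightarrow> bool" where
  "growth_le M n \<longleftrightarrow>
     (\<exists>K. \<forall>d. \<exists>T. finite T \<and> card T \<le> K * Suc d ^ n \<and> M d \<subseteq> fun_space.span T)"

definition multiplier :: "(nat \<Rightarrow> ('a \<Rightarrow> complex) set) \<Rightarrow> ('a \<Rightarrow> complex) \<Rightarrow> bool" where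
  "multiplier M h \<longleftrightarrow> (\<exists>c. \<forall>d. \<forall>f\<in>M d. (\<lambda>v. h v * f v) \<in> M (d + c))"

lemma filtered_mono: "filtered M \<Longrightarrow> f \<in> M d \<Longrightarrow> d \<le> e \<Longrightarrow> f \<in> M e"
  unfolding filtered_def mono_def by blast

lemma filtered_zero: "filtered M \<Longrightarrow> (\<lambda>_. 0) \<in> M d"
  unfolding filtered_def using fun_space.subspace_0[of "M d"] by (simp add: zero_fun_def)

lemma filtered_add: "filtered M \<Longrightarrow> f \<in> M d \<Longrightarrow> g \<in> M d \<Longrightarrow> (\<lambda>v. f v + g v) \<in> M d"
  unfolding filtered_def using fun_space.subspace_add[of "M d" f g] by (simp add: plus_fun_def)

lemma filtered_cmult: "filtered M \<Longrightarrow> f \<in> M d \<Longrightarrow> (\<lambda>v. c * f v) \<in> M d"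
  unfolding filtered_def using fun_space.subspace_scale[of "M d" f c] by simp

lemma multiplier_const: "filtered M \<Longrightarrow> multiplier M (\<lambda>_. c)"
  unfolding multiplier_def by (rule exI[of _ 0]) (simp add: filtered_cmult)

lemma multiplier_add:
  assumes M: "filtered M" and "multiplier M g" "multiplier M h"
  shows "multiplier M (\<lambda>v. g v + h v)"
proof -
  obtain a b where ab: "\<And>d f. f \<in> M d \<Longrightarrow> (\<lambda>v. g v * f v) \<in> M (d + a)"
    "\<And>d f. f \<in> M d \<Longrightarrow> (\<lambda>v. h v * f v) \<in> M (d + b)"
    using assms(2,3) unfolding multiplier_def by blast
  have "(\<lambda>v. (g v + h v) * f v) \<in> M (d + (a + b))" if "f \<in> M d" for f d
    using filtered_add[OF M filtered_mono[OF M ab(1)[OF that]] filtered_mono[OF M ab(2)[OF that]],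
        of "d + (a + b)"]
    by (simp add: algebra_simps)
  then show ?thesis unfolding multiplier_def by blast
qed

lemma multiplier_mult:
  assumes "multiplier M g" "multiplier M h"
  shows "multiplier M (\<lambda>v. g v * h v)"
proof -
  obtain a b where ab: "\<And>d f. f \<in> M d \<Longrightarrow> (\<lambda>v. g v * f v) \<in> M (d + a)"
    "\<And>d f. f \<in> M d \<Longrightarrow> (\<lambda>v. h v * f v) \<in> M (d + b)"
    using assms unfolding multiplier_def by blast
  have "(\<lambda>v. (g v * h v) * f v) \<in> M (d + (b + a))" if "f \<in> M d" for f d
    using ab(1)[OF ab(2)[OF that]] by (simp add: algebra_simps)
  then show ?thesis unfolding multiplier_def by blast
qed

lemma multiplier_polyfun:
  assumes "filtered M" "\<And>i. multiplier M (\<lambda>v. \<alpha> v $ i)" "f \<in> polyfun"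
  shows "multiplier M (\<lambda>v. f (\<alpha> v))"
  using assms(3)
  by induction (auto intro: multiplier_const multiplier_add multiplier_mult assms)

text \<open>
  If \<open>y\<close> satisfies a monic equation of degree \<open>D\<close> over the multipliers of \<open>M\<close>, then the powers of \<open>y\<close>
  below \<open>D\<close> suffice to make \<open>y\<close> a multiplier too, while the order of growth stays the same.
\<close>

definition adjoin ::
    "nat \<Rightarrow> ('a \<Rightarrow> complex) \<Rightarrow> (nat \<Rightarrow> ('a \<Rightarrow> complex) set) \<Rightarrow> nat \<Rightarrow> ('a \<Rightarrow> complex) set" where
  "adjoin D y M d = {\<lambda>v. \<Sum>i<D. y v ^ i * f i v |f. \<forall>i<D. f i \<in> M d}"

lemma adjoinI: "(\<And>i. i < D \<Longrightarrow> f i \<in> M d) \<Longrightarrow> (\<lambda>v. \<Sum>i<D. y v ^ i * f i v) \<in> adjoin D y M d"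
  unfolding adjoin_def by blast

lemma adjoinE:
  assumes "F \<in> adjoin D y M d"
  obtains f where "\<And>i. i < D \<Longrightarrow> f i \<in> M d" "F = (\<lambda>v. \<Sum>i<D. y v ^ i * f i v)"
  using assms unfolding adjoin_def by blast

lemma filtered_adjoin:
  assumes M: "filtered M"
  shows "filtered (adjoin D y M)"
  unfolding filtered_def
proof (intro conjI allI)
  show "fun_space.subspace (adjoin D y M d)" for d
  proof (rule fun_space.subspaceI)
    have "(\<lambda>v. \<Sum>i<D. y v ^ i * (\<lambda>i v. 0) i v) \<in> adjoin D y M d"
      by (rule adjoinI) (simp add: filtered_zero M)
    then show "0 \<in> adjoin D y M d" by (simp add: zero_fun_def)
  next
    fix F G assume "F \<in> adjoin D y M d" "G \<in> adjoin D y M d"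
    obtain f where f: "\<And>i. i < D \<Longrightarrow> f i \<in> M d" "F = (\<lambda>v. \<Sum>i<D. y v ^ i * f i v)"
      using \<open>F \<in> _\<close> by (rule adjoinE) blast
    obtain g where g: "\<And>i. i < D \<Longrightarrow> g i \<in> M d" "G = (\<lambda>v. \<Sum>i<D. y v ^ i * g i v)"
      using \<open>G \<in> _\<close> by (rule adjoinE) blast
    from f g show "F + G \<in> adjoin D y M d"
      using adjoinI[of D "\<lambda>i v. f i v + g i v" M d y] filtered_add[OF M]
      by (simp add: plus_fun_def sum.distrib distrib_left)
  next
    fix c F assume "F \<in> adjoin D y M d"
    then obtain f where "\<And>i. i < D \<Longrightarrow> f i \<in> M d" "F = (\<lambda>v. \<Sum>i<D. y v ^ i * f i v)"
      by (rule adjoinE) blast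
    then show "(\<lambda>v. c * F v) \<in> adjoin D y M d"
      using adjoinI[of D "\<lambda>i v. c * f i v" M d y] filtered_cmult[OF M]
      by (simp add: sum_distrib_left ac_simps)
  qed
  show "mono (adjoin D y M)"
  proof (rule monoI, rule subsetI)
    fix d e :: nat and F assume "d \<le> e" "F \<in> adjoin D y M d"
    obtain f where f: "\<And>i. i < D \<Longrightarrow> f i \<in> M d" "F = (\<lambda>v. \<Sum>i<D. y v ^ i * f i v)"
      using \<open>F \<in> _\<close> by (rule adjoinE) blast
    show "F \<in> adjoin D y M e"
      unfolding f(2) using filtered_mono[OF M f(1) \<open>d \<le> e\<close>] by (rule adjoinI)
  qed
qed

lemma multiplier_adjoin:
  assumes "multiplier M h"
  shows "multiplier (adjoin D y M) h"
proof -
  obtain c where c: "\<And>d f. f \<in> M d \<Longrightarrow> (\<lambda>v. h v * f v) \<in> M (d + c)"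
    using assms unfolding multiplier_def by blast
  have "(\<lambda>v. h v * F v) \<in> adjoin D y M (d + c)" if "F \<in> adjoin D y M d" for F d
  proof -
    obtain f where f: "\<And>i. i < D \<Longrightarrow> f i \<in> M d" "F = (\<lambda>v. \<Sum>i<D. y v ^ i * f i v)"
      using \<open>F \<in> _\<close> by (rule adjoinE) blast
    have "(\<lambda>v. \<Sum>i<D. y v ^ i * (h v * f i v)) \<in> adjoin D y M (d + c)"
      by (rule adjoinI) (rule c[OF f(1)])
    then show ?thesis by (simp add: f(2) sum_distrib_left mult.left_commute)
  qed
  then show ?thesis unfolding multiplier_def by blast
qed

lemma multiplier_adjoin_self:
  assumes M: "filtered M" and a: "\<And>i. i < D \<Longrightarrow> multiplier M (a i)"
    and rel: "\<And>d f v. f \<in> M d \<Longrightarrow> y v ^ D * f v = (\<Sum>i<D. y v ^ i * a i v) * f v"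
  shows "multiplier (adjoin D y M) y"
proof (cases D)
  case 0
  then show ?thesis by (auto simp: multiplier_def adjoin_def)
next
  case (Suc D')
  obtain k where k: "\<And>i d f. i < D \<Longrightarrow> f \<in> M d \<Longrightarrow> (\<lambda>v. a i v * f v) \<in> M (d + k i)"
    using a unfolding multiplier_def by metis
  define c where "c = (\<Sum>i<D. k i)"
  have kc: "k i \<le> c" if "i < D" for i
    unfolding c_def using that by (intro member_le_sum) auto
  have "(\<lambda>v. y v * F v) \<in> adjoin D y M (d + c)" if F: "F \<in> adjoin D y M d" for F d
  proof -
    obtain f where f: "\<And>i. i < D \<Longrightarrow> f i \<in> M d" "F = (\<lambda>v. \<Sum>i<D. y v ^ i * f i v)"
      using F by (rule adjoinE) blast
    \<comment> \<open>multiplication by \<open>y\<close> shifts the coefficients, and the equation reduces the term of degree \<open>D\<close>\<close>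
    define g where "g i v = (if i = 0 then 0 else f (i - 1) v) + a i v * f D' v" for i v
    have "g i \<in> M (d + c)" if "i < D" for i
    proof -
      have "(\<lambda>v. a i v * f D' v) \<in> M (d + c)"
        using filtered_mono[OF M k[OF that f(1)], of D' "d + c"] kc[OF that] Suc by simp
      moreover have "(\<lambda>v. if i = 0 then 0 else f (i - 1) v) \<in> M (d + c)"
        using filtered_zero[OF M] filtered_mono[OF M f(1), of "i - 1" "d + c"] that
        by (cases "i = 0") auto
      ultimately show ?thesis
        unfolding g_def[abs_def] by (intro filtered_add[OF M])
    qed
    then have "(\<lambda>v. \<Sum>i<D. y v ^ i * g i v) \<in> adjoin D y M (d + c)" by (rule adjoinI)
    moreover have "y v * F v = (\<Sum>i<D. y v ^ i * g i v)" for v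
    proof -
      have "y v * F v = (\<Sum>i<D'. y v ^ Suc i * f i v) + y v ^ D * f D' v"
        by (simp add: f(2) Suc sum_distrib_left algebra_simps)
      also have "\<dots> = (\<Sum>i<D. y v ^ i * (if i = 0 then 0 else f (i - 1) v))
          + (\<Sum>i<D. y v ^ i * (a i v * f D' v))"
        using rel[OF f(1), of D' v, unfolded sum_distrib_right mult.assoc]
        by (simp add: Suc sum.lessThan_Suc_shift sum_distrib_right mult.assoc del: sum.lessThan_Suc power_Suc)
      finally show ?thesis by (simp add: g_def algebra_simps sum.distrib)
    qed
    ultimately show ?thesis by simp
  qed
  then show ?thesis unfolding multiplier_def by blast
qed

lemma subset_adjoin: "0 < D \<Longrightarrow> filtered M \<Longrightarrow> M d \<subseteq> adjoin D y M d"
proof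
  fix f assume D: "0 < D" "filtered M" and f: "f \<in> M d"
  have "(\<lambda>v. \<Sum>i<D. y v ^ i * (if i = 0 then f v else 0)) = f"
    using D by (cases D) (simp_all add: sum.lessThan_Suc_shift del: sum.lessThan_Suc)
  moreover have "(\<lambda>v. \<Sum>i<D. y v ^ i * (\<lambda>i v. if i = 0 then f v else 0) i v) \<in> adjoin D y M d"
  proof (rule adjoinI)
    show "(\<lambda>v. if i = 0 then f v else 0) \<in> M d" for i
      using f filtered_zero[OF D(2)] by (cases "i = 0") auto
  qed
  ultimately show "f \<in> adjoin D y M d" by simp
qed

lemma growth_adjoin:
  assumes "growth_le M n"
  shows "growth_le (adjoin D y M) n"
proof -
  obtain K where K: "\<And>d. \<exists>T. finite T \<and> card T \<le> K * Suc d ^ n \<and> M d \<subseteq> fun_space.span T"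
    using assms unfolding growth_le_def by blast
  have "\<exists>T. finite T \<and> card T \<le> (D * K) * Suc d ^ n \<and> adjoin D y M d \<subseteq> fun_space.span T" for d
  proof -
    obtain T where T: "finite T" "card T \<le> K * Suc d ^ n" "M d \<subseteq> fun_space.span T"
      using K by blast
    define T' where "T' = (\<lambda>(i, f) v. y v ^ i * f v) ` ({..<D} \<times> T)"
    have gen: "(\<lambda>v. y v ^ i * f v) \<in> fun_space.span T'" if "i < D" "f \<in> fun_space.span T" for i f
      using that(2)
    proof (induction rule: fun_space.span_induct_alt)
      case base
      show ?case using fun_space.span_zero[of T'] by (simp add: zero_fun_def)
    next
      case (step c g h)
      have "(\<lambda>v. y v ^ i * g v) \<in> T'"
        using step(1) that(1) unfolding T'_def by force
      then have "(\<lambda>v. c * (y v ^ i * g v)) + (\<lambda>v. y v ^ i * h v) \<in> fun_space.span T'"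
        using step(2) by (intro fun_space.span_add fun_space.span_scale[OF fun_space.span_base])
      then show ?case by (simp add: plus_fun_def algebra_simps)
    qed
    have "adjoin D y M d \<subseteq> fun_space.span T'"
    proof
      fix F assume "F \<in> adjoin D y M d"
      then obtain f where f: "\<And>i. i < D \<Longrightarrow> f i \<in> M d" "F = (\<lambda>v. \<Sum>i<D. y v ^ i * f i v)"
        by (rule adjoinE) blast
      have "F = (\<Sum>i<D. (\<lambda>v. y v ^ i * f i v))"
        by (simp add: f(2) fun_eq_iff sum_fun_apply)
      also have "\<dots> \<in> fun_space.span T'"
        by (rule fun_space.span_sum) (use gen f(1) T(3) in blast)
      finally show "F \<in> fun_space.span T'" .
    qed
    moreover have "card T' \<le> (D * K) * Suc d ^ n"
    proof -
      have "card T' \<le> card ({..<D} \<times> T)" unfolding T'_def using T(1) by (intro card_image_le) simp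
      also have "\<dots> = D * card T" by (simp add: card_cartesian_product)
      also have "\<dots> \<le> (D * K) * Suc d ^ n" using T(2) by (simp add: mult.assoc)
      finally show ?thesis .
    qed
    moreover have "finite T'" using T(1) by (simp add: T'_def)
    ultimately show ?thesis by blast
  qed
  then show ?thesis unfolding growth_le_def by blast
qed

text \<open>
  The factor \<open>indicator C\<close> replaces the restriction to \<open>C\<close>: equations that hold on \<open>C\<close> only become
  equations of functions.
\<close>

definition poly_space :: "'a set \<Rightarrow> 'j set \<Rightarrow> ('j \<Rightarrow> 'a \<Rightarrow> complex) \<Rightarrow> nat \<Rightarrow> ('a \<Rightarrow> complex) set" where
  "poly_space C J g d = fun_space.span
     ((\<lambda>m v. indicator C v * (\<Prod>k\<in>J. g k v ^ m k)) ` (J \<rightarrow>\<^sub>E {..d}))"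

lemma filtered_poly_space: "filtered (poly_space C J g)"
proof -
  have "J \<rightarrow>\<^sub>E {..d} \<subseteq> J \<rightarrow>\<^sub>E {..e}" if "d \<le> e" for d e :: nat
    using that by (intro PiE_mono) auto
  then show ?thesis
    unfolding filtered_def poly_space_def
    by (auto intro!: monoI fun_space.span_mono image_mono)
qed

lemma growth_poly_space:
  assumes "finite J"
  shows "growth_le (poly_space C J g) (card J)"
proof -
  have "card ((\<lambda>m v. indicator C v * (\<Prod>k\<in>J. g k v ^ m k) :: complex) ` (J \<rightarrow>\<^sub>E {..d}))
      \<le> 1 * Suc d ^ card J" for d
    using card_image_le[OF finite_PiE[OF assms, of "\<lambda>_. {..d}"]] assms by (simp add: card_PiE)
  moreover have "finite ((\<lambda>m v. indicator C v * (\<Prod>k\<in>J. g k v ^ m k) :: complex) ` (J \<rightarrow>\<^sub>E {..d}))" for d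
    using assms by (intro finite_imageI finite_PiE) auto
  ultimately show ?thesis
    unfolding growth_le_def poly_space_def by blast
qed

lemma multiplier_poly_space:
  assumes J: "finite J" "j \<in> J"
  shows "multiplier (poly_space C J g) (g j)"
proof -
  have "(\<lambda>v. g j v * f v) \<in> poly_space C J g (d + 1)" if "f \<in> poly_space C J g d" for f d
    using that unfolding poly_space_def
  proof (induction rule: fun_space.span_induct_alt)
    case base
    show ?case using fun_space.span_zero by (simp add: zero_fun_def)
  next
    case (step c x h)
    let ?B = "(\<lambda>m v. indicator C v * (\<Prod>k\<in>J. g k v ^ m k) :: complex) ` (J \<rightarrow>\<^sub>E {..d + 1})"
    obtain m where m: "m \<in> J \<rightarrow>\<^sub>E {..d}" "x = (\<lambda>v. indicator C v * (\<Prod>k\<in>J. g k v ^ m k))"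
      using step(1) by blast
    define m' where "m' = m(j := Suc (m j))"
    have m': "m' \<in> J \<rightarrow>\<^sub>E {..d + 1}"
      using m(1) J(2) unfolding m'_def PiE_def Pi_def extensional_def by (auto simp: le_Suc_eq)
    have "(\<Prod>k\<in>J. g k v ^ m' k) = g j v * (\<Prod>k\<in>J. g k v ^ m k)" for v
    proof -
      have "(\<Prod>k\<in>J - {j}. g k v ^ m' k) = (\<Prod>k\<in>J - {j}. g k v ^ m k)"
        by (rule prod.cong) (auto simp: m'_def)
      then show ?thesis using J by (simp add: prod.remove m'_def)
    qed
    then have "(\<lambda>v. g j v * x v) = (\<lambda>v. indicator C v * (\<Prod>k\<in>J. g k v ^ m' k))"
      by (simp add: m(2) ac_simps)
    then have "(\<lambda>v. g j v * x v) \<in> ?B" using m' by blast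
    then have "(\<lambda>v. c * (g j v * x v)) + (\<lambda>v. g j v * h v) \<in> fun_space.span ?B"
      using step(2) by (intro fun_space.span_add fun_space.span_scale[OF fun_space.span_base])
    then show ?case by (simp add: plus_fun_def algebra_simps)
  qed
  then show ?thesis unfolding multiplier_def by blast
qed

lemma indicator_in_poly_space: "indicator C \<in> poly_space C J g d"
proof -
  have "(\<lambda>v. indicator C v * (\<Prod>k\<in>J. g k v ^ (\<lambda>k\<in>J. 0) k)) \<in> poly_space C J g d"
    unfolding poly_space_def by (intro fun_space.span_base imageI) auto
  then show ?thesis by simp
qed

lemma poly_space_off: "f \<in> poly_space C J g d \<Longrightarrow> v \<notin> C \<Longrightarrow> f v = 0"
  unfolding poly_space_def by (induction rule: fun_space.span_induct_alt) auto

lemma adjoin_off: "(\<And>f. f \<in> M d \<Longrightarrow> f v = 0) \<Longrightarrow> F \<in> adjoin D y M d \<Longrightarrow> F v = 0"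
  by (auto elim!: adjoinE intro!: sum.neutral)

text \<open>
  The power products of \<open>k\<close> algebraically independent multipliers with exponents up to \<open>N\<close> are
  \<open>(N + 1)\<^sup>k\<close> independent functions in a space of dimension \<open>O(N\<^sup>n)\<close>.
\<close>

lemma alg_indep_length_le:
  assumes M: "filtered M" "growth_le M n" and hs: "\<And>h. h \<in> set hs \<Longrightarrow> multiplier M h"
    and C: "indicator C \<in> M 0" "alg_indep_on C hs"
  shows "length hs \<le> n"
proof -
  have pow: "\<exists>c. \<forall>a d. \<forall>f\<in>M d. (\<lambda>v. h v ^ a * f v) \<in> M (d + c * a)" if h: "multiplier M h" for h
  proof -
    obtain c where c: "\<And>d f. f \<in> M d \<Longrightarrow> (\<lambda>v. h v * f v) \<in> M (d + c)"
      using h unfolding multiplier_def by blast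
    have "(\<lambda>v. h v ^ a * f v) \<in> M (d + c * a)" if "f \<in> M d" for a d f
    proof (induction a)
      case (Suc a)
      from c[OF Suc] show ?case by (simp add: ac_simps)
    qed (use that in simp)
    then show ?thesis by blast
  qed
  have "\<exists>c. \<forall>N. \<forall>as\<in>exponents (length hs) N.
      (\<lambda>v. power_product hs as v * indicator C v) \<in> M (c * N)"
    using hs
  proof (induction hs)
    case Nil
    show ?case using C(1) by (intro exI[of _ 0]) (simp add: exponents_0)
  next
    case (Cons h hs)
    obtain c where c: "\<And>N as. as \<in> exponents (length hs) N \<Longrightarrow>
        (\<lambda>v. power_product hs as v * indicator C v) \<in> M (c * N)"
      using Cons by auto
    obtain b where b: "\<And>a d f. f \<in> M d \<Longrightarrow> (\<lambda>v. h v ^ a * f v) \<in> M (d + b * a)"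
      using pow[OF Cons.prems, of h] by (metis list.set_intros(1))
    have "(\<lambda>v. power_product (h # hs) as v * indicator C v) \<in> M ((c + b) * N)"
      if as: "as \<in> exponents (length (h # hs)) N" for as N
    proof -
      obtain a as' where a: "as = a # as'" "a \<le> N" "as' \<in> exponents (length hs) N"
        using as by (auto simp: exponents_Suc)
      have "c * N + b * a \<le> (c + b) * N" using a(2) by (simp add: algebra_simps)
      from filtered_mono[OF M(1) b[OF c[OF a(3)], of a] this] show ?thesis
        by (simp add: a(1) mult.assoc)
    qed
    then show ?case by blast
  qed
  then obtain c where c: "\<And>N as. as \<in> exponents (length hs) N \<Longrightarrow>
      (\<lambda>v. power_product hs as v * indicator C v) \<in> M (c * N)" by blast
  obtain K where K: "\<And>d. \<exists>T. finite T \<and> card T \<le> K * Suc d ^ n \<and> M d \<subseteq> fun_space.span T"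
    using M(2) unfolding growth_le_def by blast
  have count: "Suc N ^ length hs \<le> (K * Suc c ^ n) * Suc N ^ n" for N
  proof -
    obtain T where T: "finite T" "card T \<le> K * Suc (c * N) ^ n" "M (c * N) \<subseteq> fun_space.span T"
      using K by blast
    have "indep_on UNIV (exponents (length hs) N) (\<lambda>as v. power_product hs as v * indicator C v)"
      unfolding indep_on_def
    proof (intro allI impI)
      fix x assume x: "\<forall>v\<in>UNIV. (\<Sum>i\<in>exponents (length hs) N.
          x i * (power_product hs i v * indicator C v)) = 0"
      have "\<forall>v\<in>C. (\<Sum>i\<in>exponents (length hs) N. x i * power_product hs i v) = 0"
      proof
        fix v assume "v \<in> C"
        then show "(\<Sum>i\<in>exponents (length hs) N. x i * power_product hs i v) = 0"
          using x[rule_format, of v] by simp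
      qed
      then show "\<forall>i\<in>exponents (length hs) N. x i = 0"
        using C(2) indep_onD[of C "exponents (length hs) N" "power_product hs" x]
        unfolding alg_indep_on_def by blast
    qed
    then have "card (exponents (length hs) N) \<le> card T"
      using T(1,3) c by (intro card_le_of_indep_on[of _ "\<lambda>as v. power_product hs as v * indicator C v"]) auto
    then have "Suc N ^ length hs \<le> card T" by (simp add: card_exponents)
    also have "\<dots> \<le> K * Suc (c * N) ^ n" by (rule T(2))
    also have "\<dots> \<le> K * (Suc c * Suc N) ^ n" by (intro mult_le_mono2 power_mono) simp_all
    finally show ?thesis by (simp only: power_mult_distrib mult.assoc)
  qed
  show ?thesis
  proof (rule ccontr)
    assume "\<not> length hs \<le> n"
    \<comment> \<open>the constant in \<open>count\<close>; it is smaller than \<open>N + 1\<close>, so one factor \<open>N + 1\<close> too many is a contradiction\<close>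
    define N where "N = K * Suc c ^ n"
    have "Suc N * Suc N ^ n \<le> Suc N ^ length hs"
      using \<open>\<not> length hs \<le> n\<close> power_increasing[of "Suc n" "length hs" "Suc N"] by simp
    also have "\<dots> \<le> N * Suc N ^ n" using count[of N] by (simp add: N_def)
    finally show False by simp
  qed
qed

section \<open>Chains of linear subspaces\<close>

definition irreducible_chain :: "'n::finite ppoint set \<Rightarrow> nat \<Rightarrow> (nat \<Rightarrow> 'n ppoint set) \<Rightarrow> bool" where
  "irreducible_chain S n Z \<longleftrightarrow>
     (\<forall>i\<le>n. irreducible_variety (Z i) \<and> Z i \<subseteq> S) \<and> (\<forall>i<n. Z i \<subset> Z (Suc i))"

lemma proj_dim_altdef: "proj_dim S = Sup {enat n |n. \<exists>Z. irreducible_chain S n Z}"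
  unfolding proj_dim_def irreducible_chain_def by (rule refl)

text \<open>The coordinate flag bounds the dimension of projective space from below.\<close>

lemma irreducible_linear_chain:
  "\<exists>Z. irreducible_chain (proj_space :: 'n::finite ppoint set) (CARD('n) - 1) Z"
proof -
  obtain h where h: "bij_betw h {0..<CARD('n)} (UNIV :: 'n set)"
    using ex_bij_betw_nat_finite[of "UNIV :: 'n set"] by auto
  have hinj: "h i = h j \<longleftrightarrow> i = j" if "i < CARD('n)" "j < CARD('n)" for i j
    using h that by (auto simp: bij_betw_def inj_on_def)
  define \<Phi> where "\<Phi> i = {\<lambda>v :: complex ^ 'n. v $ h j |j. i < j \<and> j < CARD('n)}" for i
  define W where "W i = {v :: complex ^ 'n. \<forall>j. i < j \<and> j < CARD('n) \<longrightarrow> v $ h j = 0}" for i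
  define Z where "Z i = {p \<in> proj_space. \<forall>f\<in>\<Phi> i. \<forall>v\<in>p. f v = 0}" for i
  have W: "vec.subspace (W i)" for i
    by (auto simp: W_def vec.subspace_def)
  have Z: "Z i = {p \<in> proj_space. p \<subseteq> W i}" for i
  proof -
    have "(\<forall>f\<in>\<Phi> i. \<forall>v\<in>p. f v = 0) \<longleftrightarrow> p \<subseteq> W i" for p
    proof
      assume "\<forall>f\<in>\<Phi> i. \<forall>v\<in>p. f v = 0"
      then show "p \<subseteq> W i" unfolding \<Phi>_def W_def by fast
    next
      assume "p \<subseteq> W i"
      then show "\<forall>f\<in>\<Phi> i. \<forall>v\<in>p. f v = 0" unfolding \<Phi>_def W_def by auto
    qed
    then show ?thesis by (simp add: Z_def)
  qed
  have span_in: "vec.span {v} \<in> Z i \<longleftrightarrow> v \<in> W i" if "v \<noteq> 0" for v i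
  proof
    assume "vec.span {v} \<in> Z i"
    then show "v \<in> W i" using vec.span_base[of v "{v}"] by (auto simp: Z)
  next
    assume "v \<in> W i"
    then have "vec.span {v} \<subseteq> W i" using W by (intro vec.span_minimal) auto
    then show "vec.span {v} \<in> Z i" using span_in_proj_space[OF that] by (simp add: Z)
  qed
  have axis: "vec.span {axis (h j) 1} \<in> Z i \<longleftrightarrow> j \<le> i" if "j < CARD('n)" for i j
  proof -
    have "axis (h j) (1::complex) \<noteq> 0" by (simp add: axis_eq_0_iff)
    then have "vec.span {axis (h j) 1} \<in> Z i \<longleftrightarrow> axis (h j) 1 \<in> W i"
      by (rule span_in)
    also have "\<dots> \<longleftrightarrow> (\<forall>k. i < k \<and> k < CARD('n) \<longrightarrow> k \<noteq> j)"
      unfolding W_def axis_def using that hinj by simp metis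
    also have "\<dots> \<longleftrightarrow> j \<le> i" using that by (auto simp: not_le[symmetric])
    finally show ?thesis .
  qed
  have "irreducible_variety (Z i)" if "i < CARD('n)" for i
  proof (rule prime_on_imp_irreducible)
    show "zariski_closed (Z i)"
      unfolding Z_def
    proof (rule zariski_closed_restrict[OF zariski_closed_proj_space])
      fix f assume "f \<in> \<Phi> i"
      then show "f \<in> polyfun \<and> (\<exists>d. homog d f)"
        by (auto simp: \<Phi>_def homog_def intro!: exI[of _ 1])
    qed
    have "vec.span {axis (h 0) 1} \<in> Z i" using axis[of 0 i] that by simp
    then show ne: "Z i \<noteq> {}" by blast
    have "\<Union>(Z i) = W i"
    proof
      show "W i \<subseteq> \<Union>(Z i)"
      proof
        fix v assume v: "v \<in> W i"
        show "v \<in> \<Union>(Z i)"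
        proof (cases "v = 0")
          case True
          then show ?thesis using zero_in_cone[of "Z i"] ne by (auto simp: Z_def)
        next
          case False
          then have "vec.span {v} \<in> Z i" using span_in v by simp
          then show ?thesis using vec.span_base[of v "{v}"] by blast
        qed
      qed
    qed (auto simp: Z)
    then show "prime_on (\<Union>(Z i))" using prime_on_subspace[OF W] by simp
  qed
  moreover have "Z i \<subset> Z (Suc i)" if "Suc i < CARD('n)" for i
  proof
    have "W i \<subseteq> W (Suc i)" unfolding W_def using Suc_lessD by blast
    then show "Z i \<subseteq> Z (Suc i)" unfolding Z by blast
    have "vec.span {axis (h (Suc i)) 1} \<in> Z (Suc i)" "vec.span {axis (h (Suc i)) 1} \<notin> Z i"
      using axis[OF that] by simp_all
    then show "Z i \<noteq> Z (Suc i)" by metis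
  qed
  moreover have "Z i \<subseteq> proj_space" for i by (simp add: Z_def)
  moreover have "i < CARD('n)" if "i \<le> CARD('n) - 1" for i
    using that zero_less_card_finite[where 'a = 'n] by linarith
  ultimately have "irreducible_chain proj_space (CARD('n) - 1) Z"
    unfolding irreducible_chain_def by (simp add: less_diff_conv)
  then show ?thesis by (rule exI[of "irreducible_chain proj_space (CARD('n) - 1)"])
qed

text \<open>
  In \<open>enat\<close> a finite supremum of a nonempty set is attained; without \<open>P m\<close>, the value 0 could also be
  the supremum of the empty set.
\<close>

lemma Sup_enat_attained:
  assumes "Sup {enat n |n. P n} = enat k" "P m"
  shows "P k"
proof -
  let ?A = "{enat n |n. P n}"
  have ne: "?A \<noteq> {}" using assms(2) by blast
  then have "finite ?A" "Sup ?A = Max ?A"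
    using assms(1) by (auto simp: Sup_enat_def split: if_splits)
  then have "enat k \<in> ?A" using Max_in[OF _ ne] assms(1) by simp
  then show ?thesis by blast
qed

lemma hypersurface_dim:
  fixes S :: "'n::finite ppoint set"
  assumes "hypersurface S"
  obtains k where "proj_dim S = enat k" "k + 2 = CARD('n)"
proof -
  have eq: "proj_dim S + 2 = enat CARD('n)" using assms by (simp add: hypersurface_def)
  then obtain k where k: "proj_dim S = enat k" by (cases "proj_dim S") auto
  have "enat (k + 2) = enat CARD('n)" using eq unfolding k by (metis numeral_eq_enat plus_enat_simps(1))
  then show thesis using that k by blast
qed

lemma hypersurface_alg_indep:
  fixes S :: "'n::finite ppoint set"
  assumes "irreducible_variety S" "hypersurface S"
  shows "\<exists>hs. Suc (length hs) = CARD('n) \<and> set hs \<subseteq> polyfun \<and> alg_indep_on (\<Union>S) hs"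
proof -
  obtain k where k: "proj_dim S = enat k" "k + 2 = CARD('n)"
    by (rule hypersurface_dim[OF assms(2)])
  have "irreducible_chain S 0 (\<lambda>_. S)" using assms(1) by (simp add: irreducible_chain_def)
  then have "\<exists>Z. irreducible_chain S 0 Z" by (rule exI[of "irreducible_chain S 0"])
  from Sup_enat_attained[OF k(1)[unfolded proj_dim_altdef] this]
  have "\<exists>Z. irreducible_chain S k Z" .
  then obtain Z where Z: "irreducible_chain S k Z" ..
  have "\<exists>hs. length hs = Suc k \<and> set hs \<subseteq> polyfun \<and> alg_indep_on (\<Union>(Z k)) hs"
    by (rule alg_indep_on_irreducible_chain) (use Z in \<open>unfold irreducible_chain_def, simp_all\<close>)
  then obtain hs where hs: "length hs = Suc k" "set hs \<subseteq> polyfun" "alg_indep_on (\<Union>(Z k)) hs"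
    by (elim exE conjE)
  have "Z k \<subseteq> S" using Z unfolding irreducible_chain_def by simp
  then have "alg_indep_on (\<Union>S) hs" using hs(3) by (rule alg_indep_on_mono[OF Union_mono])
  then show ?thesis using k(2) hs(1,2) by (intro exI[of _ hs]) simp
qed

lemma hypersurface_ne_proj_space:
  fixes S :: "'n::finite ppoint set"
  assumes "hypersurface S"
  shows "S \<noteq> proj_space"
proof
  assume S: "S = proj_space"
  obtain k where k: "proj_dim S = enat k" "k + 2 = CARD('n)"
    by (rule hypersurface_dim[OF assms])
  then have "CARD('n) - 1 = Suc k" by simp
  with irreducible_linear_chain[where 'n = 'n] have "\<exists>Z. irreducible_chain S (Suc k) Z"
    by (simp add: S)
  then have "enat (Suc k) \<in> {enat n |n. \<exists>Z. irreducible_chain S n Z}" by (intro CollectI exI[of _ "Suc k"] conjI refl)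
  then have "enat (Suc k) \<le> proj_dim S"
    unfolding proj_dim_altdef by (rule Sup_upper)
  then show False using k(1) by simp
qed

section \<open>Projecting along a line\<close>

lemma poly_eq_sum_atMost:
  fixes p :: "'a::comm_ring_1 poly"
  assumes "degree p \<le> n"
  shows "poly p x = (\<Sum>i\<le>n. coeff p i * x ^ i)"
proof -
  have "poly p x = poly (\<Sum>i\<le>n. monom (coeff p i) i) x"
    using poly_as_sum_of_monoms'[OF assms] by simp
  then show ?thesis by (simp add: poly_sum poly_monom)
qed

text \<open>
  The projection along \<open>e\<close> onto the hyperplane of the vectors whose \<open>i0\<close>-th coordinate is 0. The
  coordinate \<open>i0\<close> only provides a linear form that is nonzero at \<open>e\<close>.
\<close>

locale coordinate_projection =
  fixes e :: "complex ^ 'n::finite" and i0 :: 'n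
  assumes nonzero: "e $ i0 \<noteq> 0"
begin

definition height :: "complex ^ 'n \<Rightarrow> complex" where
  "height v = v $ i0 / e $ i0"

definition shadow :: "complex ^ 'n \<Rightarrow> complex ^ 'n" where
  "shadow v = v - height v *s e"

text \<open>
  This makes a polynomial function \<open>f\<close> a polynomial in the height, with coefficients that are
  functions of the shadow: \<open>f v\<close> is the value of \<open>fiber f v\<close> at \<open>height v\<close>.
\<close>

definition fiber :: "(complex ^ 'n \<Rightarrow> complex) \<Rightarrow> complex ^ 'n \<Rightarrow> complex poly" where
  "fiber f v = line_poly f (shadow v) e"

lemma polyfun_height [simp, intro]: "height \<in> polyfun"
  unfolding height_def[abs_def] by (intro polyfun_divide_const polyfun.coord)

lemma polyfun_shadow [simp, intro]: "(\<lambda>v. shadow v $ i) \<in> polyfun"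
proof -
  have "(\<lambda>v. shadow v $ i) = (\<lambda>v. v $ i - height v * e $ i)"
    by (simp add: shadow_def fun_eq_iff)
  then show ?thesis by (simp add: polyfun_diff polyfun.mult)
qed

lemma height_shadow [simp]: "height (shadow v) = 0"
  using nonzero by (simp add: shadow_def height_def)

lemma shadow_component [simp]: "shadow v $ i0 = 0"
  using nonzero by (simp add: shadow_def height_def)

lemma shadow_shadow [simp]: "shadow (shadow v) = shadow v"
  by (subst shadow_def) simp

lemma shadow_plus_height: "shadow v + height v *s e = v"
  by (simp add: shadow_def)

lemma height_shadow_plus [simp]: "height (shadow v + t *s e) = t"
  using nonzero by (simp add: height_def)

lemma shadow_shadow_plus [simp]: "shadow (shadow v + t *s e) = shadow v"
  by (subst shadow_def) simp

lemma shadow_scale: "shadow (c *s v) = c *s shadow v"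
  by (simp add: shadow_def height_def vec.scale_right_diff_distrib)

lemma shadow_plus_multiple: "shadow (v + c *s e) = shadow v"
  using nonzero by (simp add: shadow_def height_def add_divide_distrib vec.scale_left_distrib)

lemma poly_fiber: "f \<in> polyfun \<Longrightarrow> poly (fiber f v) t = f (shadow v + t *s e)"
  by (simp add: fiber_def poly_line_poly)

lemma poly_fiber_height: "f \<in> polyfun \<Longrightarrow> poly (fiber f v) (height v) = f v"
  by (simp add: poly_fiber shadow_plus_height)

lemma fiber_shadow_plus [simp]: "fiber f (shadow v + t *s e) = fiber f v"
  and fiber_shadow [simp]: "fiber f (shadow v) = fiber f v"
  by (simp_all add: fiber_def)

lemma fiber_height: "fiber height v = [:0, 1:]"
  unfolding fiber_def by (rule line_poly_eqI) simp

lemma polyfun_coeff_fiber [intro]: "f \<in> polyfun \<Longrightarrow> (\<lambda>v. coeff (fiber f v) j) \<in> polyfun"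
  unfolding fiber_def by (rule polyfun_coeff_line_poly) auto

lemma fiber_mult:
  "f \<in> polyfun \<Longrightarrow> g \<in> polyfun \<Longrightarrow> fiber (\<lambda>v. f v * g v) v = fiber f v * fiber g v"
  by (simp add: fiber_def line_poly_mult)

lemma fiber_diff:
  "f \<in> polyfun \<Longrightarrow> g \<in> polyfun \<Longrightarrow> fiber (\<lambda>v. f v - g v) v = fiber f v - fiber g v"
  by (simp add: fiber_def line_poly_diff)

lemma fiber_power: "f \<in> polyfun \<Longrightarrow> fiber (\<lambda>v. f v ^ k) v = fiber f v ^ k"
  by (simp add: fiber_def line_poly_power)

lemma polyfun_zero_of_fiber:
  assumes "f \<in> polyfun" "\<And>v j. coeff (fiber f v) j = 0"
  shows "f v = 0"
proof -
  have "fiber f v = 0" using assms(2) by (simp add: poly_eq_iff)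
  then show ?thesis using poly_fiber_height[OF assms(1), of v] by simp
qed

text \<open>The polynomial functions that are constant along \<open>e\<close>; they are the coefficients of fibers.\<close>

definition base_fun :: "(complex ^ 'n \<Rightarrow> complex) \<Rightarrow> bool" where
  "base_fun a \<longleftrightarrow> a \<in> polyfun \<and> (\<forall>v. a (shadow v) = a v)"

lemma base_fun_polyfun: "base_fun a \<Longrightarrow> a \<in> polyfun"
  by (simp add: base_fun_def)

lemma fiber_base:
  assumes "base_fun a"
  shows "fiber a v = [:a v:]"
  unfolding fiber_def
proof (rule line_poly_eqI)
  fix t
  have "a (shadow v + t *s e) = a (shadow (shadow v + t *s e))"
    using assms unfolding base_fun_def by metis
  also have "\<dots> = a v" using assms by (simp add: base_fun_def)
  finally show "poly [:a v:] t = a (shadow v + t *s e)" by simp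
qed

lemma base_fun_coeff_fiber: "f \<in> polyfun \<Longrightarrow> base_fun (\<lambda>v. coeff (fiber f v) j)"
  unfolding base_fun_def by (simp add: polyfun_coeff_fiber)

text \<open>
  The functions \<open>\<alpha>\<^sub>k\<close> become multipliers once the powers of the height are adjoined: on \<open>C\<close> the
  equation \<open>F (\<alpha> v) = 0\<close> expresses the top power of the height by lower ones, as its leading
  coefficient is the constant \<open>F e\<close>.
\<close>

lemma multiplier_adjoin_height:
  assumes M: "filtered M" "\<And>d f v. f \<in> M d \<Longrightarrow> v \<notin> C \<Longrightarrow> f v = 0"
    and \<alpha>: "\<And>k. multiplier M (\<lambda>v. shadow (\<alpha> v) $ k)"
    and F: "F \<in> polyfun" "homog D F" "F e \<noteq> 0" "\<And>v. v \<in> C \<Longrightarrow> F (\<alpha> v) = 0"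
  shows "multiplier (adjoin D (\<lambda>v. height (\<alpha> v)) M) (\<lambda>v. \<alpha> v $ k)"
proof -
  let ?y = "\<lambda>v. height (\<alpha> v)"
  define a where "a i v = - 1 / F e * coeff (fiber F (shadow (\<alpha> v))) i" for i v
  have "multiplier M (a i)" for i
    unfolding a_def
    using multiplier_mult[OF multiplier_const[OF M(1)] multiplier_polyfun[OF M(1) \<alpha>]]
      polyfun_coeff_fiber[OF F(1)] by blast
  moreover have "?y v ^ D * f v = (\<Sum>i<D. ?y v ^ i * a i v) * f v" if "f \<in> M d" for d f v
  proof (cases "v \<in> C")
    case True
    have deg: "degree (fiber F (\<alpha> v)) \<le> D" "coeff (fiber F (\<alpha> v)) D = F e"
      unfolding fiber_def using homog_line_poly[OF F(1,2)] by auto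
    have "0 = poly (fiber F (\<alpha> v)) (?y v)"
      using F(4)[OF True] poly_fiber_height[OF F(1)] by simp
    also have "\<dots> = (\<Sum>i\<le>D. coeff (fiber F (\<alpha> v)) i * ?y v ^ i)"
      by (rule poly_eq_sum_atMost) (rule deg)
    also have "\<dots> = F e * ?y v ^ D - F e * (\<Sum>i<D. ?y v ^ i * a i v)"
      using F(3) by (simp add: lessThan_Suc_atMost[symmetric] deg(2) a_def sum_distrib_left sum_negf ac_simps)
    finally show ?thesis using F(3) by (simp add: algebra_simps)
  qed (use M(2)[OF that] in simp)
  ultimately have y: "multiplier (adjoin D ?y M) ?y"
    by (rule multiplier_adjoin_self[OF M(1), where a = a])
  have "multiplier (adjoin D ?y M) (\<lambda>v. shadow (\<alpha> v) $ k + ?y v * e $ k)"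
    by (rule multiplier_add[OF filtered_adjoin[OF M(1)] multiplier_adjoin[OF \<alpha>]
          multiplier_mult[OF y multiplier_const[OF filtered_adjoin[OF M(1)]]]])
  moreover have "shadow (\<alpha> v) $ k + ?y v * e $ k = \<alpha> v $ k" for v
    using shadow_plus_height[of "\<alpha> v"] by (simp add: vec_eq_iff)
  ultimately show ?thesis by simp
qed

text \<open>
  A nonzero function that is constant along \<open>e\<close> and zero on \<open>C\<close> gives a second direction \<open>e'\<close> in
  which \<open>C\<close> satisfies a monic equation. The polynomial functions on \<open>C\<close> then grow like those in
  two variables less, which leaves no room for \<open>CARD('n) - 1\<close> algebraically independent ones.
\<close>

lemma base_fun_zero:
  assumes cone: "0 \<in> C" "\<And>c v. v \<in> C \<Longrightarrow> c *s v \<in> C"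
    and F: "F \<in> polyfun" "homog D F" "F e \<noteq> 0" "\<And>v. v \<in> C \<Longrightarrow> F v = 0"
    and hs: "set hs \<subseteq> polyfun" "alg_indep_on C hs" "Suc (length hs) = CARD('n)"
    and b: "base_fun b" "\<And>v. v \<in> C \<Longrightarrow> b v = 0"
  shows "b v = 0"
proof (rule ccontr)
  assume "b v \<noteq> 0"
  have bp: "b \<in> polyfun" "\<And>v. b (shadow v) = b v" using b(1) by (auto simp: base_fun_def)
  obtain E where Ev: "component b E v \<noteq> 0"
    using \<open>b v \<noteq> 0\<close> sum_components[OF bp(1), of v] by (metis sum.neutral)
  define a where "a = component b E"
  have a: "a \<in> polyfun" "homog E a" unfolding a_def using bp(1) homog_component by auto
  have a_shadow: "a (shadow u) = a u" for u
  proof -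
    have "line_poly b 0 (shadow u) = line_poly b 0 u"
      by (rule line_poly_eqI) (metis poly_line_poly[OF bp(1)] add_0 bp(2) shadow_scale)
    then show ?thesis by (simp add: a_def component_def)
  qed
  have a0: "a u = 0" if "u \<in> C" for u
    using components_zero_iff[OF bp(1), of u] b(2) cone(2)[OF that] by (simp add: a_def)
  \<comment> \<open>a point of the base where the homogeneous component \<open>a\<close> is nonzero: \<open>a\<close> is monic along it\<close>
  define e' where "e' = shadow v"
  have ae': "a e' \<noteq> 0" using Ev by (simp add: e'_def a_shadow) (simp add: a_def)
  have "e' \<noteq> 0" using ae' a0[OF cone(1)] by auto
  then obtain i1 where i1: "e' $ i1 \<noteq> 0" by (auto simp: vec_eq_iff)
  have e'0: "e' $ i0 = 0" unfolding e'_def by simp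
  with i1 have i01: "i0 \<noteq> i1" by auto
  interpret P': coordinate_projection e' i1 by unfold_locales (rule i1)
  define \<rho> where "\<rho> u = P'.shadow (shadow u)" for u
  define J where "J = UNIV - {i0, i1}"
  have cardJ: "card J + 2 = CARD('n)"
  proof -
    have "card J = CARD('n) - card {i0, i1}" unfolding J_def by (rule card_Diff_subset) auto
    moreover have "card {i0, i1} \<le> CARD('n)" by (rule card_mono) auto
    ultimately show ?thesis using i01 by simp
  qed
  \<comment> \<open>the coordinates of \<open>\<rho>\<close> generate; the heights along \<open>e'\<close> and \<open>e\<close> are adjoined in turn\<close>
  define M0 where "M0 = poly_space C J (\<lambda>k u. \<rho> u $ k)"
  define M1 where "M1 = adjoin E (\<lambda>u. P'.height (shadow u)) M0"
  define M2 where "M2 = adjoin D height M1"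
  have filt: "filtered M0" "filtered M1" "filtered M2"
    unfolding M0_def M1_def M2_def by (intro filtered_adjoin filtered_poly_space)+
  have off0: "f u = 0" if "f \<in> M0 d" "u \<notin> C" for f d u
    using that poly_space_off unfolding M0_def by metis
  have off1: "f u = 0" if "f \<in> M1 d" "u \<notin> C" for f d u
    using adjoin_off[of M0 d u f] off0 that unfolding M1_def by blast
  have \<rho>: "multiplier M0 (\<lambda>u. \<rho> u $ k)" for k
  proof (cases "k \<in> J")
    case True
    then show ?thesis
      using multiplier_poly_space[of J k C "\<lambda>k u. \<rho> u $ k"] unfolding M0_def by simp
  next
    case False
    have "\<rho> u $ i0 = 0" "\<rho> u $ i1 = 0" for u
      unfolding \<rho>_def using i1 e'0 by (simp_all add: P'.shadow_def[of "shadow u"] P'.height_def)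
    then have "(\<lambda>u. \<rho> u $ k) = (\<lambda>u. 0)" using False by (auto simp: J_def fun_eq_iff)
    then show ?thesis using multiplier_const[OF filt(1)] by simp
  qed
  have "multiplier M1 (\<lambda>u. shadow u $ k)" for k
    unfolding M1_def
    by (rule P'.multiplier_adjoin_height[where C = C and F = a])
      (use filt(1) off0 \<rho> a ae' a0 a_shadow in \<open>auto simp: \<rho>_def\<close>)
  then have coords: "multiplier M2 (\<lambda>u. u $ k)" for k
    unfolding M2_def
    by (intro multiplier_adjoin_height[where C = C and F = F and \<alpha> = "\<lambda>u. u"])
      (use filt(2) off1 F in auto)
  have "length hs \<le> card J"
  proof (rule alg_indep_length_le)
    show "filtered M2" by (rule filt)
    show "growth_le M2 (card J)"
      unfolding M2_def M1_def M0_def by (intro growth_adjoin growth_poly_space) simp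
    show "multiplier M2 h" if "h \<in> set hs" for h
      using multiplier_polyfun[of M2 "\<lambda>u. u" h] filt(3) coords hs(1) that by auto
    have pos: "0 < E" "0 < D"
      using ae' a0[OF cone(1)] a(2) F(2,3) F(4)[OF cone(1)] unfolding homog_def
      by (metis gr0I mult_1 power_0 vec.scale_zero_left)+
    have "indicator C \<in> M0 0" unfolding M0_def by (rule indicator_in_poly_space)
    then show "indicator C \<in> M2 0"
      using subset_adjoin[OF pos(1) filt(1)] subset_adjoin[OF pos(2) filt(2)]
      unfolding M2_def M1_def by blast
    show "alg_indep_on C hs" by (rule hs)
  qed
  then show False using hs(3) cardJ by simp
qed

end

section \<open>Divisibility of polynomial functions\<close>

text \<open>
  As \<open>a v0 \<noteq> 0\<close>, the coefficients of the quotient along a line through \<open>v0\<close> can be computed from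
  the lowest one upwards, dividing by the constant \<open>a v0\<close> only; so they are polynomial functions of
  the direction of the line. At parameter 1 the quotients on the lines assemble to a polynomial
  function.
\<close>

lemma polyfun_dvd_of_lines:
  assumes a: "a \<in> polyfun" "a v0 \<noteq> 0" and p: "p \<in> polyfun"
    and lines: "\<And>w. line_poly a v0 w dvd line_poly p v0 w"
  shows "\<exists>q\<in>polyfun. \<forall>v. p v = a v * q v"
proof -
  define Q where "Q w = line_poly p v0 w div line_poly a v0 w" for w
  have Q: "line_poly p v0 w = line_poly a v0 w * Q w" for w
    unfolding Q_def using lines[of w] by simp
  obtain D where D: "\<And>u w. degree (line_poly p u w) \<le> D"
    using line_poly_degree_bound[OF p] by blast
  have a0: "coeff (line_poly a v0 w) 0 = a v0" for w
    using poly_line_poly[OF a(1), of v0 w 0] by (simp add: poly_0_coeff_0)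
  have degQ: "degree (Q w) \<le> D" for w
  proof (cases "Q w = 0")
    case False
    moreover have "line_poly a v0 w \<noteq> 0" using a0[of w] a(2) by auto
    ultimately show ?thesis using D[of v0 w] by (simp add: Q degree_mult_eq)
  qed simp
  have coeffs: "(\<lambda>w. coeff (line_poly f v0 w) j) \<in> polyfun" if "f \<in> polyfun" for f j
    using that by (rule polyfun_coeff_line_poly) auto
  have Qp: "(\<lambda>w. coeff (Q w) j) \<in> polyfun" for j
  proof (induction j rule: less_induct)
    case (less j)
    have "coeff (Q w) j = (coeff (line_poly p v0 w) j
        - (\<Sum>i<j. coeff (Q w) i * coeff (line_poly a v0 w) (j - i))) / a v0" for w
    proof -
      have "coeff (line_poly p v0 w) j = (\<Sum>i\<le>j. coeff (Q w) i * coeff (line_poly a v0 w) (j - i))"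
        unfolding Q by (subst mult.commute) (rule coeff_mult)
      also have "\<dots> = (\<Sum>i<j. coeff (Q w) i * coeff (line_poly a v0 w) (j - i))
          + coeff (Q w) j * a v0"
        by (simp add: lessThan_Suc_atMost[symmetric] a0)
      finally show ?thesis using a(2) by (simp add: field_simps)
    qed
    moreover have "(\<lambda>w. (coeff (line_poly p v0 w) j
        - (\<Sum>i<j. coeff (Q w) i * coeff (line_poly a v0 w) (j - i))) / a v0) \<in> polyfun"
      by (intro polyfun_divide_const polyfun_diff polyfun_sum polyfun.mult coeffs p a less.IH) simp
    ultimately show ?case by simp
  qed
  define q where "q v = poly (Q (v - v0)) 1" for v
  have "(\<lambda>v. \<Sum>j\<le>D. coeff (Q (v - v0)) j) \<in> polyfun"
  proof (rule polyfun_sum)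
    fix j
    have "(\<lambda>v. (v - v0) $ i) \<in> polyfun" for i
      by (simp add: polyfun_diff)
    then show "(\<lambda>v. coeff (Q (v - v0)) j) \<in> polyfun"
      by (rule polyfun_compose[OF Qp])
  qed
  moreover have "q = (\<lambda>v. \<Sum>j\<le>D. coeff (Q (v - v0)) j)"
    by (simp add: q_def poly_eq_sum_atMost[OF degQ] fun_eq_iff)
  ultimately have "q \<in> polyfun" by simp
  moreover have "p v = a v * q v" for v
    using arg_cong[OF Q[of "v - v0"], of "\<lambda>r. poly r 1"] a(1) p
    by (simp add: poly_line_poly q_def)
  ultimately show ?thesis by blast
qed

text \<open>
  Gauss's lemma: \<open>P\<close> is monic, hence primitive, so by multiplicativity of the content \<open>A\<close> and the
  content of \<open>Q\<close>, which divides \<open>A\<close>, are associated.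
\<close>

lemma lead_coeff_dvd_of_monic_multiple:
  fixes P Q U :: "complex poly poly"
  assumes eq: "smult (A ^ k) P = U * Q" and P: "lead_coeff P = 1" and Q: "lead_coeff Q = A" "A \<noteq> 0"
  shows "A dvd coeff Q i"
proof -
  have "content P dvd 1" using content_dvd_coeff[of P "degree P"] P by simp
  then have "content P = 1" using is_unit_content_iff by blast
  then have cont: "normalize (A ^ k) = content U * content Q"
    using arg_cong[OF eq, of content] by (simp add: content_mult)
  have "lead_coeff (smult (A ^ k) P) = lead_coeff U * lead_coeff Q"
    unfolding eq by (rule lead_coeff_mult)
  then have lead: "A ^ k = lead_coeff U * A" using P Q by simp
  obtain x where x: "lead_coeff U = content U * x"
    using content_dvd_coeff[of U "degree U"] by (metis dvd_def)
  obtain y where y: "A = content Q * y"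
    using content_dvd_coeff[of Q "degree Q"] Q by (metis dvd_def)
  have "lead_coeff U * A dvd content U * content Q"
    unfolding lead[symmetric] cont[symmetric] by simp
  then have "(content U * content Q) * (x * y) dvd (content U * content Q) * 1"
    using x y by (simp add: ac_simps)
  moreover have "content U * content Q \<noteq> 0" using cont Q(2) by auto
  ultimately have "x * y dvd 1" using dvd_mult_cancel_left[of "content U * content Q" "x * y" 1] by blast
  then have "y dvd 1" by (rule dvd_mult_right)
  then have "A dvd content Q"
    using y by (metis dvd_refl mult_unit_dvd_iff)
  then show ?thesis using content_dvd_coeff dvd_trans by blast
qed

section \<open>The ideal of an irreducible hypersurface is principal\<close>

context coordinate_projection
begin

definition fiber_bound :: "nat \<Rightarrow> (complex ^ 'n \<Rightarrow> complex) \<Rightarrow> bool" where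
  "fiber_bound m f \<longleftrightarrow> (\<forall>v. \<forall>j\<ge>m. coeff (fiber f v) j = 0)"

lemma fiber_bound_exists:
  assumes "f \<in> polyfun"
  shows "\<exists>m. fiber_bound m f"
proof -
  obtain D where D: "\<And>u w. degree (line_poly f u w) \<le> D"
    using line_poly_degree_bound[OF assms] by blast
  have "coeff (fiber f v) j = 0" if "Suc D \<le> j" for v j
  proof -
    have "degree (fiber f v) \<le> D" unfolding fiber_def by (rule D)
    then show ?thesis using that by (simp add: coeff_eq_0)
  qed
  then show ?thesis unfolding fiber_bound_def by blast
qed

lemma fiber_bound_mono: "fiber_bound m f \<Longrightarrow> m \<le> n \<Longrightarrow> fiber_bound n f"
  unfolding fiber_bound_def using order_trans by blast

lemma fiber_bound_0: "f \<in> polyfun \<Longrightarrow> fiber_bound 0 f \<Longrightarrow> f v = 0"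
  unfolding fiber_bound_def by (rule polyfun_zero_of_fiber) auto

lemma fiber_bound_Suc:
  assumes "fiber_bound (Suc m) f" "\<And>v. coeff (fiber f v) m = 0"
  shows "fiber_bound m f"
  using assms unfolding fiber_bound_def by (metis Suc_leI le_neq_implies_less)

text \<open>
  Division by a function \<open>f\<close> of least degree along \<open>e\<close> in the ideal of \<open>C\<close>: multiplying by the
  leading coefficient of \<open>f\<close> first, the leading term can be cancelled, and the last remainder is
  zero by minimality.
\<close>

lemma pseudo_division:
  assumes f: "f \<in> polyfun" "\<And>v. v \<in> C \<Longrightarrow> f v = 0" "fiber_bound (Suc \<delta>) f"
    "\<And>v. coeff (fiber f v) \<delta> = a v"
    and minimal: "\<And>h v. h \<in> polyfun \<Longrightarrow> (\<And>u. u \<in> C \<Longrightarrow> h u = 0) \<Longrightarrow> fiber_bound \<delta> h \<Longrightarrow> h v = 0"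
    and g: "g \<in> polyfun" "\<And>v. v \<in> C \<Longrightarrow> g v = 0"
  shows "\<exists>k. \<exists>u\<in>polyfun. \<forall>v. a v ^ k * g v = u v * f v"
proof -
  have a: "base_fun a"
    using base_fun_coeff_fiber[OF f(1), of \<delta>] f(4) by simp
  have ap: "a \<in> polyfun" using a by (rule base_fun_polyfun)
  have main: "\<exists>k. \<exists>u\<in>polyfun. \<forall>v. a v ^ k * g v = u v * f v"
    if "g \<in> polyfun" "\<And>v. v \<in> C \<Longrightarrow> g v = 0" "fiber_bound (\<delta> + n) g" for n g
    using that
  proof (induction n arbitrary: g)
    case 0
    then have "g v = 0" for v using minimal[of g v] by simp
    then show ?case by (intro exI[of _ 0] bexI[of _ "\<lambda>_. 0"]) auto
  next
    case (Suc n)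
    define b where "b v = coeff (fiber g v) (\<delta> + n)" for v
    have b: "base_fun b" unfolding b_def by (rule base_fun_coeff_fiber[OF Suc.prems(1)])
    define m where "m v = b v * height v ^ n" for v
    define g' where "g' v = a v * g v - m v * f v" for v
    have mp: "m \<in> polyfun"
      unfolding m_def[abs_def]
      by (rule polyfun.mult[OF base_fun_polyfun[OF b] polyfun_power[OF polyfun_height]])
    have parts: "(\<lambda>v. a v * g v) \<in> polyfun" "(\<lambda>v. m v * f v) \<in> polyfun"
      using polyfun.mult ap mp f(1) Suc.prems(1) by blast+
    have g'p: "g' \<in> polyfun"
      unfolding g'_def[abs_def] by (rule polyfun_diff[OF parts])
    have fm: "fiber m v = monom (b v) n" for v
    proof -
      have "fiber m v = fiber b v * fiber (\<lambda>v. height v ^ n) v"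
        unfolding m_def[abs_def]
        by (rule fiber_mult[OF base_fun_polyfun[OF b] polyfun_power[OF polyfun_height]])
      then show ?thesis
        by (simp add: fiber_base[OF b] fiber_power fiber_height monom_altdef)
    qed
    have fg': "fiber g' v = smult (a v) (fiber g v) - monom (b v) n * fiber f v" for v
      unfolding g'_def[abs_def] fiber_diff[OF parts] fiber_mult[OF ap Suc.prems(1)] fiber_mult[OF mp f(1)] fm
        fiber_base[OF a] by simp
    have "coeff (fiber g' v) j = 0" if j: "\<delta> + n \<le> j" for v j
    proof (cases "j = \<delta> + n")
      case True
      then show ?thesis by (simp add: fg' coeff_monom_mult f(4) b_def)
    next
      case False
      then have "Suc \<delta> \<le> j - n" "\<delta> + Suc n \<le> j" using j by auto
      then show ?thesis
        using f(3) Suc.prems(3) unfolding fiber_bound_def by (simp add: fg' coeff_monom_mult)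
    qed
    then have "fiber_bound (\<delta> + n) g'" unfolding fiber_bound_def by blast
    moreover have "g' v = 0" if "v \<in> C" for v
      using that f(2) Suc.prems(2) by (simp add: g'_def)
    ultimately obtain k u where u: "u \<in> polyfun" "\<And>v. a v ^ k * g' v = u v * f v"
      using Suc.IH[OF g'p] by blast
    have "(\<lambda>v. u v + a v ^ k * m v) \<in> polyfun"
      by (rule polyfun.add[OF u(1) polyfun.mult[OF polyfun_power[OF ap] mp]])
    moreover have "a v ^ Suc k * g v = (u v + a v ^ k * m v) * f v" for v
      using u(2)[of v] by (simp add: g'_def algebra_simps)
    ultimately show ?case
      by (intro exI[of _ "Suc k"] bexI[of _ "\<lambda>v. u v + a v ^ k * m v"]) blast+
  qed
  obtain n where "fiber_bound n g" using fiber_bound_exists[OF g(1)] by blast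
  then have "fiber_bound (\<delta> + n) g" by (rule fiber_bound_mono) simp
  then show ?thesis using main g by blast
qed

text \<open>
  On a line in the base, a function \<open>f\<close> becomes a polynomial in two variables: its coefficients with
  respect to the height are polynomials in the parameter of the line.
\<close>

definition plane_poly ::
    "nat \<Rightarrow> (complex ^ 'n \<Rightarrow> complex) \<Rightarrow> complex ^ 'n \<Rightarrow> complex ^ 'n \<Rightarrow> complex poly poly" where
  "plane_poly m f u w = (\<Sum>i<m. monom (line_poly (\<lambda>v. coeff (fiber f v) i) u w) i)"

lemma coeff_plane_poly:
  assumes "fiber_bound m f"
  shows "coeff (plane_poly m f u w) i = line_poly (\<lambda>v. coeff (fiber f v) i) u w"
proof (cases "i < m")
  case True
  then show ?thesis by (simp add: plane_poly_def coeff_sum)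
next
  case False
  then have "(\<lambda>v. coeff (fiber f v) i) = (\<lambda>v. 0)"
    using assms unfolding fiber_bound_def by simp
  then have "line_poly (\<lambda>v. coeff (fiber f v) i) u w = 0" by simp
  moreover have "coeff (plane_poly m f u w) i = 0"
    using False by (simp add: plane_poly_def coeff_sum)
  ultimately show ?thesis by simp
qed

lemma lead_coeff_plane_poly:
  assumes "fiber_bound (Suc d) f" "line_poly (\<lambda>v. coeff (fiber f v) d) u w \<noteq> 0"
  shows "lead_coeff (plane_poly (Suc d) f u w) = line_poly (\<lambda>v. coeff (fiber f v) d) u w"
proof -
  have "degree (plane_poly (Suc d) f u w) = d"
  proof (rule antisym)
    show "degree (plane_poly (Suc d) f u w) \<le> d"
      by (rule degree_le) (simp add: plane_poly_def coeff_sum)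
    show "d \<le> degree (plane_poly (Suc d) f u w)"
      by (rule le_degree) (simp add: coeff_plane_poly assms)
  qed
  then show ?thesis by (simp add: coeff_plane_poly[OF assms(1)])
qed

text \<open>
  If \<open>a\<^sup>k F = u f\<close> with \<open>F\<close> monic in the height, then on all lines the leading coefficient \<open>a\<close> of
  \<open>f\<close> divides the other coefficients, by Gauss's lemma; so it does as polynomial function.
\<close>

lemma lead_coeff_dvd:
  assumes F: "F \<in> polyfun" "fiber_bound (Suc D) F" "\<And>v. coeff (fiber F v) D = 1"
    and f: "f \<in> polyfun" "fiber_bound (Suc \<delta>) f" "\<And>v. coeff (fiber f v) \<delta> = a v" "a v0 \<noteq> 0"
    and u: "u \<in> polyfun" "\<And>v. a v ^ k * F v = u v * f v"
  shows "\<exists>q\<in>polyfun. \<forall>v. coeff (fiber f v) i = a v * q v"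
proof (rule polyfun_dvd_of_lines[of a v0])
  have a: "base_fun a"
    using base_fun_coeff_fiber[OF f(1), of \<delta>] f(3) by simp
  show ap: "a \<in> polyfun" using a by (rule base_fun_polyfun)
  show "a v0 \<noteq> 0" by fact
  show "(\<lambda>v. coeff (fiber f v) i) \<in> polyfun" using f(1) by (rule polyfun_coeff_fiber)
  fix w
  define A where "A = line_poly a v0 w"
  obtain m where m: "fiber_bound m u" using fiber_bound_exists[OF u(1)] by blast
  have A0: "A \<noteq> 0"
    using poly_line_poly[OF ap, of v0 w 0] f(4) unfolding A_def by auto
  have aeq: "(\<lambda>v. coeff (fiber f v) \<delta>) = a" using f(3) by (rule ext)
  have one: "(\<lambda>v. coeff (fiber F v) D) = (\<lambda>_. 1)" using F(3) by (rule ext)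
  have "smult (A ^ k) (plane_poly (Suc D) F v0 w) = plane_poly m u v0 w * plane_poly (Suc \<delta>) f v0 w"
  proof (rule poly_eqI)
    fix j
    let ?c = "\<lambda>h j v. coeff (fiber h v) j"
    have "(\<lambda>v. a v ^ k * F v) = (\<lambda>v. u v * f v)" using u(2) by (rule ext)
    then have "fiber (\<lambda>v. a v ^ k * F v) v = fiber (\<lambda>v. u v * f v) v" for v by simp
    then have "[:a v:] ^ k * fiber F v = fiber u v * fiber f v" for v
      by (simp add: fiber_mult polyfun_power ap F(1) u(1) f(1) fiber_power fiber_base[OF a])
    then have "smult (a v ^ k) (fiber F v) = fiber u v * fiber f v" for v
      by (simp add: poly_const_pow)
    then have "a v ^ k * ?c F j v = (\<Sum>i\<le>j. ?c u i v * ?c f (j - i) v)" for v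
      by (metis coeff_mult coeff_smult)
    then have "line_poly (\<lambda>v. a v ^ k * ?c F j v) v0 w
        = line_poly (\<lambda>v. \<Sum>i\<le>j. ?c u i v * ?c f (j - i) v) v0 w" by simp
    also have "\<dots> = (\<Sum>i\<le>j. line_poly (?c u i) v0 w * line_poly (?c f (j - i)) v0 w)"
      using u(1) f(1) by (subst line_poly_sum) (auto simp: line_poly_mult polyfun_coeff_fiber)
    also have "line_poly (\<lambda>v. a v ^ k * ?c F j v) v0 w = A ^ k * line_poly (?c F j) v0 w"
      unfolding A_def using ap F(1)
      by (simp add: line_poly_mult line_poly_power polyfun_power polyfun_coeff_fiber)
    finally show "coeff (smult (A ^ k) (plane_poly (Suc D) F v0 w)) j
        = coeff (plane_poly m u v0 w * plane_poly (Suc \<delta>) f v0 w) j"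
      by (simp add: coeff_mult coeff_plane_poly F(2) f(2) m)
  qed
  then have "A dvd coeff (plane_poly (Suc \<delta>) f v0 w) i"
  proof (rule lead_coeff_dvd_of_monic_multiple)
    show "lead_coeff (plane_poly (Suc D) F v0 w) = 1"
      using lead_coeff_plane_poly[OF F(2), of v0 w] by (simp add: one pCons_one)
    show "lead_coeff (plane_poly (Suc \<delta>) f v0 w) = A"
      using lead_coeff_plane_poly[OF f(2), of v0 w] A0 by (simp add: aeq A_def)
    show "A \<noteq> 0" by (rule A0)
  qed
  then show "line_poly a v0 w dvd line_poly (\<lambda>v. coeff (fiber f v) i) v0 w"
    by (simp add: A_def coeff_plane_poly[OF f(2)])
qed

text \<open>
  A function of least degree along \<open>e\<close> in the ideal, divided by its leading coefficient, is monic in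
  the height and divides the whole ideal.
\<close>

lemma monic_generator:
  assumes C: "prime_on C" and F: "F \<in> polyfun" "homog D F" "F e \<noteq> 0" "\<And>v. v \<in> C \<Longrightarrow> F v = 0"
    and base: "\<And>b v. base_fun b \<Longrightarrow> (\<And>u. u \<in> C \<Longrightarrow> b u = 0) \<Longrightarrow> b v = 0"
  shows "\<exists>f \<delta>. f \<in> polyfun \<and> (\<forall>v\<in>C. f v = 0) \<and> fiber_bound (Suc \<delta>) f \<and>
    (\<forall>v. coeff (fiber f v) \<delta> = 1) \<and>
    (\<forall>g\<in>polyfun. (\<forall>v\<in>C. g v = 0) \<longrightarrow> (\<exists>u\<in>polyfun. \<forall>v. g v = u v * f v))"
proof -
  define P where "P m \<longleftrightarrow> (\<exists>f\<in>polyfun. (\<forall>v\<in>C. f v = 0) \<and> (\<exists>v. f v \<noteq> 0) \<and> fiber_bound m f)" for m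
  have ex: "P m" if "fiber_bound m F" for m
    unfolding P_def using F that by blast
  define m where "m = (LEAST m. P m)"
  obtain m0 where "P m0" using ex fiber_bound_exists[OF F(1)] by blast
  then have "P m" unfolding m_def by (rule LeastI)
  then obtain f where f: "f \<in> polyfun" "\<And>v. v \<in> C \<Longrightarrow> f v = 0" "\<exists>v. f v \<noteq> 0" "fiber_bound m f"
    unfolding P_def by blast
  then have "m \<noteq> 0" using fiber_bound_0 by metis
  then obtain \<delta> where \<delta>: "m = Suc \<delta>" using not0_implies_Suc by blast
  have "\<not> P \<delta>" using not_less_Least[of \<delta> P] \<delta> unfolding m_def by simp
  then have minimal: "h v = 0" if "h \<in> polyfun" "\<And>u. u \<in> C \<Longrightarrow> h u = 0" "fiber_bound \<delta> h" for h v
    using that unfolding P_def by blast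
  define a where "a v = coeff (fiber f v) \<delta>" for v
  have a: "base_fun a" unfolding a_def by (rule base_fun_coeff_fiber[OF f(1)])
  have ap: "a \<in> polyfun" using a by (rule base_fun_polyfun)
  obtain v0 where v0: "a v0 \<noteq> 0"
  proof (rule ccontr)
    assume "\<not> thesis"
    then have "a v = 0" for v using that by blast
    then have "fiber_bound \<delta> f" using f(4) \<delta> by (auto simp: a_def intro: fiber_bound_Suc[of \<delta> f])
    then show False using minimal[of f] f by blast
  qed
  have aC: "\<exists>v\<in>C. a v \<noteq> 0" using base[OF a] v0 by blast
  have fb: "fiber_bound (Suc \<delta>) f" using f(4) \<delta> by simp
  define F1 where "F1 v = F v / F e" for v
  have F1: "F1 \<in> polyfun" "homog D F1" "F1 e = 1" "\<And>v. v \<in> C \<Longrightarrow> F1 v = 0"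
    unfolding F1_def[abs_def] using F by (auto simp: homog_def)
  have F1deg: "degree (fiber F1 v) \<le> D" "coeff (fiber F1 v) D = 1" for v
    unfolding fiber_def using homog_line_poly[OF F1(1,2)] F1(3) by auto
  have "coeff (fiber F1 v) j = 0" if "Suc D \<le> j" for v j
    using F1deg(1)[of v] that by (simp add: coeff_eq_0)
  then have F1b: "fiber_bound (Suc D) F1"
    unfolding fiber_bound_def by blast
  \<comment> \<open>the relation with a monic element to which Gauss's lemma applies\<close>
  have "\<exists>k. \<exists>u\<in>polyfun. \<forall>v. a v ^ k * F1 v = u v * f v"
    by (rule pseudo_division[where C = C and \<delta> = \<delta>])
      (fact f(1) f(2) fb a_def[symmetric] minimal F1(1) F1(4))+
  then obtain k u where u: "u \<in> polyfun" "\<And>v. a v ^ k * F1 v = u v * f v"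
    by blast
  have "\<exists>q\<in>polyfun. \<forall>v. coeff (fiber f v) i = a v * q v" for i
    by (rule lead_coeff_dvd[where F = F1 and u = u and k = k])
      (fact F1(1) F1b F1deg(2) f(1) fb a_def[symmetric] v0 u)+
  then obtain q where q: "\<And>i. q i \<in> polyfun" "\<And>i v. coeff (fiber f v) i = a v * q i v"
    by metis
  define h where "h v = (\<Sum>i\<le>\<delta>. q i v * height v ^ i)" for v
  have hp: "h \<in> polyfun"
    unfolding h_def[abs_def] using q(1) by (intro polyfun_sum polyfun.mult polyfun_power) auto
  have ah: "a v * h v = f v" for v
  proof -
    have "degree (fiber f v) \<le> \<delta>"
      using fb unfolding fiber_bound_def by (intro degree_le) auto
    then have "f v = (\<Sum>i\<le>\<delta>. coeff (fiber f v) i * height v ^ i)"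
      using poly_eq_sum_atMost[of "fiber f v" \<delta> "height v"] poly_fiber_height[OF f(1)] by simp
    then show ?thesis by (simp add: h_def q(2) sum_distrib_left mult.assoc)
  qed
  have "(\<forall>v\<in>C. a v = 0) \<or> (\<forall>v\<in>C. h v = 0)"
    using f(2) ah by (intro prime_onD[OF C ap hp]) simp
  then have hC: "h v = 0" if "v \<in> C" for v using aC that by blast
  have fh: "smult (a v) (fiber h v) = fiber f v" for v
  proof -
    have "fiber (\<lambda>v. a v * h v) v = fiber a v * fiber h v" by (rule fiber_mult[OF ap hp])
    then show ?thesis by (simp add: ah fiber_base[OF a])
  qed
  have hcoeff: "coeff (fiber h v) i = c" if "\<And>v. coeff (fiber f v) i = a v * c" for i c v
  proof (rule polyfun_mult_left_cancel[OF ap _ _ v0])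
    show "(\<lambda>v. coeff (fiber h v) i) \<in> polyfun" by (rule polyfun_coeff_fiber[OF hp])
    show "a v * coeff (fiber h v) i = a v * c" for v
      using arg_cong[OF fh[of v], of "\<lambda>p. coeff p i"] that[of v] by simp
  qed simp
  have hb: "fiber_bound (Suc \<delta>) h"
    unfolding fiber_bound_def using fb unfolding fiber_bound_def by (intro allI impI hcoeff) simp
  have h1: "coeff (fiber h v) \<delta> = 1" for v
    by (rule hcoeff) (simp add: a_def)
  have "\<exists>u\<in>polyfun. \<forall>v. g v = u v * h v" if g: "g \<in> polyfun" "\<forall>v\<in>C. g v = 0" for g
  proof -
    have "\<exists>k. \<exists>u\<in>polyfun. \<forall>v. 1 ^ k * g v = u v * h v"
      by (rule pseudo_division[where C = C and \<delta> = \<delta>])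
        (fact hp hC hb h1 minimal g(1) g(2)[rule_format])+
    then show ?thesis by simp
  qed
  then show ?thesis using hp hC hb h1 by blast
qed

end

text \<open>
  The equation found in this way is homogeneous: for \<open>c \<noteq> 0\<close> the function \<open>f (c v)\<close> is zero on the
  cone, hence a multiple of \<open>f\<close>, and by comparing degrees in the height the factor is a constant.
\<close>

lemma (in coordinate_projection) monic_generator_homog:
  assumes cone: "0 \<in> C" "\<And>c v. v \<in> C \<Longrightarrow> c *s v \<in> C"
    and f: "f \<in> polyfun" "\<And>v. v \<in> C \<Longrightarrow> f v = 0" "fiber_bound (Suc \<delta>) f"
      "\<And>v. coeff (fiber f v) \<delta> = 1"
    and gen: "\<And>g. g \<in> polyfun \<Longrightarrow> (\<And>v. v \<in> C \<Longrightarrow> g v = 0) \<Longrightarrow> \<exists>u\<in>polyfun. \<forall>v. g v = u v * f v"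
  shows "homog \<delta> f"
  unfolding homog_def
proof (intro allI)
  fix c v
  have deg: "degree (fiber f v) = \<delta>" for v
  proof (rule antisym)
    show "degree (fiber f v) \<le> \<delta>"
      using f(3) unfolding fiber_bound_def by (intro degree_le) auto
    show "\<delta> \<le> degree (fiber f v)" by (rule le_degree) (simp add: f(4))
  qed
  show "f (c *s v) = c ^ \<delta> * f v"
  proof (cases "c = 0")
    case True
    have "\<delta> \<noteq> 0"
    proof
      assume "\<delta> = 0"
      then have "fiber f 0 = [:1:]"
        using deg[of 0] f(4)[of 0] by (metis degree_eq_zeroE coeff_pCons_0)
      then have "f 0 = 1" using poly_fiber_height[OF f(1), of 0] by simp
      then show False using f(2) cone(1) by simp
    qed
    then show ?thesis using True f(2) cone(1) by simp
  next
    case False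
    have cp: "(\<lambda>v. f (c *s v)) \<in> polyfun"
      by (rule polyfun_compose[OF f(1)]) (simp add: polyfun_cmult)
    obtain u where u: "u \<in> polyfun" "\<And>v. f (c *s v) = u v * f v"
      using gen[OF cp] f(2) cone(2) by metis
    have "fiber u v * fiber f v = pcompose (fiber f (c *s v)) [:0, c:]"
    proof (rule poly_ext)
      fix t
      have "f (c *s (shadow v + t *s e)) = u (shadow v + t *s e) * f (shadow v + t *s e)"
        by (rule u(2))
      moreover have "c *s (shadow v + t *s e) = shadow (c *s v) + (t * c) *s e"
        by (simp add: shadow_scale vec_eq_iff algebra_simps)
      ultimately show "poly (fiber u v * fiber f v) t = poly (pcompose (fiber f (c *s v)) [:0, c:]) t"
        by (simp add: poly_fiber u(1) f(1) poly_pcompose)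
    qed
    note eq = this
    have "coeff (fiber u v * fiber f v) \<delta> = c ^ \<delta>"
      unfolding eq by (simp add: coeff_pcompose_scale f(4))
    moreover have "degree (fiber u v * fiber f v) \<le> \<delta>"
      unfolding eq using deg[of "c *s v"] by (simp add: degree_pcompose)
    moreover have "fiber u v \<noteq> 0" "fiber f v \<noteq> 0"
      using calculation(1) False f(4)[of v] by auto
    ultimately have "degree (fiber u v) = 0" using deg[of v] by (simp add: degree_mult_eq)
    then obtain b where b: "fiber u v = [:b:]" by (rule degree_eq_zeroE)
    then have "b = c ^ \<delta>" using \<open>coeff _ \<delta> = c ^ \<delta>\<close> f(4)[of v] by simp
    then have "u v = c ^ \<delta>" using b poly_fiber_height[OF u(1), of v] by simp
    then show ?thesis using u(2) by simp
  qed
qed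

text \<open>
  A hypersurface is not the whole space, so there are a point outside of it and a function of the
  ideal that is nonzero there, and the projection from this point applies.
\<close>

lemma hypersurface_ideal_principal:
  fixes S :: "'n::finite ppoint set"
  assumes S: "irreducible_variety S" "hypersurface S"
  shows "\<exists>f d. f \<in> polyfun \<and> homog d f \<and> (\<exists>v. f v \<noteq> 0) \<and> (\<forall>v\<in>\<Union>S. f v = 0) \<and>
    (\<forall>g\<in>polyfun. (\<forall>v\<in>\<Union>S. g v = 0) \<longrightarrow> (\<exists>u\<in>polyfun. \<forall>v. g v = u v * f v))"
proof -
  have closed: "zariski_closed S" "S \<noteq> {}" using S(1) by (auto simp: irreducible_variety_def)
  then have Ss: "S \<subseteq> proj_space" by (intro zariski_closed_subset)
  have prime: "prime_on (\<Union>S)" using S(1) by (rule irreducible_imp_prime_on)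
  obtain p where p: "p \<in> proj_space" "p \<notin> S"
    using hypersurface_ne_proj_space[OF S(2)] Ss by blast
  obtain e where e: "e \<in> p" "e \<noteq> 0" using proj_point_nonzero[OF p(1)] by blast
  have "e \<notin> \<Union>S"
    using p(2) span_in_iff_cone[OF Ss e(2)] proj_point_eq_span[OF p(1) e] by simp
  then obtain F D where F: "F \<in> polyfun" "homog D F" "\<And>u. u \<in> \<Union>S \<Longrightarrow> F u = 0" "F e \<noteq> 0"
    using not_in_closed_imp_homog[OF closed(1) _ e(2)] by blast
  obtain i0 where "e $ i0 \<noteq> 0" using e(2) by (auto simp: vec_eq_iff)
  then interpret coordinate_projection e i0 by unfold_locales
  obtain hs where hs: "Suc (length hs) = CARD('n)" "set hs \<subseteq> polyfun" "alg_indep_on (\<Union>S) hs"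
    using hypersurface_alg_indep[OF S] by (elim exE conjE)
  have cone: "c *s v \<in> \<Union>S" if "v \<in> \<Union>S" for c v
    using cone_scale[OF Ss that] .
  have zero: "0 \<in> \<Union>S" using zero_in_cone[OF Ss closed(2)] .
  have base: "b v = 0" if "base_fun b" "\<And>u. u \<in> \<Union>S \<Longrightarrow> b u = 0" for b v
    by (rule base_fun_zero[where C = "\<Union>S" and F = F and D = D and hs = hs])
      (fact zero cone F(1) F(2) F(4) F(3) hs(1) hs(2) hs(3) that)+
  have "\<exists>f \<delta>. f \<in> polyfun \<and> (\<forall>v\<in>\<Union>S. f v = 0) \<and> fiber_bound (Suc \<delta>) f \<and>
      (\<forall>v. coeff (fiber f v) \<delta> = 1) \<and>
      (\<forall>g\<in>polyfun. (\<forall>v\<in>\<Union>S. g v = 0) \<longrightarrow> (\<exists>u\<in>polyfun. \<forall>v. g v = u v * f v))"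
    by (rule monic_generator[where F = F and D = D])
      (fact prime F(1) F(2) F(4) F(3) base)+
  then obtain f \<delta> where f: "f \<in> polyfun" "\<forall>v\<in>\<Union>S. f v = 0" "fiber_bound (Suc \<delta>) f"
    "\<And>v. coeff (fiber f v) \<delta> = 1"
    "\<forall>g\<in>polyfun. (\<forall>v\<in>\<Union>S. g v = 0) \<longrightarrow> (\<exists>u\<in>polyfun. \<forall>v. g v = u v * f v)"
    by blast
  have "homog \<delta> f"
    by (rule monic_generator_homog[where C = "\<Union>S"]) (use zero cone f in blast)+
  moreover have "\<exists>v. f v \<noteq> 0"
  proof (rule ccontr)
    assume "\<not> (\<exists>v. f v \<noteq> 0)"
    then have "fiber f 0 = 0" by (intro poly_ext) (simp add: poly_fiber f(1))
    then show False using f(4)[of 0] by simp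
  qed
  ultimately show ?thesis using f by blast
qed

section \<open>Equation, degree and multiplicity\<close>

interpretation ring_module: module "(*) :: 'a::comm_ring_1 \<Rightarrow> 'a \<Rightarrow> 'a"
  by unfold_locales (simp_all add: algebra_simps)

lemma ideal_span_singleton: "ideal_span {f} = range (\<lambda>u. u * f)"
  unfolding ideal_span_def by (rule ring_module.span_singleton)

text \<open>On each line through the origin, both factors are units among the polynomials in one variable.\<close>

lemma polyfun_unit_const:
  assumes "u \<in> polyfun" "w \<in> polyfun" "\<And>v. u v * w v = 1"
  shows "u v = u 0"
proof -
  have "line_poly u 0 v * line_poly w 0 v = 1"
    by (rule poly_ext) (simp add: poly_line_poly assms)
  then have "line_poly u 0 v dvd 1" by (metis dvd_triv_left)
  then obtain c where "line_poly u 0 v = [:c:]" by (metis is_unit_polyE)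
  then show ?thesis
    using poly_line_poly[OF assms(1), of 0 v 0] poly_line_poly[OF assms(1), of 0 v 1] by simp
qed

text \<open>
  The chosen equation and the generator found above divide each other, so they agree up to a constant
  factor.
\<close>

lemma hypersurface_equation:
  fixes S :: "'n::finite ppoint set"
  assumes S: "irreducible_variety S" "hypersurface S"
  defines "f \<equiv> poly_eval (hypersurface_equation S)"
  shows "\<exists>d. homog d f \<and> hypersurface_degree S \<le> d"
    and "\<exists>v. f v \<noteq> 0"
    and "v \<in> \<Union>S \<Longrightarrow> f v = 0"
    and "g \<in> polyfun \<Longrightarrow> (\<And>v. v \<in> \<Union>S \<Longrightarrow> g v = 0) \<Longrightarrow> \<exists>u\<in>polyfun. \<forall>v. g v = u v * f v"
proof -
  let ?E = "hypersurface_equation S"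
  obtain h d where h: "h \<in> polyfun" "homog d h" "\<exists>v. h v \<noteq> 0" "\<forall>v\<in>\<Union>S. h v = 0"
    "\<forall>g\<in>polyfun. (\<forall>v\<in>\<Union>S. g v = 0) \<longrightarrow> (\<exists>u\<in>polyfun. \<forall>v. g v = u v * h v)"
    using hypersurface_ideal_principal[OF S] by blast
  have vanishing: "F \<in> vanishing_ideal S \<longleftrightarrow> (\<forall>v\<in>\<Union>S. poly_eval F v = 0)" for F
    unfolding vanishing_ideal_def by blast
  have "vanishing_ideal S = ideal_span {poly_of h}"
  proof (intro equalityI subsetI)
    fix G assume "G \<in> vanishing_ideal S"
    then obtain u where "u \<in> polyfun" "\<And>v. poly_eval G v = u v * h v"
      using h(5) vanishing by (meson polyfun_poly_eval)
    then have "poly_eval G = poly_eval (poly_of u * poly_of h)"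
      using h(1) by (simp add: fun_eq_iff)
    then show "G \<in> ideal_span {poly_of h}"
      unfolding ideal_span_singleton poly_eval_inject by blast
  next
    fix G assume "G \<in> ideal_span {poly_of h}"
    then obtain U where "G = U * poly_of h" unfolding ideal_span_singleton by blast
    then show "G \<in> vanishing_ideal S" using h(1,4) by (simp add: vanishing)
  qed
  then have E: "vanishing_ideal S = ideal_span {?E}"
    unfolding hypersurface_equation_def by (rule someI)
  have f: "f \<in> polyfun" unfolding f_def by simp
  have multiple: "\<exists>u\<in>polyfun. \<forall>v. g v = u v * f v" if "g \<in> polyfun" "\<forall>v\<in>\<Union>S. g v = 0" for g
  proof -
    have "poly_of g \<in> vanishing_ideal S" using that by (simp add: vanishing)
    then obtain U where "poly_of g = U * ?E" unfolding E ideal_span_singleton by blast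
    from arg_cong[OF this, of poly_eval] have "g v = poly_eval U v * f v" for v
      using that(1) by (simp add: f_def fun_eq_iff)
    then show ?thesis using polyfun_poly_eval by blast
  qed
  then show "g \<in> polyfun \<Longrightarrow> (\<And>v. v \<in> \<Union>S \<Longrightarrow> g v = 0) \<Longrightarrow> \<exists>u\<in>polyfun. \<forall>v. g v = u v * f v"
    by blast
  have "?E \<in> vanishing_ideal S"
    unfolding E ideal_span_singleton by (metis mult_1 rangeI)
  then have fS: "\<forall>v\<in>\<Union>S. f v = 0" unfolding vanishing f_def .
  then show "v \<in> \<Union>S \<Longrightarrow> f v = 0" by blast
  obtain u where u: "u \<in> polyfun" "\<And>v. f v = u v * h v" using h(5) f fS by blast
  obtain w where w: "w \<in> polyfun" "\<And>v. h v = w v * f v" using multiple[OF h(1,4)] by blast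
  have uw: "u v * w v = 1" for v
  proof -
    obtain v0 where v0: "h v0 \<noteq> 0" using h(3) by blast
    show ?thesis
    proof (rule polyfun_mult_left_cancel[OF h(1) polyfun.mult[OF u(1) w(1)] _ v0])
      show "h v * (u v * w v) = h v * 1" for v
        using u(2)[of v] w(2)[of v] by (metis mult.assoc mult.commute mult_1)
    qed simp
  qed
  have fh: "f v = u 0 * h v" for v
    using u(2)[of v] polyfun_unit_const[OF u(1) w(1) uw] by simp
  show "\<exists>v. f v \<noteq> 0" using h(3) uw[of 0] fh by (metis mult_eq_0_iff zero_neq_one)
  have hom: "homog d f" using homog_cmult[OF h(2), of "u 0"] fh by (simp add: homog_def)
  have "monom_degree m \<le> d" if "m \<in> Poly_Mapping.keys ?E" for m
    using homog_keys[of d ?E m] hom that unfolding f_def by simp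
  then have "hypersurface_degree S \<le> d"
    unfolding hypersurface_degree_def poly_degree_def by (intro Max.boundedI) auto
  then show "\<exists>d. homog d f \<and> hypersurface_degree S \<le> d" using hom by blast
qed

definition ideal_products :: "'a::comm_ring_1 set \<Rightarrow> nat \<Rightarrow> 'a set" where
  "ideal_products I k = {(\<Prod>i<k. g i) |g. \<forall>i<k. g i \<in> I}"

lemma ideal_power_altdef: "ideal_power I k = ideal_span (ideal_products I k)"
  by (simp add: ideal_power_def ideal_products_def)

lemma ideal_products_0: "1 \<in> ideal_products I 0"
  by (auto simp: ideal_products_def)

lemma ideal_products_Suc:
  assumes "p \<in> ideal_products I k" "x \<in> I"
  shows "p * x \<in> ideal_products I (Suc k)"
proof -
  obtain g where g: "p = (\<Prod>i<k. g i)" "\<forall>i<k. g i \<in> I"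
    using assms(1) unfolding ideal_products_def by blast
  have "p * x = (\<Prod>i<Suc k. (g(k := x)) i)" using g(1) by simp
  moreover have "\<forall>i<Suc k. (g(k := x)) i \<in> I" using g(2) assms(2) by simp
  ultimately show ?thesis unfolding ideal_products_def by blast
qed

lemma ideal_products_power:
  assumes "p \<in> ideal_products I k" "x \<in> I"
  shows "p * x ^ n \<in> ideal_products I (k + n)"
proof (induction n)
  case 0
  show ?case using assms(1) by simp
next
  case (Suc n)
  have "(p * x ^ n) * x \<in> ideal_products I (Suc (k + n))"
    by (rule ideal_products_Suc[OF Suc assms(2)])
  then show ?case unfolding power_Suc2 add_Suc_right mult.assoc .
qed

lemma ideal_products_prod:
  assumes "finite A" "\<And>i. i \<in> A \<Longrightarrow> x i \<in> I"
  shows "(\<Prod>i\<in>A. x i ^ n i) \<in> ideal_products I (\<Sum>i\<in>A. n i)"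
  using assms
proof (induction A rule: finite_induct)
  case empty
  show ?case by (simp add: ideal_products_0)
next
  case (insert i A)
  then have "(\<Prod>i\<in>A. x i ^ n i) * x i ^ n i \<in> ideal_products I ((\<Sum>i\<in>A. n i) + n i)"
    by (intro ideal_products_power) auto
  then show ?case using insert.hyps by (simp add: mult.commute add.commute)
qed

lemma ideal_products_in_power:
  assumes "p \<in> ideal_products I n" "k \<le> n"
  shows "p \<in> ideal_power I k"
  using assms(2,1)
proof (induction n arbitrary: p rule: dec_induct)
  case base
  then show ?case unfolding ideal_power_altdef ideal_span_def by (rule ring_module.span_base)
next
  case (step n)
  obtain g where g: "p = (\<Prod>i<Suc n. g i)" "\<forall>i<Suc n. g i \<in> I"
    using step.prems unfolding ideal_products_def by blast
  then have "(\<Prod>i<n. g i) \<in> ideal_products I n" unfolding ideal_products_def by auto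
  then have "(\<Prod>i<n. g i) \<in> ideal_power I k" by (rule step.IH)
  then have "g n * (\<Prod>i<n. g i) \<in> ideal_power I k"
    unfolding ideal_power_def ideal_span_def by (rule ring_module.span_scale)
  then show ?case by (simp add: g(1) mult.commute)
qed

text \<open>
  An element of the \<open>k\<close>-th power of the ideal of a point \<open>z\<close> has a zero of order at least \<open>k\<close> at
  the parameter of \<open>z\<close> on all lines through \<open>z\<close>; so a nonzero polynomial lies in only finitely many
  of these powers.
\<close>

lemma ideal_power_vanishing_order:
  assumes "G \<in> ideal_power (vanishing_ideal {z}) k" "z0 \<in> z"
  shows "monom 1 k dvd line_poly (poly_eval G) z0 w"
  using assms(1) unfolding ideal_power_altdef ideal_span_def
proof (induction rule: ring_module.span_induct_alt)
  case base
  have "line_poly (poly_eval 0) z0 w = 0" by (rule line_poly_eqI) simp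
  then show ?case by simp
next
  case (step c p q)
  obtain g where g: "p = (\<Prod>i<k. g i)" "\<forall>i<k. g i \<in> vanishing_ideal {z}"
    using step(1) unfolding ideal_products_def by blast
  have lin: "[:0, 1:] dvd line_poly (poly_eval (g i)) z0 w" if "i < k" for i
  proof -
    have "poly_eval (g i) z0 = 0" using g(2) that assms(2) unfolding vanishing_ideal_def by blast
    then have "poly (line_poly (poly_eval (g i)) z0 w) 0 = 0" by (simp add: poly_line_poly)
    then show ?thesis by (simp add: poly_eq_0_iff_dvd)
  qed
  have "line_poly (poly_eval p) z0 w = (\<Prod>i<k. line_poly (poly_eval (g i)) z0 w)"
    by (rule line_poly_eqI) (simp add: g(1) poly_prod poly_line_poly)
  moreover have "(\<Prod>i<k. [:0, 1 :: complex:]) dvd (\<Prod>i<k. line_poly (poly_eval (g i)) z0 w)"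
    using lin by (intro prod_dvd_prod) auto
  ultimately have "monom 1 k dvd line_poly (poly_eval p) z0 w"
    by (simp add: monom_altdef)
  moreover have "line_poly (poly_eval (c * p + q)) z0 w
      = line_poly (poly_eval c) z0 w * line_poly (poly_eval p) z0 w + line_poly (poly_eval q) z0 w"
    by (rule line_poly_eqI) (simp add: poly_line_poly)
  ultimately show ?case using step(2) by (simp only: dvd_add dvd_mult)
qed

lemma hypersurface_mult_ge:
  assumes z0: "z0 \<in> z" and nz: "\<exists>v. poly_eval (hypersurface_equation S) v \<noteq> 0"
    and mem: "hypersurface_equation S \<in> ideal_power (vanishing_ideal {z}) k"
  shows "k \<le> hypersurface_mult S z"
proof -
  let ?f = "poly_eval (hypersurface_equation S)"
  obtain D where D: "\<And>u w. degree (line_poly ?f u w) \<le> D"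
    using line_poly_degree_bound[of ?f] by blast
  obtain v where v: "?f v \<noteq> 0" using nz by blast
  have "l \<le> D" if "hypersurface_equation S \<in> ideal_power (vanishing_ideal {z}) l" for l
  proof -
    have "?f (z0 + 1 *s (v - z0)) \<noteq> 0" using v by simp
    then have nz: "line_poly ?f z0 (v - z0) \<noteq> 0"
      using poly_line_poly[of ?f z0 "v - z0" 1] by auto
    have "degree (monom (1::complex) l) \<le> degree (line_poly ?f z0 (v - z0))"
      by (rule dvd_imp_degree_le[OF ideal_power_vanishing_order[OF that z0] nz])
    then show ?thesis using D[of z0 "v - z0"] by (simp add: degree_monom_eq)
  qed
  then show ?thesis
    unfolding hypersurface_mult_def by (intro Greatest_le_nat[of _ k D]) (use mem in auto)
qed

lemma (in coordinate_projection) shadow_direction: "shadow (c *s e) = 0"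
  using nonzero by (simp add: shadow_def height_def)

text \<open>
  Expand the polynomial by powers of the height: the coefficient of the \<open>j\<close>-th power is homogeneous
  of degree \<open>d - j\<close> in the shadow, whose coordinates are linear forms that are zero at \<open>e\<close>.
\<close>

lemma (in coordinate_projection) homog_in_ideal_power:
  assumes hom: "homog d (poly_eval E)" and bound: "fiber_bound (Suc k) (poly_eval E)"
  shows "E \<in> ideal_power (vanishing_ideal {vec.span {e}}) (d - k)"
proof -
  let ?f = "poly_eval E"
  let ?I = "vanishing_ideal {vec.span {e}}"
  define L where "L i = poly_of (\<lambda>v. shadow v $ i)" for i
  have evL: "poly_eval (L i) = (\<lambda>v. shadow v $ i)" for i
    unfolding L_def by (rule poly_eval_poly_of[OF polyfun_shadow])
  have L: "L i \<in> ?I" for i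
    unfolding vanishing_ideal_def by (auto simp: evL vec.span_singleton shadow_direction)
  define A where "A j = poly_of (\<lambda>v. coeff (fiber ?f v) j)" for j
  have evA: "poly_eval (A j) = (\<lambda>v. coeff (fiber ?f v) j)" for j
    unfolding A_def by (rule poly_eval_poly_of[OF polyfun_coeff_fiber[OF polyfun_poly_eval]])
  define T where "T j = (\<Sum>m\<in>Poly_Mapping.keys (A j).
    Poly_Mapping.single 0 (Poly_Mapping.lookup (A j) m) * (\<Prod>i\<in>UNIV. L i ^ Poly_Mapping.lookup m i))" for j
  have evT: "poly_eval (T j) v = coeff (fiber ?f v) j" for j v
  proof -
    have "poly_eval (T j) v = poly_eval (A j) (shadow v)"
      by (simp add: T_def evL poly_eval_altdef[of "A j"] monomial_fun_def)
    then show ?thesis by (simp add: evA)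
  qed
  have T: "T j \<in> ideal_power ?I (d - k)" if "j \<le> k" "j \<le> d" for j
  proof -
    have "homog (d - j) (\<lambda>v. coeff (line_poly ?f v e) j)"
      by (rule homog_line_poly(3)[OF polyfun_poly_eval hom that(2)])
    then have "homog (d - j) (poly_eval (A j))"
      unfolding evA fiber_def by (simp add: homog_def shadow_scale)
    then have deg: "(\<Sum>i\<in>UNIV. Poly_Mapping.lookup m i) = d - j" if "m \<in> Poly_Mapping.keys (A j)" for m
      using homog_keys that unfolding monom_degree_def by blast
    have "(\<Prod>i\<in>UNIV. L i ^ Poly_Mapping.lookup m i) \<in> ideal_power ?I (d - k)"
      if "m \<in> Poly_Mapping.keys (A j)" for m
    proof (rule ideal_products_in_power)
      show "(\<Prod>i\<in>UNIV. L i ^ Poly_Mapping.lookup m i) \<in> ideal_products ?I (d - j)"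
        using ideal_products_prod[of UNIV L ?I "Poly_Mapping.lookup m"] L deg[OF that] by simp
      show "d - k \<le> d - j" using \<open>j \<le> k\<close> by simp
    qed
    then show ?thesis
      unfolding T_def ideal_power_def ideal_span_def
      by (intro ring_module.span_sum ring_module.span_scale)
  qed
  have "E = (\<Sum>j\<le>min k d. poly_of height ^ j * T j)"
    unfolding poly_eval_inject[symmetric]
  proof (rule ext)
    fix v
    have "degree (fiber ?f v) \<le> min k d"
      using bound homog_line_poly(1)[OF polyfun_poly_eval hom, of "shadow v" e]
      unfolding fiber_bound_def fiber_def by (auto intro: degree_le)
    then have "?f v = (\<Sum>j\<le>min k d. coeff (fiber ?f v) j * height v ^ j)"
      using poly_eq_sum_atMost poly_fiber_height[OF polyfun_poly_eval, of E v] by metis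
    then show "?f v = poly_eval (\<Sum>j\<le>min k d. poly_of height ^ j * T j) v"
      by (simp add: evT mult.commute)
  qed
  also have "\<dots> \<in> ideal_power ?I (d - k)"
    using T unfolding ideal_power_def ideal_span_def
    by (intro ring_module.span_sum ring_module.span_scale) auto
  finally show ?thesis .
qed

section \<open>Polynomials with a single root\<close>

text \<open>
  For \<open>p = c t\<^sup>k + b t\<^sup>k\<^sup>-\<^sup>1 + \<dots>\<close> the only candidate for a \<open>k\<close>-fold root is \<open>- b / (k c)\<close>, and it is one
  only if \<open>k p = (t + b / (k c)) p'\<close>. Cleared of denominators, the difference of the two sides has
  coefficients that are polynomials in those of \<open>p\<close>.
\<close>

definition root_defect :: "nat \<Rightarrow> complex poly \<Rightarrow> complex poly" where
  "root_defect k p = smult (of_nat k ^ 2 * coeff p k) p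
     - [:coeff p (k - 1), of_nat k * coeff p k:] * pderiv p"

lemma coeff_linear_mult_pderiv:
  "coeff ([:b, m:] * pderiv p) i
     = b * (of_nat (Suc i) * coeff p (Suc i)) + m * (of_nat i * coeff p i)"
  for p :: "complex poly"
  by (cases i) (simp_all add: coeff_pderiv)

lemma coeff_root_defect:
  "coeff (root_defect k p) i = of_nat k ^ 2 * coeff p k * coeff p i
     - (coeff p (k - 1) * (of_nat (Suc i) * coeff p (Suc i))
        + of_nat k * coeff p k * (of_nat i * coeff p i))"
  by (simp only: root_defect_def coeff_diff coeff_smult coeff_linear_mult_pderiv)

lemma coeff_root_defect_high:
  assumes "degree p \<le> k" "k \<le> i"
  shows "coeff (root_defect k p) i = 0"
proof (cases "i = k")
  case True
  then show ?thesis using assms(1)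
    by (simp add: coeff_root_defect coeff_eq_0 power2_eq_square)
next
  case False
  then show ?thesis using assms by (simp add: coeff_root_defect coeff_eq_0)
qed

lemma two_roots:
  assumes k: "degree p = k" "0 < k" and "root_defect k p \<noteq> 0"
  shows "\<exists>s t. s \<noteq> t \<and> poly p s = 0 \<and> poly p t = 0"
proof (rule ccontr)
  assume none: "\<not> ?thesis"
  define c where "c = coeff p k"
  have "\<not> constant (poly p)" using k by (simp add: constant_degree)
  then obtain r where r: "poly p r = 0" using fundamental_theorem_of_algebra by blast
  then have roots: "{z. poly p z = 0} = {r}" using none by blast
  have "smult (lead_coeff p) (\<Prod>z | poly p z = 0. [:- z, 1:] ^ order z p) = p"
    by (rule complex_poly_decompose)
  then have p: "p = smult c ([:- r, 1:] ^ order r p)"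
    using k(1) unfolding roots by (simp add: c_def)
  have "c \<noteq> 0" using k unfolding c_def by (metis degree_0 leading_coeff_0_iff less_irrefl)
  then have "order r p = k"
    using arg_cong[OF p, of degree] k(1) by (simp add: degree_linear_power)
  then have p: "p = smult c ([:- r, 1:] ^ k)" using p by simp
  have "pderiv p = smult c (smult (of_nat k) ([:- r, 1:] ^ (k - 1)))"
    by (subst p) (simp add: pderiv_smult pderiv_power pderiv_pCons)
  then have "[:- r, 1:] * pderiv p = smult c (smult (of_nat k) ([:- r, 1:] * [:- r, 1:] ^ (k - 1)))"
    by (simp only: mult_smult_right)
  also have "[:- r, 1:] * [:- r, 1:] ^ (k - 1) = [:- r, 1:] ^ k"
    using k(2) by (metis power_eq_if not_gr_zero)
  also have "smult c (smult (of_nat k) ([:- r, 1:] ^ k)) = smult (of_nat k) (smult c ([:- r, 1:] ^ k))"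
    by (simp add: mult.commute)
  also have "\<dots> = smult (of_nat k) p" by (simp only: p[symmetric])
  finally have deriv: "[:- r, 1:] * pderiv p = smult (of_nat k) p" .
  have "coeff ([:- r, 1:] * pderiv p) (k - 1) = of_nat k * coeff p (k - 1)"
    by (simp only: deriv coeff_smult)
  moreover have "Suc (k - 1) = k" using k(2) by simp
  moreover have "of_nat (k - 1) = (of_nat k - 1 :: complex)" using k(2) by (simp add: of_nat_diff)
  ultimately have "- r * (of_nat k * c) + (of_nat k - 1) * coeff p (k - 1) = of_nat k * coeff p (k - 1)"
    by (simp only: coeff_linear_mult_pderiv c_def mult_1)
  then have b: "coeff p (k - 1) = - r * (of_nat k * c)" by algebra
  have "[:coeff p (k - 1), of_nat k * c:] = smult (of_nat k * c) [:- r, 1:]"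
    unfolding b by (simp only: smult_pCons smult_0_right mult_1_right mult.commute[of "- r"])
  then have "[:coeff p (k - 1), of_nat k * c:] * pderiv p = smult (of_nat k * c) ([:- r, 1:] * pderiv p)"
    by (simp only: mult_smult_left)
  then have lin: "[:coeff p (k - 1), of_nat k * c:] * pderiv p = smult (of_nat k * c * of_nat k) p"
    by (simp only: deriv smult_smult)
  have "of_nat k ^ 2 * c = of_nat k * c * of_nat k" by (simp add: power2_eq_square)
  then have "root_defect k p = 0"
    by (simp only: root_defect_def c_def[symmetric] lin diff_self)
  then show False using assms(3) by simp
qed

text \<open>
  If all polynomials of degree \<open>k\<close> along the lines through \<open>e\<close> had a single root, then \<open>k\<^sup>2 c f\<close> would be the
  product of \<open>k c t + b\<close> and the derivative of \<open>f\<close> in the direction \<open>e\<close>. By primality one of these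
  two factors, whose degrees in the height are smaller than that of \<open>f\<close>, would be a multiple of \<open>f\<close>.
\<close>

lemma (in coordinate_projection) root_defect_nonzero:
  assumes C: "prime_on C" and f: "f \<in> polyfun" "\<And>v. v \<in> C \<Longrightarrow> f v = 0"
    and gen: "\<And>g. g \<in> polyfun \<Longrightarrow> (\<And>v. v \<in> C \<Longrightarrow> g v = 0) \<Longrightarrow> \<exists>u\<in>polyfun. \<forall>v. g v = u v * f v"
    and k: "fiber_bound (Suc k) f" "coeff (fiber f v0) k \<noteq> 0" "2 \<le> k"
  shows "\<exists>v. root_defect k (fiber f v) \<noteq> 0 \<and> coeff (fiber f v) k \<noteq> 0"
proof (rule ccontr)
  assume none: "\<not> ?thesis"
  define a where "a i v = coeff (fiber f v) i" for i v
  have ap: "a i \<in> polyfun" for i unfolding a_def by (rule polyfun_coeff_fiber[OF f(1)])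
  have deg: "degree (fiber f v) \<le> k" for v
    using k(1) unfolding fiber_bound_def by (intro degree_le) auto
  have zero: "root_defect k (fiber f v) = 0" for v
  proof (rule poly_eqI)
    fix i
    have p: "(\<lambda>v. coeff (root_defect k (fiber f v)) i) \<in> polyfun"
      unfolding coeff_root_defect a_def[symmetric]
      by (intro polyfun_diff polyfun.add polyfun.mult polyfun.const ap)
    have "a k v * coeff (root_defect k (fiber f v)) i = 0" for v
    proof -
      have "root_defect k (fiber f v) = 0 \<or> a k v = 0" using none by (auto simp: a_def)
      then show ?thesis by (metis coeff_0 mult_zero_left mult_zero_right)
    qed
    then have "(\<forall>v. a k v = 0) \<or> (\<forall>v. coeff (root_defect k (fiber f v)) i = 0)"
      by (rule polyfun_mult_eq_0[OF ap p])
    then show "coeff (root_defect k (fiber f v)) i = coeff 0 i"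
      using k(2) by (auto simp: a_def)
  qed
  define g where "g v = a (k - 1) v + of_nat k * a k v * height v" for v
  define D where "D v = (\<Sum>i\<le>k. of_nat (Suc i) * a (Suc i) v * height v ^ i)" for v
  have gp: "g \<in> polyfun"
    unfolding g_def[abs_def] by (intro polyfun.add polyfun.mult polyfun.const ap polyfun_height)
  have Dp: "D \<in> polyfun"
    unfolding D_def[abs_def]
    by (intro polyfun_sum polyfun.mult polyfun.const polyfun_power ap polyfun_height)
  have fg: "fiber g v = [:a (k - 1) v, of_nat k * a k v:]" for v
    unfolding fiber_def by (rule line_poly_eqI) (simp add: g_def a_def mult.commute)
  have fD: "fiber D v = pderiv (fiber f v)" for v
    unfolding fiber_def[of D]
  proof (rule line_poly_eqI)
    fix t
    have "degree (pderiv (fiber f v)) \<le> k" using deg[of v] by (simp add: degree_pderiv)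
    then show "poly (pderiv (fiber f v)) t = D (shadow v + t *s e)"
      by (simp add: poly_eq_sum_atMost D_def a_def coeff_pderiv)
  qed
  have rel: "of_nat k ^ 2 * a k v * f v = g v * D v" for v
  proof -
    have "smult (of_nat k ^ 2 * a k v) (fiber f v) = fiber g v * fiber D v"
      using zero[of v] unfolding root_defect_def fg fD a_def by simp
    from arg_cong[OF this, of "\<lambda>p. poly p (height v)"] show ?thesis
      by (simp add: poly_fiber_height f(1) gp Dp)
  qed
  have "(\<forall>v\<in>C. g v = 0) \<or> (\<forall>v\<in>C. D v = 0)"
    by (rule prime_onD[OF C gp Dp]) (simp add: rel[symmetric] f(2))
  moreover have False if h: "h \<in> polyfun" "\<forall>v\<in>C. h v = 0" "fiber h v0 \<noteq> 0" "degree (fiber h v0) < k" for h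
  proof -
    obtain u where u: "u \<in> polyfun" "\<And>v. h v = u v * f v" using gen[OF h(1)] h(2) by blast
    have "h = (\<lambda>v. u v * f v)" using u(2) by (rule ext)
    then have "fiber h v0 = fiber u v0 * fiber f v0"
      using fiber_mult[OF u(1) f(1), of v0] by (simp only:)
    then have "degree (fiber f v0) \<le> degree (fiber h v0)"
      using h(3) by (intro dvd_imp_degree_le) auto
    moreover have "k \<le> degree (fiber f v0)" using k(2) by (rule le_degree)
    ultimately show False using h(4) by simp
  qed
  moreover have "fiber g v0 \<noteq> 0" "degree (fiber g v0) < k"
    using k(2,3) by (auto simp: fg a_def)
  moreover have "fiber D v0 \<noteq> 0"
  proof
    assume "fiber D v0 = 0"
    then have "coeff (pderiv (fiber f v0)) (k - 1) = 0" by (simp add: fD)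
    then show False using k(2,3) by (simp add: coeff_pderiv)
  qed
  moreover have "degree (fiber D v0) < k"
    using deg[of v0] k(3) by (simp add: fD degree_pderiv)
  ultimately show False using gp Dp by blast
qed

section \<open>Generic lines through a point of low multiplicity\<close>

lemma span_eq_imp_multiple: "vec.span {u} = vec.span {v} \<Longrightarrow> \<exists>c. u = c *s v"
  using vec.span_base[of u "{u}"] by (auto simp: vec.span_singleton)

text \<open>
  Project from \<open>z\<close>, spanned by \<open>e\<close>. On the line through \<open>z\<close> and \<open>v\<close> the equation \<open>f\<close> of \<open>S\<close>
  restricts to a polynomial in the height, of degree at most \<open>k\<close>, where \<open>k\<close> is at least the degree of
  \<open>S\<close> minus its multiplicity at \<open>z\<close>, hence at least 2. The conditions on \<open>v\<close> that the degree is \<open>k\<close>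
  and that the polynomial is not a \<open>k\<close>-th power are given by homogeneous polynomials in the shadow
  of \<open>v\<close>, and they are not void. The roots give the intersection points different from \<open>z\<close>.
\<close>

lemma generic_line_meets_hypersurface_twice:
  fixes S :: "'n::finite ppoint set"
  assumes S: "irreducible_variety S" "hypersurface S" and z: "z \<in> proj_space"
    and mult: "int (hypersurface_mult S z) \<le> int (hypersurface_degree S) - 2"
  shows "generic_line_through z
    (\<lambda>L. (\<exists>q0\<in>L \<inter> S. \<exists>q1\<in>L \<inter> S. q0 \<noteq> q1 \<and> q0 \<noteq> z \<and> q1 \<noteq> z) \<and> \<not> L \<subseteq> S)"
proof -
  have closed: "zariski_closed S" using S(1) by (simp add: irreducible_variety_def)
  then have Ss: "S \<subseteq> proj_space" by (rule zariski_closed_subset)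
  have prime: "prime_on (\<Union>S)" using S(1) by (rule irreducible_imp_prime_on)
  define E where "E = hypersurface_equation S"
  define f where "f = poly_eval E"
  note equation = hypersurface_equation[OF S, folded E_def, folded f_def]
  have f: "f \<in> polyfun" unfolding f_def by simp
  obtain d where d: "homog d f" "hypersurface_degree S \<le> d" using equation(1) by blast
  have in_S: "vec.span {y} \<in> S \<longleftrightarrow> f y = 0" if nz: "y \<noteq> 0" for y
  proof
    assume "vec.span {y} \<in> S"
    then show "f y = 0" using equation(3) vec.span_base[of y "{y}"] by blast
  next
    assume y: "f y = 0"
    show "vec.span {y} \<in> S"
    proof (rule ccontr)
      assume "vec.span {y} \<notin> S"
      then have "y \<notin> \<Union>S" using span_in_iff_cone[OF Ss nz] by simp
      then obtain h where h: "h \<in> polyfun" "\<forall>u\<in>\<Union>S. h u = 0" "h y \<noteq> 0"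
        using not_in_closed_imp_homog[OF closed _ nz] by blast
      have "\<exists>u\<in>polyfun. \<forall>v. h v = u v * f v"
        by (rule equation(4)) (use h in auto)
      then show False using h(3) y by auto
    qed
  qed
  obtain e where e: "e \<in> z" "e \<noteq> 0" using proj_point_nonzero[OF z] by blast
  have ze: "z = vec.span {e}" by (rule proj_point_eq_span[OF z e])
  obtain i0 where "e $ i0 \<noteq> 0" using e(2) by (auto simp: vec_eq_iff)
  then interpret coordinate_projection e i0 by unfold_locales

  \<comment> \<open>\<open>k\<close> is the degree of \<open>f\<close> along general lines through \<open>z\<close>\<close>
  define m where "m = (LEAST m. fiber_bound m f)"
  obtain m0 where "fiber_bound m0 f" using fiber_bound_exists[OF f] by blast
  then have m: "fiber_bound m f" unfolding m_def by (rule LeastI)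
  have "m \<noteq> 0" using m fiber_bound_0[OF f] equation(2) by metis
  then obtain k where mk: "m = Suc k" using not0_implies_Suc by blast
  have bound: "fiber_bound (Suc k) f" using m mk by simp
  have "\<not> fiber_bound k f" using not_less_Least[of k "\<lambda>m. fiber_bound m f"] mk unfolding m_def by simp
  then obtain v0 where v0: "coeff (fiber f v0) k \<noteq> 0"
    using fiber_bound_Suc[OF bound] by blast
  have "coeff (fiber f v0) k = 0" if "d < k"
    using homog_line_poly(1)[OF f d(1), of "shadow v0" e] that
    unfolding fiber_def by (intro coeff_eq_0) simp
  then have kd: "k \<le> d" using v0 by (metis not_le)
  have "E \<in> ideal_power (vanishing_ideal {z}) (d - k)"
    unfolding ze by (rule homog_in_ideal_power) (use d(1) bound in \<open>simp_all add: f_def\<close>)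
  then have "d - k \<le> hypersurface_mult S z"
    using hypersurface_mult_ge[OF e(1), of S "d - k"] equation(2) unfolding E_def f_def by blast
  then have k2: "2 \<le> k" using mult d(2) kd by linarith

  define a where "a i v = coeff (fiber f v) i" for i v
  \<comment> \<open>the factor \<open>a k v\<close> turns the two conditions on \<open>v\<close> into one\<close>
  define H where "H i v = a k v * coeff (root_defect k (fiber f v)) i" for i v
  have ap: "a i \<in> polyfun" for i unfolding a_def by (rule polyfun_coeff_fiber[OF f])
  have Hp: "H i \<in> polyfun" for i
    unfolding H_def coeff_root_defect a_def[symmetric]
    by (intro polyfun_diff polyfun.add polyfun.mult polyfun.const ap)
  have H_shadow: "H i (shadow v) = H i v" for i v
    by (simp add: H_def a_def)
  have ah: "homog (d - i) (a i)" if "i \<le> d" for i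
    using homog_line_poly(3)[OF f d(1) that, of e]
    unfolding a_def fiber_def homog_def shadow_scale by blast
  have Hh: "homog ((d - k) + ((d - k) + (d - i))) (H i)" if "i < k" for i
  proof -
    have eq: "(d - (k - 1)) + (d - Suc i) = (d - k) + (d - i)" using kd that by linarith
    have h1: "homog ((d - k) + (d - i)) (\<lambda>v. of_nat k ^ 2 * (a k v * a i v))"
      by (intro homog_cmult homog_mult ah) (use kd that in linarith)+
    have h2: "homog ((d - (k - 1)) + (d - Suc i)) (\<lambda>v. of_nat (Suc i) * (a (k - 1) v * a (Suc i) v))"
      by (intro homog_cmult homog_mult ah) (use kd that in linarith)+
    have h3: "homog ((d - k) + (d - i)) (\<lambda>v. (of_nat k * of_nat i) * (a k v * a i v))"
      by (intro homog_cmult homog_mult ah) (use kd that in linarith)+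
    have "homog ((d - k) + (d - i)) (\<lambda>v. of_nat k ^ 2 * (a k v * a i v)
        - of_nat (Suc i) * (a (k - 1) v * a (Suc i) v) - of_nat k * of_nat i * (a k v * a i v))"
      by (rule homog_diff[OF homog_diff[OF h1 h2[unfolded eq]] h3])
    moreover have "coeff (root_defect k (fiber f v)) i = of_nat k ^ 2 * (a k v * a i v)
        - of_nat (Suc i) * (a (k - 1) v * a (Suc i) v) - of_nat k * of_nat i * (a k v * a i v)" for v
      unfolding coeff_root_defect a_def[symmetric]
      by (simp only: diff_diff_eq mult.assoc mult.left_commute[of "a (k - 1) v"]
          mult.left_commute[of "a k v" "of_nat i"])
    ultimately show ?thesis unfolding H_def by (intro homog_mult ah[OF kd]) simp
  qed
  have H0: "H i 0 = 0" if "i < k" for i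
  proof -
    have "H i (0 *s 0) = 0 ^ ((d - k) + ((d - k) + (d - i))) * H i 0"
      using Hh[OF that] unfolding homog_def by blast
    moreover have "(d - k) + ((d - k) + (d - i)) \<noteq> 0" using that kd by linarith
    then have "(0::complex) ^ ((d - k) + ((d - k) + (d - i))) = 0" by (simp only: power_0_left if_False)
    ultimately show ?thesis by (simp only: mult_zero_left vec.scale_zero_left)
  qed
  have not_in_z: "shadow v \<noteq> 0" if "i < k" "H i v \<noteq> 0" for i v
    using H0[OF that(1)] H_shadow[of i v] that(2) by auto
  have shadow_z: "shadow y = 0" if "y \<in> z" for y
    using that shadow_direction unfolding ze vec.span_singleton by auto

  define U where "U = {L \<in> lines_through z. \<exists>i<k. \<exists>p\<in>L. \<exists>v\<in>p. H i v \<noteq> 0}"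
  define F where "F = (\<lambda>i. poly_of (H i)) ` {..<k}"
  have "\<forall>h\<in>F. homogeneous_poly h \<and> (\<forall>v. \<forall>w\<in>z. poly_eval h (v + w) = poly_eval h v)" 
  proof
    fix h assume h: "h \<in> F"
    obtain i where i: "i < k" "h = poly_of (H i)" using h unfolding F_def by blast
    have "H i (v + w) = H i v" if w: "w \<in> z" for v w
    proof -
      obtain c where "w = c *s e" using w unfolding ze vec.span_singleton by blast
      then show ?thesis using H_shadow[of i "v + w"] H_shadow[of i v] shadow_plus_multiple by metis
    qed
    then show "homogeneous_poly h \<and> (\<forall>v. \<forall>w\<in>z. poly_eval h (v + w) = poly_eval h v)"
      using i homogeneous_poly_of[OF Hp Hh[OF i(1)]] by (simp add: Hp)
  qed
  moreover have "lines_through z - U = {L \<in> lines_through z. \<forall>h\<in>F. \<forall>p\<in>L. \<forall>v\<in>p. poly_eval h v = 0}"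
    unfolding U_def F_def by (auto simp: Hp)
  ultimately have "zariski_closed_lines z (lines_through z - U)"
    unfolding zariski_closed_lines_def by (rule exI[of _ F, OF conjI])
  moreover have "U \<subseteq> lines_through z" unfolding U_def by (rule Collect_restrict)
  ultimately have U_open: "zariski_open_lines z U"
    unfolding zariski_open_lines_def by simp

  have U_nonempty: "U \<noteq> {}"
  proof -
    obtain v where v: "root_defect k (fiber f v) \<noteq> 0" "a k v \<noteq> 0"
      using root_defect_nonzero[OF prime f equation(3,4) bound v0 k2] unfolding a_def by blast
    obtain i where i: "coeff (root_defect k (fiber f v)) i \<noteq> 0"
      using v(1) by (auto simp: poly_eq_iff)
    have "degree (fiber f v) \<le> k" using bound unfolding fiber_bound_def by (intro degree_le) auto
    then have "i < k" using i coeff_root_defect_high by (metis not_le)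
    have Hv: "H i v \<noteq> 0" using v(2) i by (simp add: H_def)
    have sv: "shadow v \<noteq> 0" by (rule not_in_z[OF \<open>i < k\<close> Hv])
    then have "v \<noteq> 0" using shadow_z vec.subspace_0[OF proj_point_subspace[OF z]] by auto
    have "v \<notin> vec.span {e}" using shadow_z sv ze by blast
    then have "vec.independent {v, e}" "v \<noteq> e"
      using e(2) vec.span_base[of e "{e}"] by (auto simp: vec.independent_insert)
    then have "vec.dim (vec.span {v, e}) = 2"
      by (simp add: vec.dim_eq_card_independent)
    then have "proj_line (proj_linear (vec.span {v, e}))"
      unfolding proj_line_def by (intro exI[of _ "vec.span {v, e}"]) simp
    moreover have "z \<in> proj_linear (vec.span {v, e})"
      using z unfolding proj_linear_def ze by (simp add: vec.span_mono)
    moreover have "vec.span {v} \<in> proj_linear (vec.span {v, e})"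
      using span_in_proj_space[OF \<open>v \<noteq> 0\<close>] unfolding proj_linear_def by (simp add: vec.span_mono)
    ultimately have "proj_linear (vec.span {v, e}) \<in> U"
      using Hv \<open>i < k\<close> vec.span_base[of v "{v}"] unfolding U_def lines_through_def by blast
    then show ?thesis by blast
  qed

  have U_twice: "(\<exists>q0\<in>L \<inter> S. \<exists>q1\<in>L \<inter> S. q0 \<noteq> q1 \<and> q0 \<noteq> z \<and> q1 \<noteq> z) \<and> \<not> L \<subseteq> S" if "L \<in> U" for L
  proof -
    obtain i p v where L: "L \<in> lines_through z" "i < k" "p \<in> L" "v \<in> p" "H i v \<noteq> 0"
      using \<open>L \<in> U\<close> unfolding U_def by blast
    obtain W where W: "vec.subspace W" "L = proj_linear W"
      using L(1) unfolding lines_through_def proj_line_def by blast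
    have "v \<in> W" "e \<in> W" using L W e(1) unfolding lines_through_def proj_linear_def by auto
    \<comment> \<open>representatives of the points of \<open>L\<close> other than \<open>z\<close>\<close>
    define y where "y t = shadow v + t *s e" for t
    have yW: "y t \<in> W" for t
      unfolding y_def shadow_def using W(1) \<open>v \<in> W\<close> \<open>e \<in> W\<close>
      by (intro vec.subspace_add vec.subspace_diff vec.subspace_scale)
    have sy: "shadow (y t) = shadow v" "height (y t) = t" for t by (simp_all add: y_def)
    have sv: "shadow v \<noteq> 0" by (rule not_in_z[OF L(2,5)])
    have y0: "y t \<noteq> 0" for t
      using sv sy(1)[of t] shadow_z[OF vec.subspace_0[OF proj_point_subspace[OF z]]] by metis
    have yL: "vec.span {y t} \<in> L" for t
      using span_in_proj_space[OF y0] yW W(1) unfolding W(2) proj_linear_def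
      by (simp add: vec.span_minimal)
    have yz: "vec.span {y t} \<noteq> z" for t
      using shadow_z[of "y t"] sy(1)[of t] sv vec.span_base[of "y t" "{y t}"] by auto
    have y_inj: "s = t" if eq: "vec.span {y s} = vec.span {y t}" for s t
    proof -
      obtain c where c: "y s = c *s y t" using span_eq_imp_multiple[OF eq] by blast
      then have "shadow v = c *s shadow v" using sy(1) shadow_scale by metis
      then have "c = 1" using sv by (metis vec.scale_cancel_right vec.scale_one)
      then have "y s = y t" using c by (simp only: vec.scale_one)
      then show ?thesis using sy(2) by metis
    qed
    have yS: "vec.span {y t} \<in> S \<longleftrightarrow> poly (fiber f v) t = 0" for t
      using in_S[OF y0] by (simp add: poly_fiber f y_def)
    have top: "coeff (fiber f v) k \<noteq> 0" "root_defect k (fiber f v) \<noteq> 0"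
      using L(5) by (auto simp: H_def a_def)
    have "degree (fiber f v) = k"
    proof (rule antisym)
      show "degree (fiber f v) \<le> k" using bound unfolding fiber_bound_def by (intro degree_le) auto
      show "k \<le> degree (fiber f v)" using top(1) by (rule le_degree)
    qed
    then obtain s t where st: "s \<noteq> t" "poly (fiber f v) s = 0" "poly (fiber f v) t = 0"
      using two_roots[of "fiber f v" k] k2 top(2) by auto
    have "\<exists>q0\<in>L \<inter> S. \<exists>q1\<in>L \<inter> S. q0 \<noteq> q1 \<and> q0 \<noteq> z \<and> q1 \<noteq> z"
      using yL yS yz y_inj st
      by (intro bexI[of _ "vec.span {y s}"] bexI[of _ "vec.span {y t}"]) auto
    moreover obtain t' where "poly (fiber f v) t' \<noteq> 0"
      using top(1) poly_all_0_iff_0[of "fiber f v"] by auto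
    then have "\<not> L \<subseteq> S" using yL[of t'] yS[of t'] by blast
    ultimately show ?thesis by blast
  qed
  show ?thesis
    unfolding generic_line_through_def
    by (intro exI[of _ U] conjI[OF U_open conjI[OF U_nonempty]] ballI U_twice)
qed

text \<open>
  For \<open>S\<close> the secant variety, the two points found on \<open>L\<close> are \<open>q0\<close> and \<open>q1\<close>, and \<open>z\<close> is itself the
  required point of \<open>X\<close>.
\<close>

theorem proposition4p5:
  fixes X :: "'n::finite ppoint set" and z :: "'n ppoint" and r :: nat
  assumes "r \<ge> 2"
    and "irreducible_variety X"
    and "nondegenerate X"
    and "hypersurface (secant_variety r X)"
    and "z \<in> X"
    and "int (hypersurface_mult (secant_variety r X) z)
           \<le> int (hypersurface_degree (secant_variety r X)) - 2"
  shows "generic_line_through z (secant_double_drop r X)"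
proof -
  let ?S = "secant_variety r X"
  have closed: "zariski_closed ?S" "?S \<noteq> {}"
    using assms(4) by (auto simp: hypersurface_def)
  have "irreducible_variety ?S"
    by (rule prime_on_imp_irreducible[OF closed prime_on_secant_variety[OF assms(2) closed(1)]])
  moreover have "z \<in> proj_space"
    using assms(2,5) zariski_closed_subset unfolding irreducible_variety_def by blast
  ultimately have "generic_line_through z
      (\<lambda>L. (\<exists>q0\<in>L \<inter> ?S. \<exists>q1\<in>L \<inter> ?S. q0 \<noteq> q1 \<and> q0 \<noteq> z \<and> q1 \<noteq> z) \<and> \<not> L \<subseteq> ?S)"
    using assms(4,6) by (intro generic_line_meets_hypersurface_twice)
  then obtain U where U: "zariski_open_lines z U" "U \<noteq> {}"
    "\<forall>L\<in>U. (\<exists>q0\<in>L \<inter> ?S. \<exists>q1\<in>L \<inter> ?S. q0 \<noteq> q1 \<and> q0 \<noteq> z \<and> q1 \<noteq> z) \<and> \<not> L \<subseteq> ?S"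
    unfolding generic_line_through_def by (elim exE conjE)
  have "secant_double_drop r X L" if "L \<in> U" for L
  proof -
    have "proj_line L" "z \<in> L"
      using U(1) that unfolding zariski_open_lines_def lines_through_def by auto
    then show ?thesis
      unfolding secant_double_drop_def using bspec[OF U(3) that] assms(5) by blast
  qed
  then show ?thesis
    unfolding generic_line_through_def
    by (intro exI[of _ U] conjI[OF U(1) conjI[OF U(2)]] ballI)
qed

end
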